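(* Let $\mathcal{E}$ be a deflation-exact category satisfying axiom R0$^*$. The following are equivalent: (1) Axiom R3$^+$ holds in $\mathcal{E}$. (2) $\mathcal{E}$ is weakly idempotent complete and axiom R3 holds in $\mathcal{E}$. (3) If $\begin{pmatrix}0&g\end{pmatrix}\colon X\oplus Y\to Z$ is a deflation, then $g\colon Y\to Z$ is a deflation. (4) A morphism $g\colon Y\to Z$ is a deflation if and only if there exists a deflation $f\colon X\twoheadrightarrow Y$ such that $g\circ f$ is a deflation. (5) The ker-coker-sequence property holds: for all admissible morphisms $f\colon A\to B$ and $g\colon B\to C$ such that $h=g\circ f$ is admissible, there is a natural exact sequence $$0\to\ker(f)\to\ker(h)\to\ker(g)\to\operatorname{coker}(f)\to\operatorname{coker}(h)\to\operatorname{coker}(g)\to0.$$ (6a) The short snake lemma holds: for every commutative diagram with rows conflations $A_1\rightarrowtail A_2\twoheadrightarrow A_3$ and $B_1\rightarrowtail B_2\twoheadrightarrow B_3$ and with admissible vertical morphisms $f_i\colon A_i\to B_i$ ($i=1,2,3$), writing $K_i=\ker(f_i)$ and $C_i=\operatorname{coker}(f_i)$, there is a natural connecting morphism $\delta\colon K_3\to C_1$ such that the sequence $$0\to K_1\to K_2\to K_3\xrightarrow{\delta}C_1\to C_2\to C_3\to0,$$ whose other maps are induced by the diagram, is exact. (6b) The snake lemma holds: for every commutative diagram with exact rows $A_1\xrightarrow{\phi_1}A_2\xrightarrow{\phi_2}A_3\to0$ and $0\to B_1\xrightarrow{\phi_1'}B_2\xrightarrow{\phi_2'}B_3$ in which $\phi_1,\phi_2,\phi_1',\phi_2'$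 and the vertical morphisms $f_i\colon A_i\to B_i$ ($i=1,2,3$) are admissible, writing $K_i=\ker(f_i)$ and $C_i=\operatorname{coker}(f_i)$, there is an induced exact sequence $$0\to\ker(\phi_1)\to K_1\to K_2\to K_3\to C_1\to C_2\to C_3\to\operatorname{coker}(\phi_2')\to0.$$ (7) Deflations are closed under retracts, i.e. for every commutative square given by morphisms $g\colon Y\to Z$, $g'\colon Y'\to Z'$, $r\colon Y\to Y'$, $s\colon Z\to Z'$ with $s\circ g=g'\circ r$ and with $r,s$ retractions, if $g$ is a deflation, then $g'$ is a deflation. (8) Deflations are closed under direct summands, i.e. for any two morphisms $g\colon Y\to Z$ and $g'\colon Y'\to Z'$, if the direct sum $g\oplus g'\colon Y\oplus Y'\to Z\oplus Z'$ is a deflation, then $g$ and $g'$ are deflations.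
   Context: A conflation category is a pair $\mathcal{E}=(\mathcal{A},\mathbb{D})$ with $\mathcal{A}$ an additive category and $\mathbb{D}$ a class of kernel-cokernel pairs $X\xrightarrow{f}Y\xrightarrow{g}Z$, closed under isomorphisms; its members are called conflations, the kernel part is called an inflation ($\rightarrowtail$) and the cokernel part a deflation ($\twoheadrightarrow$). $\mathcal{E}$ is deflation-exact if: (R0) $1_0\colon 0\to0$ is a deflation; (R1) deflations are closed under composition; (R2) the pullback of any morphism along a deflation exists, and deflations are stable under pullbacks. Axiom R0$^*$: for every $A\in\mathcal{E}$, $A\to0$ is a deflation (equivalently, all split kernel-cokernel pairs are conflations). Axiom R3: if $i\colon A\to B$, $p\colon B\to C$ are morphisms such that $p$ has a kernel and $p\circ i$ is a deflation, then $p$ is a deflation. Axiom R3$^+$: if a composition $Y'\xrightarrow{f'}Y\xrightarrow{g}Z$ is a deflation, then $g$ is a deflation. An additive category is weakly idempotent complete if every retraction (morphism $f$ having a right inverse) has a kernel. A morphism is admissible if it factors as a deflation followed by an inflation; such a morphism has a kernel and a cokernel. A sequence $\cdots\to X_j\xrightarrow{f_j}X_{j+1}\to\cdots$ is exact (acyclic) if each $f_j$ factors as $f_j=\iota_j\circ\rho_j$ with $\rho_j\colon X_j\twoheadrightarrow\operatorname{im}(f_j)$ a deflation and $\iota_j\colon\operatorname{im}(f_j)\rightarrowtail X_{j+1}$ an inflation such that $\iota_j=\ker(f_{j+1})$ and $\rho_j=\operatorname{coker}(f_{j-1})$ for all $j$ (whenever these are defined). For the sequence $A_1\to A_2\to A_3\to0$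 exactness means in particular that $\phi_2$ is a deflation; for $0\to B_1\to B_2\to B_3$ it means in particular that $\phi_1'$ is an inflation. In (5), the maps are the natural ones: $\ker(f)\to\ker(h)$ and $\operatorname{coker}(h)\to\operatorname{coker}(g)$ are the canonical maps, $\ker(h)\to\ker(g)$ is induced by $f$, $\operatorname{coker}(f)\to\operatorname{coker}(h)$ is induced by $g$, and $\ker(g)\to\operatorname{coker}(f)$ is the composite $\ker(g)\to B\to\operatorname{coker}(f)$. *)

theory Defs
  imports "HOL-Algebra.Group"
begin

section \<open>Additive categories\<close>

text \<open>Small categories in the style of HOL-Algebra: a record of carriers and operations, the laws
  being collected in locales. \<open>Comp E g f\<close>, written \<open>g \<cdot>\<^bsub>E\<^esub> f\<close>, is the composite
  ``first f, then g''. The values of the operations outside the carriers are irrelevant.\<close>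

record ('o, 'm) additive_structure =
  Obj :: "'o set"
  Arr :: "'m set"
  Dom :: "'m \<Rightarrow> 'o"
  Cod :: "'m \<Rightarrow> 'o"
  Ident :: "'o \<Rightarrow> 'm"
  Comp :: "'m \<Rightarrow> 'm \<Rightarrow> 'm"  (infixl "\<cdot>\<index>" 70)
  Plus :: "'m \<Rightarrow> 'm \<Rightarrow> 'm"
  Zero :: "'o \<Rightarrow> 'o \<Rightarrow> 'm"

definition Hom :: "('o, 'm, 'z) additive_structure_scheme \<Rightarrow> 'o \<Rightarrow> 'o \<Rightarrow> 'm set" where
  "Hom E X Y = {f \<in> Arr E. Dom E f = X \<and> Cod E f = Y}"

definition hom_group :: "('o, 'm, 'z) additive_structure_scheme \<Rightarrow> 'o \<Rightarrow> 'o \<Rightarrow> 'm monoid" where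
  "hom_group E X Y = \<lparr>carrier = Hom E X Y, monoid.mult = Plus E, one = Zero E X Y\<rparr>"

definition zero_object :: "('o, 'm, 'z) additive_structure_scheme \<Rightarrow> 'o \<Rightarrow> bool" where
  "zero_object E Z \<longleftrightarrow> Z \<in> Obj E \<and>
     (\<forall>X\<in>Obj E. (\<exists>!f. f \<in> Hom E X Z) \<and> (\<exists>!f. f \<in> Hom E Z X))"

text \<open>A fixed zero object \<open>0\<close>; the maps \<open>0 \<rightarrow> X\<close> and \<open>X \<rightarrow> 0\<close> are
  \<open>Zero E (zobj E) X\<close> and \<open>Zero E X (zobj E)\<close>.\<close>

definition zobj :: "('o, 'm, 'z) additive_structure_scheme \<Rightarrow> 'o" where
  "zobj E = (SOME Z. zero_object E Z)"

definition biproduct ::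
  "('o, 'm, 'z) additive_structure_scheme \<Rightarrow> 'o \<Rightarrow> 'o \<Rightarrow> 'o \<Rightarrow> 'm \<Rightarrow> 'm \<Rightarrow> 'm \<Rightarrow> 'm \<Rightarrow> bool" where
  "biproduct E X Y P i1 i2 p1 p2 \<longleftrightarrow>
     X \<in> Obj E \<and> Y \<in> Obj E \<and> P \<in> Obj E \<and>
     i1 \<in> Hom E X P \<and> i2 \<in> Hom E Y P \<and> p1 \<in> Hom E P X \<and> p2 \<in> Hom E P Y \<and>
     p1 \<cdot>\<^bsub>E\<^esub> i1 = Ident E X \<and> p2 \<cdot>\<^bsub>E\<^esub> i2 = Ident E Y \<and>
     p1 \<cdot>\<^bsub>E\<^esub> i2 = Zero E Y X \<and> p2 \<cdot>\<^bsub>E\<^esub> i1 = Zero E X Y \<and>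
     Plus E (i1 \<cdot>\<^bsub>E\<^esub> p1) (i2 \<cdot>\<^bsub>E\<^esub> p2) = Ident E P"

locale additive_category =
  fixes E :: "('o, 'm, 'z) additive_structure_scheme" (structure)
  assumes Dom_closed: "f \<in> Arr E \<Longrightarrow> Dom E f \<in> Obj E"
    and Cod_closed: "f \<in> Arr E \<Longrightarrow> Cod E f \<in> Obj E"
    and Ident_closed: "X \<in> Obj E \<Longrightarrow> Ident E X \<in> Hom E X X"
    and Comp_closed: "\<lbrakk>f \<in> Hom E X Y; g \<in> Hom E Y Z\<rbrakk> \<Longrightarrow> g \<cdot> f \<in> Hom E X Z"
    and Ident_right: "f \<in> Hom E X Y \<Longrightarrow> f \<cdot> Ident E X = f"
    and Ident_left: "f \<in> Hom E X Y \<Longrightarrow> Ident E Y \<cdot> f = f"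
    and Comp_assoc: "\<lbrakk>f \<in> Hom E W X; g \<in> Hom E X Y; h \<in> Hom E Y Z\<rbrakk>
          \<Longrightarrow> h \<cdot> (g \<cdot> f) = (h \<cdot> g) \<cdot> f"
    and Hom_comm_group: "\<lbrakk>X \<in> Obj E; Y \<in> Obj E\<rbrakk> \<Longrightarrow> comm_group (hom_group E X Y)"
    and Comp_Plus_right: "\<lbrakk>f \<in> Hom E X Y; f' \<in> Hom E X Y; g \<in> Hom E Y Z\<rbrakk>
          \<Longrightarrow> g \<cdot> Plus E f f' = Plus E (g \<cdot> f) (g \<cdot> f')"
    and Comp_Plus_left: "\<lbrakk>f \<in> Hom E X Y; g \<in> Hom E Y Z; g' \<in> Hom E Y Z\<rbrakk>
          \<Longrightarrow> Plus E g g' \<cdot> f = Plus E (g \<cdot> f) (g' \<cdot> f)"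
    and zero_object_exists: "\<exists>Z. zero_object E Z"
    and biproduct_exists: "\<lbrakk>X \<in> Obj E; Y \<in> Obj E\<rbrakk>
          \<Longrightarrow> \<exists>P i1 i2 p1 p2. biproduct E X Y P i1 i2 p1 p2"

definition iso_arr :: "('o, 'm, 'z) additive_structure_scheme \<Rightarrow> 'm \<Rightarrow> bool" where
  "iso_arr E f \<longleftrightarrow> f \<in> Arr E \<and>
     (\<exists>g \<in> Hom E (Cod E f) (Dom E f). g \<cdot>\<^bsub>E\<^esub> f = Ident E (Dom E f) \<and> f \<cdot>\<^bsub>E\<^esub> g = Ident E (Cod E f))"

definition retraction :: "('o, 'm, 'z) additive_structure_scheme \<Rightarrow> 'm \<Rightarrow> bool" where
  "retraction E f \<longleftrightarrow> f \<in> Arr E \<and>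
     (\<exists>s \<in> Hom E (Cod E f) (Dom E f). f \<cdot>\<^bsub>E\<^esub> s = Ident E (Cod E f))"

text \<open>\<open>is_kernel E k f\<close>: the arrow \<open>k\<close> is a kernel of \<open>f\<close>;
  \<open>is_cokernel E c f\<close>: the arrow \<open>c\<close> is a cokernel of \<open>f\<close>.\<close>

definition is_kernel :: "('o, 'm, 'z) additive_structure_scheme \<Rightarrow> 'm \<Rightarrow> 'm \<Rightarrow> bool" where
  "is_kernel E k f \<longleftrightarrow> k \<in> Arr E \<and> f \<in> Arr E \<and> Cod E k = Dom E f \<and>
     f \<cdot>\<^bsub>E\<^esub> k = Zero E (Dom E k) (Cod E f) \<and>
     (\<forall>T. \<forall>t \<in> Hom E T (Dom E f). f \<cdot>\<^bsub>E\<^esub> t = Zero E T (Cod E f) \<longrightarrow>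
        (\<exists>!u. u \<in> Hom E T (Dom E k) \<and> k \<cdot>\<^bsub>E\<^esub> u = t))"

definition is_cokernel :: "('o, 'm, 'z) additive_structure_scheme \<Rightarrow> 'm \<Rightarrow> 'm \<Rightarrow> bool" where
  "is_cokernel E c f \<longleftrightarrow> c \<in> Arr E \<and> f \<in> Arr E \<and> Dom E c = Cod E f \<and>
     c \<cdot>\<^bsub>E\<^esub> f = Zero E (Dom E f) (Cod E c) \<and>
     (\<forall>T. \<forall>t \<in> Hom E (Cod E f) T. t \<cdot>\<^bsub>E\<^esub> f = Zero E (Dom E f) T \<longrightarrow>
        (\<exists>!u. u \<in> Hom E (Cod E c) T \<and> u \<cdot>\<^bsub>E\<^esub> c = t))"

definition kernel_cokernel_pair :: "('o, 'm, 'z) additive_structure_scheme \<Rightarrow> 'm \<Rightarrow> 'm \<Rightarrow> bool" where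
  "kernel_cokernel_pair E f g \<longleftrightarrow> is_kernel E f g \<and> is_cokernel E g f"

text \<open>The square with \<open>p : P \<rightarrow> Dom g\<close>, \<open>q : P \<rightarrow> Dom h\<close> and \<open>g p = h q\<close> is a pullback;
  thus \<open>q\<close> is the pullback of \<open>g\<close> along \<open>h\<close>.\<close>

definition is_pullback ::
  "('o, 'm, 'z) additive_structure_scheme \<Rightarrow> 'm \<Rightarrow> 'm \<Rightarrow> 'm \<Rightarrow> 'm \<Rightarrow> bool" where
  "is_pullback E p q g h \<longleftrightarrow>
     p \<in> Arr E \<and> q \<in> Arr E \<and> g \<in> Arr E \<and> h \<in> Arr E \<and>
     Dom E p = Dom E q \<and> Cod E p = Dom E g \<and> Cod E q = Dom E h \<and> Cod E g = Cod E h \<and>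
     g \<cdot>\<^bsub>E\<^esub> p = h \<cdot>\<^bsub>E\<^esub> q \<and>
     (\<forall>T. \<forall>s \<in> Hom E T (Dom E g). \<forall>t \<in> Hom E T (Dom E h). g \<cdot>\<^bsub>E\<^esub> s = h \<cdot>\<^bsub>E\<^esub> t \<longrightarrow>
        (\<exists>!u. u \<in> Hom E T (Dom E p) \<and> p \<cdot>\<^bsub>E\<^esub> u = s \<and> q \<cdot>\<^bsub>E\<^esub> u = t))"


section \<open>Conflation categories and deflation-exact categories\<close>

record ('o, 'm) conflation_structure = "('o, 'm) additive_structure" +
  conflations :: "('m \<times> 'm) set"

definition inflation :: "('o, 'm, 'z) conflation_structure_scheme \<Rightarrow> 'm \<Rightarrow> bool" where
  "inflation E f \<longleftrightarrow> (\<exists>g. (f, g) \<in> conflations E)"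

definition deflation :: "('o, 'm, 'z) conflation_structure_scheme \<Rightarrow> 'm \<Rightarrow> bool" where
  "deflation E g \<longleftrightarrow> (\<exists>f. (f, g) \<in> conflations E)"

locale conflation_category = additive_category E
  for E :: "('o, 'm, 'z) conflation_structure_scheme" (structure) +
  assumes conflation_kernel_cokernel:
      "(f, g) \<in> conflations E \<Longrightarrow> kernel_cokernel_pair E f g"
    and conflation_iso_closed:
      "\<lbrakk>(f, g) \<in> conflations E; kernel_cokernel_pair E f' g';
        a \<in> Hom E (Dom E f) (Dom E f'); b \<in> Hom E (Cod E f) (Cod E f');
        c \<in> Hom E (Cod E g) (Cod E g');
        iso_arr E a; iso_arr E b; iso_arr E c; b \<cdot> f = f' \<cdot> a; c \<cdot> g = g' \<cdot> b\<rbrakk>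
       \<Longrightarrow> (f', g') \<in> conflations E"

locale deflation_exact_category = conflation_category E
  for E :: "('o, 'm, 'z) conflation_structure_scheme" (structure) +
  assumes R0: "deflation E (Ident E (zobj E))"
    and R1: "\<lbrakk>deflation E f; deflation E g; Cod E f = Dom E g\<rbrakk> \<Longrightarrow> deflation E (g \<cdot> f)"
    and R2_exists: "\<lbrakk>deflation E g; h \<in> Arr E; Cod E h = Cod E g\<rbrakk> \<Longrightarrow> \<exists>p q. is_pullback E p q g h"
    and R2_stable: "\<lbrakk>deflation E g; is_pullback E p q g h\<rbrakk> \<Longrightarrow> deflation E q"

definition axiom_R0_star :: "('o, 'm, 'z) conflation_structure_scheme \<Rightarrow> bool" where
  "axiom_R0_star E \<longleftrightarrow> (\<forall>A\<in>Obj E. deflation E (Zero E A (zobj E)))"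

definition axiom_R3 :: "('o, 'm, 'z) conflation_structure_scheme \<Rightarrow> bool" where
  "axiom_R3 E \<longleftrightarrow> (\<forall>A B C. \<forall>i \<in> Hom E A B. \<forall>p \<in> Hom E B C.
     (\<exists>k. is_kernel E k p) \<longrightarrow> deflation E (p \<cdot>\<^bsub>E\<^esub> i) \<longrightarrow> deflation E p)"

definition axiom_R3_plus :: "('o, 'm, 'z) conflation_structure_scheme \<Rightarrow> bool" where
  "axiom_R3_plus E \<longleftrightarrow> (\<forall>Y' Y Z. \<forall>f' \<in> Hom E Y' Y. \<forall>g \<in> Hom E Y Z.
     deflation E (g \<cdot>\<^bsub>E\<^esub> f') \<longrightarrow> deflation E g)"

definition weakly_idempotent_complete :: "('o, 'm, 'z) additive_structure_scheme \<Rightarrow> bool" where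
  "weakly_idempotent_complete E \<longleftrightarrow> (\<forall>f. retraction E f \<longrightarrow> (\<exists>k. is_kernel E k f))"

definition admissible :: "('o, 'm, 'z) conflation_structure_scheme \<Rightarrow> 'm \<Rightarrow> bool" where
  "admissible E f \<longleftrightarrow>
     (\<exists>\<rho> \<iota>. deflation E \<rho> \<and> inflation E \<iota> \<and> Cod E \<rho> = Dom E \<iota> \<and> f = \<iota> \<cdot>\<^bsub>E\<^esub> \<rho>)"

text \<open>A finite sequence is given by the list of its arrows; the kernel condition makes
  consecutive arrows composable. The condition on the left neighbour is void for the first arrow,
  that on the right neighbour for the last one.\<close>

definition exact_seq :: "('o, 'm, 'z) conflation_structure_scheme \<Rightarrow> 'm list \<Rightarrow> bool" where
  "exact_seq E fs \<longleftrightarrow> (\<forall>j < length fs. \<exists>\<rho> \<iota>.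
     deflation E \<rho> \<and> inflation E \<iota> \<and> Cod E \<rho> = Dom E \<iota> \<and> fs ! j = \<iota> \<cdot>\<^bsub>E\<^esub> \<rho> \<and>
     (Suc j < length fs \<longrightarrow> is_kernel E \<iota> (fs ! Suc j)) \<and>
     (0 < j \<longrightarrow> is_cokernel E \<rho> (fs ! (j - 1))))"


section \<open>Closure properties of deflations\<close>

text \<open>The arrow \<open>m\<close> below is the row matrix \<open>(0 g)\<close>, given by its components on the summands.\<close>

definition zero_summand_cancellation :: "('o, 'm, 'z) conflation_structure_scheme \<Rightarrow> bool" where
  "zero_summand_cancellation E \<longleftrightarrow>
     (\<forall>X Y Z P i1 i2 p1 p2 g m.
        biproduct E X Y P i1 i2 p1 p2 \<longrightarrow> g \<in> Hom E Y Z \<longrightarrow>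
        m \<in> Hom E P Z \<longrightarrow> m \<cdot>\<^bsub>E\<^esub> i1 = Zero E X Z \<longrightarrow> m \<cdot>\<^bsub>E\<^esub> i2 = g \<longrightarrow>
        deflation E m \<longrightarrow> deflation E g)"

definition deflation_criterion :: "('o, 'm, 'z) conflation_structure_scheme \<Rightarrow> bool" where
  "deflation_criterion E \<longleftrightarrow>
     (\<forall>Y Z. \<forall>g \<in> Hom E Y Z.
        deflation E g \<longleftrightarrow> (\<exists>X. \<exists>f \<in> Hom E X Y. deflation E f \<and> deflation E (g \<cdot>\<^bsub>E\<^esub> f)))"

definition deflations_closed_under_retracts :: "('o, 'm, 'z) conflation_structure_scheme \<Rightarrow> bool" where
  "deflations_closed_under_retracts E \<longleftrightarrow>
     (\<forall>Y Z Y' Z'. \<forall>g \<in> Hom E Y Z. \<forall>g' \<in> Hom E Y' Z'. \<forall>r \<in> Hom E Y Y'. \<forall>s \<in> Hom E Z Z'.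
        s \<cdot>\<^bsub>E\<^esub> g = g' \<cdot>\<^bsub>E\<^esub> r \<longrightarrow> retraction E r \<longrightarrow> retraction E s \<longrightarrow>
        deflation E g \<longrightarrow> deflation E g')"

text \<open>The arrow \<open>m\<close> below is \<open>g \<oplus> g'\<close>.\<close>

definition deflations_closed_under_summands :: "('o, 'm, 'z) conflation_structure_scheme \<Rightarrow> bool" where
  "deflations_closed_under_summands E \<longleftrightarrow>
     (\<forall>Y Y' P i i' p p' Z Z' Q j j' q q' g g' m.
        biproduct E Y Y' P i i' p p' \<longrightarrow> biproduct E Z Z' Q j j' q q' \<longrightarrow>
        g \<in> Hom E Y Z \<longrightarrow> g' \<in> Hom E Y' Z' \<longrightarrow>
        m \<in> Hom E P Q \<longrightarrow> m \<cdot>\<^bsub>E\<^esub> i = j \<cdot>\<^bsub>E\<^esub> g \<longrightarrow> m \<cdot>\<^bsub>E\<^esub> i' = j' \<cdot>\<^bsub>E\<^esub> g' \<longrightarrow>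
        deflation E m \<longrightarrow> deflation E g \<and> deflation E g')"


section \<open>The ker-coker-sequence and the snake lemmas\<close>

text \<open>An admissible arrow has a kernel and a cokernel, so quantifying universally over all choices
  of them is not vacuous. The maps \<open>a, b, d, e\<close> are uniquely determined by their equations.\<close>

definition ker_coker_sequence_property :: "('o, 'm, 'z) conflation_structure_scheme \<Rightarrow> bool" where
  "ker_coker_sequence_property E \<longleftrightarrow>
     (\<forall>A B C. \<forall>f \<in> Hom E A B. \<forall>g \<in> Hom E B C. \<forall>kf kg kh cf cg ch.
        let h = g \<cdot>\<^bsub>E\<^esub> f in
        admissible E f \<longrightarrow> admissible E g \<longrightarrow> admissible E h \<longrightarrow>
        is_kernel E kf f \<longrightarrow> is_kernel E kg g \<longrightarrow> is_kernel E kh h \<longrightarrow>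
        is_cokernel E cf f \<longrightarrow> is_cokernel E cg g \<longrightarrow> is_cokernel E ch h \<longrightarrow>
        (\<exists>a \<in> Hom E (Dom E kf) (Dom E kh). \<exists>b \<in> Hom E (Dom E kh) (Dom E kg).
         \<exists>d \<in> Hom E (Cod E cf) (Cod E ch). \<exists>e \<in> Hom E (Cod E ch) (Cod E cg).
           kh \<cdot>\<^bsub>E\<^esub> a = kf \<and> kg \<cdot>\<^bsub>E\<^esub> b = f \<cdot>\<^bsub>E\<^esub> kh \<and> d \<cdot>\<^bsub>E\<^esub> cf = ch \<cdot>\<^bsub>E\<^esub> g \<and> e \<cdot>\<^bsub>E\<^esub> ch = cg \<and>
           exact_seq E [Zero E (zobj E) (Dom E kf), a, b, cf \<cdot>\<^bsub>E\<^esub> kg, d, e, Zero E (Cod E cg) (zobj E)]))"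

text \<open>
  A snake diagram together with chosen kernels \<open>ker\<^sub>i : K\<^sub>i \<rightarrow> A\<^sub>i\<close> and cokernels
  \<open>cok\<^sub>i : B\<^sub>i \<rightarrow> C\<^sub>i\<close> of the vertical arrows \<open>vert\<^sub>i : A\<^sub>i \<rightarrow> B\<^sub>i\<close>. The rows are
  \<open>top1 : A\<^sub>1 \<rightarrow> A\<^sub>2\<close>, \<open>top2 : A\<^sub>2 \<rightarrow> A\<^sub>3\<close> and \<open>bot1 : B\<^sub>1 \<rightarrow> B\<^sub>2\<close>, \<open>bot2 : B\<^sub>2 \<rightarrow> B\<^sub>3\<close>.\<close>

record 'm snake =
  top1 :: 'm
  top2 :: 'm
  bot1 :: 'm
  bot2 :: 'm
  vert1 :: 'm
  vert2 :: 'm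
  vert3 :: 'm
  ker1 :: 'm
  ker2 :: 'm
  ker3 :: 'm
  cok1 :: 'm
  cok2 :: 'm
  cok3 :: 'm

definition snake_diagram :: "('o, 'm, 'z) conflation_structure_scheme \<Rightarrow> 'm snake \<Rightarrow> bool" where
  "snake_diagram E S \<longleftrightarrow>
     (\<exists>A1 A2 A3 B1 B2 B3.
        top1 S \<in> Hom E A1 A2 \<and> top2 S \<in> Hom E A2 A3 \<and>
        bot1 S \<in> Hom E B1 B2 \<and> bot2 S \<in> Hom E B2 B3 \<and>
        vert1 S \<in> Hom E A1 B1 \<and> vert2 S \<in> Hom E A2 B2 \<and> vert3 S \<in> Hom E A3 B3) \<and>
     vert2 S \<cdot>\<^bsub>E\<^esub> top1 S = bot1 S \<cdot>\<^bsub>E\<^esub> vert1 S \<and>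
     vert3 S \<cdot>\<^bsub>E\<^esub> top2 S = bot2 S \<cdot>\<^bsub>E\<^esub> vert2 S \<and>
     admissible E (vert1 S) \<and> admissible E (vert2 S) \<and> admissible E (vert3 S) \<and>
     is_kernel E (ker1 S) (vert1 S) \<and> is_kernel E (ker2 S) (vert2 S) \<and> is_kernel E (ker3 S) (vert3 S) \<and>
     is_cokernel E (cok1 S) (vert1 S) \<and> is_cokernel E (cok2 S) (vert2 S) \<and> is_cokernel E (cok3 S) (vert3 S)"

definition short_snake_diagram :: "('o, 'm, 'z) conflation_structure_scheme \<Rightarrow> 'm snake \<Rightarrow> bool" where
  "short_snake_diagram E S \<longleftrightarrow> snake_diagram E S \<and>
     (top1 S, top2 S) \<in> conflations E \<and> (bot1 S, bot2 S) \<in> conflations E"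

definition long_snake_diagram :: "('o, 'm, 'z) conflation_structure_scheme \<Rightarrow> 'm snake \<Rightarrow> bool" where
  "long_snake_diagram E S \<longleftrightarrow> snake_diagram E S \<and>
     admissible E (top1 S) \<and> admissible E (top2 S) \<and> admissible E (bot1 S) \<and> admissible E (bot2 S) \<and>
     exact_seq E [top1 S, top2 S, Zero E (Cod E (top2 S)) (zobj E)] \<and>
     exact_seq E [Zero E (zobj E) (Dom E (bot1 S)), bot1 S, bot2 S]"

text \<open>The maps \<open>K\<^sub>1 \<rightarrow> K\<^sub>2 \<rightarrow> K\<^sub>3\<close> and \<open>C\<^sub>1 \<rightarrow> C\<^sub>2 \<rightarrow> C\<^sub>3\<close> induced by the diagram.\<close>

definition snake_induced ::
  "('o, 'm, 'z) conflation_structure_scheme \<Rightarrow> 'm snake \<Rightarrow> 'm \<Rightarrow> 'm \<Rightarrow> 'm \<Rightarrow> 'm \<Rightarrow> bool" where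
  "snake_induced E S \<kappa>1 \<kappa>2 \<gamma>1 \<gamma>2 \<longleftrightarrow>
     \<kappa>1 \<in> Hom E (Dom E (ker1 S)) (Dom E (ker2 S)) \<and> ker2 S \<cdot>\<^bsub>E\<^esub> \<kappa>1 = top1 S \<cdot>\<^bsub>E\<^esub> ker1 S \<and>
     \<kappa>2 \<in> Hom E (Dom E (ker2 S)) (Dom E (ker3 S)) \<and> ker3 S \<cdot>\<^bsub>E\<^esub> \<kappa>2 = top2 S \<cdot>\<^bsub>E\<^esub> ker2 S \<and>
     \<gamma>1 \<in> Hom E (Cod E (cok1 S)) (Cod E (cok2 S)) \<and> \<gamma>1 \<cdot>\<^bsub>E\<^esub> cok1 S = cok2 S \<cdot>\<^bsub>E\<^esub> bot1 S \<and>
     \<gamma>2 \<in> Hom E (Cod E (cok2 S)) (Cod E (cok3 S)) \<and> \<gamma>2 \<cdot>\<^bsub>E\<^esub> cok2 S = cok3 S \<cdot>\<^bsub>E\<^esub> bot2 S"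

definition snake_morphism ::
  "('o, 'm, 'z) conflation_structure_scheme \<Rightarrow> 'm snake \<Rightarrow> 'm snake \<Rightarrow>
     'm \<Rightarrow> 'm \<Rightarrow> 'm \<Rightarrow> 'm \<Rightarrow> 'm \<Rightarrow> 'm \<Rightarrow> bool" where
  "snake_morphism E S S' a1 a2 a3 b1 b2 b3 \<longleftrightarrow>
     a1 \<in> Hom E (Dom E (vert1 S)) (Dom E (vert1 S')) \<and> b1 \<in> Hom E (Cod E (vert1 S)) (Cod E (vert1 S')) \<and>
     a2 \<in> Hom E (Dom E (vert2 S)) (Dom E (vert2 S')) \<and> b2 \<in> Hom E (Cod E (vert2 S)) (Cod E (vert2 S')) \<and>
     a3 \<in> Hom E (Dom E (vert3 S)) (Dom E (vert3 S')) \<and> b3 \<in> Hom E (Cod E (vert3 S)) (Cod E (vert3 S')) \<and>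
     a2 \<cdot>\<^bsub>E\<^esub> top1 S = top1 S' \<cdot>\<^bsub>E\<^esub> a1 \<and> a3 \<cdot>\<^bsub>E\<^esub> top2 S = top2 S' \<cdot>\<^bsub>E\<^esub> a2 \<and>
     b2 \<cdot>\<^bsub>E\<^esub> bot1 S = bot1 S' \<cdot>\<^bsub>E\<^esub> b1 \<and> b3 \<cdot>\<^bsub>E\<^esub> bot2 S = bot2 S' \<cdot>\<^bsub>E\<^esub> b2 \<and>
     b1 \<cdot>\<^bsub>E\<^esub> vert1 S = vert1 S' \<cdot>\<^bsub>E\<^esub> a1 \<and> b2 \<cdot>\<^bsub>E\<^esub> vert2 S = vert2 S' \<cdot>\<^bsub>E\<^esub> a2 \<and>
     b3 \<cdot>\<^bsub>E\<^esub> vert3 S = vert3 S' \<cdot>\<^bsub>E\<^esub> a3"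

text \<open>A family \<open>\<delta>\<close> of arrows \<open>K\<^sub>3 \<rightarrow> C\<^sub>1\<close>, one for each diagram in the class \<open>D\<close>, natural with
  respect to all morphisms of such diagrams: \<open>u : K\<^sub>3 \<rightarrow> K\<^sub>3'\<close> and \<open>v : C\<^sub>1 \<rightarrow> C\<^sub>1'\<close> are the
  maps induced by the morphism.\<close>

definition natural_connecting ::
  "('o, 'm, 'z) conflation_structure_scheme \<Rightarrow> ('m snake \<Rightarrow> bool) \<Rightarrow> ('m snake \<Rightarrow> 'm) \<Rightarrow> bool" where
  "natural_connecting E D \<delta> \<longleftrightarrow>
     (\<forall>S. D S \<longrightarrow> \<delta> S \<in> Hom E (Dom E (ker3 S)) (Cod E (cok1 S))) \<and>
     (\<forall>S S' a1 a2 a3 b1 b2 b3 u v.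
        D S \<longrightarrow> D S' \<longrightarrow> snake_morphism E S S' a1 a2 a3 b1 b2 b3 \<longrightarrow>
        u \<in> Hom E (Dom E (ker3 S)) (Dom E (ker3 S')) \<longrightarrow> ker3 S' \<cdot>\<^bsub>E\<^esub> u = a3 \<cdot>\<^bsub>E\<^esub> ker3 S \<longrightarrow>
        v \<in> Hom E (Cod E (cok1 S)) (Cod E (cok1 S')) \<longrightarrow> v \<cdot>\<^bsub>E\<^esub> cok1 S = cok1 S' \<cdot>\<^bsub>E\<^esub> b1 \<longrightarrow>
        \<delta> S' \<cdot>\<^bsub>E\<^esub> u = v \<cdot>\<^bsub>E\<^esub> \<delta> S)"

definition short_snake_lemma :: "('o, 'm, 'z) conflation_structure_scheme \<Rightarrow> bool" where
  "short_snake_lemma E \<longleftrightarrow>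
     (\<exists>\<delta>. natural_connecting E (short_snake_diagram E) \<delta> \<and>
        (\<forall>S. short_snake_diagram E S \<longrightarrow>
          (\<exists>\<kappa>1 \<kappa>2 \<gamma>1 \<gamma>2. snake_induced E S \<kappa>1 \<kappa>2 \<gamma>1 \<gamma>2 \<and>
             exact_seq E [Zero E (zobj E) (Dom E (ker1 S)), \<kappa>1, \<kappa>2, \<delta> S, \<gamma>1, \<gamma>2,
                          Zero E (Cod E (cok3 S)) (zobj E)])))"

definition snake_lemma :: "('o, 'm, 'z) conflation_structure_scheme \<Rightarrow> bool" where
  "snake_lemma E \<longleftrightarrow>
     (\<exists>\<delta>. natural_connecting E (long_snake_diagram E) \<delta> \<and>
        (\<forall>S k c. long_snake_diagram E S \<longrightarrow> is_kernel E k (top1 S) \<longrightarrow> is_cokernel E c (bot2 S) \<longrightarrow>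
          (\<exists>\<kappa>1 \<kappa>2 \<gamma>1 \<gamma>2. \<exists>\<kappa>0 \<in> Hom E (Dom E k) (Dom E (ker1 S)). \<exists>\<gamma>3 \<in> Hom E (Cod E (cok3 S)) (Cod E c).
             snake_induced E S \<kappa>1 \<kappa>2 \<gamma>1 \<gamma>2 \<and>
             ker1 S \<cdot>\<^bsub>E\<^esub> \<kappa>0 = k \<and> \<gamma>3 \<cdot>\<^bsub>E\<^esub> cok3 S = c \<and>
             exact_seq E [Zero E (zobj E) (Dom E k), \<kappa>0, \<kappa>1, \<kappa>2, \<delta> S, \<gamma>1, \<gamma>2, \<gamma>3,
                          Zero E (Cod E c) (zobj E)])))"

end

theory Submission
  imports Defs
begin

text \<open>A morphism \<open>g : Y \<rightarrow> Z\<close> for which some \<open>g f'\<close> with \<open>f' : Y' \<rightarrow> Y\<close> is a deflation can always be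
  reached through deflations only: the shear \<open>(f' 1) : Y' \<oplus> Y \<rightarrow> Y\<close> is isomorphic to a projection,
  and \<open>g (f' 1) = (g f' g)\<close> is a deflation as well. So R3\<open>\<^sup>+\<close> only has to be shown for \<open>g f\<close> with
  \<open>f\<close> a deflation, and then \<open>g\<close> can be exhibited as the last map between cokernels in a suitable
  ker-coker-sequence or short snake diagram.

  Conversely, deflations are the singleton covers of a Grothendieck topology, and R3\<open>\<^sup>+\<close> says that a
  morphism is a deflation as soon as it is locally surjective. Hence one may chase elements
  \<open>T \<rightarrow> X\<close> as in an abelian category, each lifting step being allowed to pass to a cover
  \<open>T' \<rightarrow> T\<close>. A sequence that is exact in this local sense and ends in an admissible morphism is
  exact: reading from right to left, each image is the kernel of the deflation part of the next
  morphism.\<close>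

section \<open>Additive categories\<close>

text \<open>The axioms speak of deflations only: inflations are not assumed to compose or to have
  pushouts, so no argument about deflations can simply be dualised. Every inflation in a sequence is
  therefore produced as a kernel of a deflation, and every cokernel condition is read off from the
  fact that a deflation is the cokernel of its kernel. For the same reason the cokernel half of the
  snake sequence is also chased with generalised elements, which are first lifted along the
  deflations onto the cokernels.

  The axiom \<open>axiom_R0_star\<close> enters through biproducts: a projection is a pullback of a
  map to 0, so projections and all their shears are deflations. In the snake argument R3+ is used
  only to turn local exactness into exactness: the map onto an image becomes a deflation after
  composition with a suitable arrow. For the way back, the test diagrams are built so that
  \<open>g\<close> is forced to be the arrow just before a final 0, where exactness makes it a
  deflation.

  The connecting map is specified by its value on all possible lifts, not by one construction; this
  is what makes an arbitrarily chosen family of such maps natural.\<close>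

context additive_category
begin

lemma Hom_iff [simp]: "f \<in> Hom E X Y \<longleftrightarrow> f \<in> Arr E \<and> Dom E f = X \<and> Cod E f = Y"
  by (simp add: Hom_def)

lemma Dom_Obj [simp]: "f \<in> Arr E \<Longrightarrow> Dom E f \<in> Obj E"
  and Cod_Obj [simp]: "f \<in> Arr E \<Longrightarrow> Cod E f \<in> Obj E"
  by (simp_all add: Dom_closed Cod_closed)

lemma Comp_simps [simp]:
  assumes "f \<in> Arr E" "g \<in> Arr E" "Cod E f = Dom E g"
  shows "g \<cdot> f \<in> Arr E" "Dom E (g \<cdot> f) = Dom E f" "Cod E (g \<cdot> f) = Cod E g"
  using Comp_closed[of f "Dom E f" "Cod E f" g "Cod E g"] assms by auto

lemma Ident_simps [simp]:
  assumes "X \<in> Obj E"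
  shows "Ident E X \<in> Arr E" "Dom E (Ident E X) = X" "Cod E (Ident E X) = X"
  using Ident_closed[OF assms] by auto

lemma Comp_Ident [simp]:
  "f \<in> Arr E \<Longrightarrow> Dom E f = X \<Longrightarrow> f \<cdot> Ident E X = f"
  "f \<in> Arr E \<Longrightarrow> Cod E f = X \<Longrightarrow> Ident E X \<cdot> f = f"
  using Ident_right[of f] Ident_left[of f] by auto

lemma Comp_assoc_right [simp]:
  "\<lbrakk>f \<in> Arr E; g \<in> Arr E; h \<in> Arr E; Cod E f = Dom E g; Cod E g = Dom E h\<rbrakk>
    \<Longrightarrow> (h \<cdot> g) \<cdot> f = h \<cdot> (g \<cdot> f)"
  using Comp_assoc[of f "Dom E f" "Cod E f" g "Cod E g" h "Cod E h"] by auto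

text \<open>Composites are normalised to the right; equations between composites therefore also have to
  be available with an arbitrary arrow appended.\<close>

lemma Comp_append:
  "\<lbrakk>a \<cdot> b = c; a \<in> Arr E; b \<in> Arr E; x \<in> Arr E; Cod E b = Dom E a; Cod E x = Dom E b\<rbrakk>
    \<Longrightarrow> a \<cdot> (b \<cdot> x) = c \<cdot> x"
  by (metis Comp_assoc_right)

lemma Zero_simps [simp]:
  assumes "X \<in> Obj E" "Y \<in> Obj E"
  shows "Zero E X Y \<in> Arr E" "Dom E (Zero E X Y) = X" "Cod E (Zero E X Y) = Y"
proof -
  interpret comm_group "hom_group E X Y" using Hom_comm_group[OF assms] .
  show "Zero E X Y \<in> Arr E" "Dom E (Zero E X Y) = X" "Cod E (Zero E X Y) = Y"
    using one_closed by (auto simp: hom_group_def)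
qed

lemma Plus_simps [simp]:
  assumes "f \<in> Arr E" "g \<in> Arr E" "Dom E f = Dom E g" "Cod E f = Cod E g"
  shows "Plus E f g \<in> Arr E" "Dom E (Plus E f g) = Dom E g" "Cod E (Plus E f g) = Cod E g"
proof -
  interpret comm_group "hom_group E (Dom E g) (Cod E g)" using Hom_comm_group assms by simp
  show "Plus E f g \<in> Arr E" "Dom E (Plus E f g) = Dom E g" "Cod E (Plus E f g) = Cod E g"
    using m_closed[of f g] assms by (auto simp: hom_group_def)
qed

lemma Plus_Zero [simp]:
  assumes "f \<in> Arr E" "Dom E f = X" "Cod E f = Y"
  shows "Plus E (Zero E X Y) f = f" "Plus E f (Zero E X Y) = f"
proof -
  interpret comm_group "hom_group E X Y" using Hom_comm_group assms by auto
  show "Plus E (Zero E X Y) f = f" "Plus E f (Zero E X Y) = f"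
    using l_one[of f] r_one[of f] assms by (auto simp: hom_group_def)
qed

lemma Plus_assoc:
  assumes "f \<in> Arr E" "g \<in> Arr E" "h \<in> Arr E" "Dom E f = Dom E g" "Cod E f = Cod E g"
    "Dom E g = Dom E h" "Cod E g = Cod E h"
  shows "Plus E (Plus E f g) h = Plus E f (Plus E g h)"
proof -
  interpret comm_group "hom_group E (Dom E g) (Cod E g)" using Hom_comm_group assms by auto
  show ?thesis using m_assoc[of f g h] assms by (auto simp: hom_group_def)
qed

lemma Plus_commute:
  assumes "f \<in> Arr E" "g \<in> Arr E" "Dom E f = Dom E g" "Cod E f = Cod E g"
  shows "Plus E f g = Plus E g f"
proof -
  interpret comm_group "hom_group E (Dom E g) (Cod E g)" using Hom_comm_group assms by auto
  show ?thesis using m_comm[of f g] assms by (auto simp: hom_group_def)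
qed

text \<open>The additive structure has no operation for inverses, so they are taken from the hom
  group, whose objects are read off from the arrow.\<close>

definition Neg :: "'m \<Rightarrow> 'm" where
  "Neg f = m_inv (hom_group E (Dom E f) (Cod E f)) f"

lemma Neg_simps [simp]:
  assumes "f \<in> Arr E"
  shows "Neg f \<in> Arr E" "Dom E (Neg f) = Dom E f" "Cod E (Neg f) = Cod E f"
    and Plus_Neg: "Plus E f (Neg f) = Zero E (Dom E f) (Cod E f)" "Plus E (Neg f) f = Zero E (Dom E f) (Cod E f)"
proof -
  interpret comm_group "hom_group E (Dom E f) (Cod E f)" using Hom_comm_group assms by auto
  show "Neg f \<in> Arr E" "Dom E (Neg f) = Dom E f" "Cod E (Neg f) = Cod E f"
    using inv_closed[of f] assms by (auto simp: hom_group_def Neg_def)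
  show "Plus E f (Neg f) = Zero E (Dom E f) (Cod E f)" "Plus E (Neg f) f = Zero E (Dom E f) (Cod E f)"
    using r_inv[of f] l_inv[of f] assms by (auto simp: hom_group_def Neg_def)
qed

lemma Plus_cancel_left:
  assumes "f \<in> Arr E" "g \<in> Arr E" "h \<in> Arr E" "Dom E f = Dom E g" "Cod E f = Cod E g"
    "Dom E g = Dom E h" "Cod E g = Cod E h"
  shows "Plus E f g = Plus E f h \<longleftrightarrow> g = h"
proof -
  interpret comm_group "hom_group E (Dom E h) (Cod E h)" using Hom_comm_group assms by auto
  show ?thesis using Units_l_cancel[of f g h] Units_eq assms by (auto simp: hom_group_def)
qed

lemma Comp_Plus [simp]:
  "\<lbrakk>f \<in> Arr E; f' \<in> Arr E; g \<in> Arr E; Dom E f = Dom E f'; Cod E f = Dom E g; Cod E f' = Dom E g\<rbrakk>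
    \<Longrightarrow> g \<cdot> Plus E f f' = Plus E (g \<cdot> f) (g \<cdot> f')"
  "\<lbrakk>f \<in> Arr E; g \<in> Arr E; g' \<in> Arr E; Cod E g = Cod E g'; Cod E f = Dom E g; Cod E f = Dom E g'\<rbrakk>
    \<Longrightarrow> Plus E g g' \<cdot> f = Plus E (g \<cdot> f) (g' \<cdot> f)"
  using Comp_Plus_right[of f "Dom E f" "Cod E f" f' g "Cod E g"]
    Comp_Plus_left[of f "Dom E f" "Cod E f" g "Cod E g" g'] by auto

lemma Plus_self_imp_Zero:
  "\<lbrakk>f \<in> Arr E; Plus E f f = f\<rbrakk> \<Longrightarrow> f = Zero E (Dom E f) (Cod E f)"
  using Plus_cancel_left[of f f "Zero E (Dom E f) (Cod E f)"] by simp

text \<open>By additivity a composite \<open>x\<close> with a zero map satisfies x + x = x, and zero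
  is the only such element of a hom group.\<close>

lemma Comp_Zero [simp]:
  assumes "g \<in> Arr E" "X \<in> Obj E"
  shows "Dom E g = Y \<Longrightarrow> g \<cdot> Zero E X Y = Zero E X (Cod E g)"
    and "Cod E g = Y \<Longrightarrow> Zero E Y X \<cdot> g = Zero E (Dom E g) X"
proof -
  assume Y: "Dom E g = Y"
  with assms have YO: "Y \<in> Obj E" by auto
  have "Plus E (g \<cdot> Zero E X Y) (g \<cdot> Zero E X Y) = g \<cdot> Plus E (Zero E X Y) (Zero E X Y)"
    using assms Y YO by (subst Comp_Plus) simp_all
  also have "\<dots> = g \<cdot> Zero E X Y" using assms YO by simp
  finally show "g \<cdot> Zero E X Y = Zero E X (Cod E g)"
    using Plus_self_imp_Zero[of "g \<cdot> Zero E X Y"] assms Y YO by simp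
next
  assume Y: "Cod E g = Y"
  with assms have YO: "Y \<in> Obj E" by auto
  have "Plus E (Zero E Y X \<cdot> g) (Zero E Y X \<cdot> g) = Plus E (Zero E Y X) (Zero E Y X) \<cdot> g"
    using assms Y YO by (subst Comp_Plus) simp_all
  also have "\<dots> = Zero E Y X \<cdot> g" using assms YO by simp
  finally show "Zero E Y X \<cdot> g = Zero E (Dom E g) X"
    using Plus_self_imp_Zero[of "Zero E Y X \<cdot> g"] assms Y YO by simp
qed

lemma Plus_Neg_cancel [simp]:
  assumes "f \<in> Arr E" "g \<in> Arr E" "Dom E f = Dom E g" "Cod E f = Cod E g"
  shows "Plus E f (Plus E (Neg f) g) = g" "Plus E (Neg f) (Plus E f g) = g"
  using assms by (simp_all add: Plus_assoc[symmetric] Plus_Neg)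

lemma Neg_Zero [simp]: "\<lbrakk>X \<in> Obj E; Y \<in> Obj E\<rbrakk> \<Longrightarrow> Neg (Zero E X Y) = Zero E X Y"
  by (metis Plus_Zero(1) Plus_Neg(1) Neg_simps(1-3) Zero_simps)

lemma Neg_unique:
  assumes "f \<in> Arr E" "g \<in> Arr E" "Dom E f = Dom E g" "Cod E f = Cod E g"
    and "Plus E f g = Zero E (Dom E g) (Cod E g)"
  shows "g = Neg f"
proof -
  have "g = Plus E (Neg f) (Plus E f g)" using assms(1-4) by simp
  also have "\<dots> = Neg f" unfolding assms(5) using assms(1-4) by simp
  finally show ?thesis .
qed

lemma Comp_Neg [simp]:
  assumes "f \<in> Arr E" "g \<in> Arr E" "Cod E f = Dom E g"
  shows "g \<cdot> Neg f = Neg (g \<cdot> f)" "Neg g \<cdot> f = Neg (g \<cdot> f)"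
proof -
  have "Plus E (g \<cdot> f) (g \<cdot> Neg f) = g \<cdot> Plus E f (Neg f)"
    using assms by (subst Comp_Plus) simp_all
  then show "g \<cdot> Neg f = Neg (g \<cdot> f)"
    using assms by (intro Neg_unique) (simp_all add: Plus_Neg)
  have "Plus E (g \<cdot> f) (Neg g \<cdot> f) = Plus E g (Neg g) \<cdot> f"
    using assms by (subst Comp_Plus) simp_all
  then show "Neg g \<cdot> f = Neg (g \<cdot> f)"
    using assms by (intro Neg_unique) (simp_all add: Plus_Neg)
qed

lemma zero_object_zobj: "zero_object E (zobj E)"
  unfolding zobj_def using zero_object_exists by (rule someI_ex)

lemma zobj_Obj [simp]: "zobj E \<in> Obj E"
  using zero_object_zobj by (simp add: zero_object_def)

lemma to_zobj_eq: "\<lbrakk>f \<in> Arr E; Cod E f = zobj E\<rbrakk> \<Longrightarrow> f = Zero E (Dom E f) (zobj E)"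
  and from_zobj_eq: "\<lbrakk>f \<in> Arr E; Dom E f = zobj E\<rbrakk> \<Longrightarrow> f = Zero E (zobj E) (Cod E f)"
  using zero_object_zobj unfolding zero_object_def
  by (metis Hom_iff Cod_Obj Dom_Obj Zero_simps)+

lemma Ident_zobj: "Ident E (zobj E) = Zero E (zobj E) (zobj E)"
  using to_zobj_eq[of "Ident E (zobj E)"] by simp

section \<open>Kernels and cokernels\<close>

lemma kernelI:
  assumes "k \<in> Arr E" "f \<in> Arr E" "Cod E k = Dom E f" "f \<cdot> k = Zero E (Dom E k) (Cod E f)"
    and "\<And>t. \<lbrakk>t \<in> Arr E; Cod E t = Dom E f; f \<cdot> t = Zero E (Dom E t) (Cod E f)\<rbrakk>
          \<Longrightarrow> \<exists>u \<in> Hom E (Dom E t) (Dom E k). k \<cdot> u = t"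
    and "\<And>u v. \<lbrakk>u \<in> Arr E; v \<in> Arr E; Dom E u = Dom E v; Cod E u = Dom E k; Cod E v = Dom E k;
          k \<cdot> u = k \<cdot> v\<rbrakk> \<Longrightarrow> u = v"
  shows "is_kernel E k f"
  unfolding is_kernel_def
proof (intro conjI allI ballI impI)
  fix T t assume t: "t \<in> Hom E T (Dom E f)" "f \<cdot> t = Zero E T (Cod E f)"
  then obtain u where "u \<in> Hom E T (Dom E k)" "k \<cdot> u = t" using assms(5)[of t] by auto
  then show "\<exists>!u. u \<in> Hom E T (Dom E k) \<and> k \<cdot> u = t"
    by (intro ex1I[of _ u]) (auto intro!: assms(6))
qed (use assms in auto)

lemma cokernelI:
  assumes "c \<in> Arr E" "f \<in> Arr E" "Dom E c = Cod E f" "c \<cdot> f = Zero E (Dom E f) (Cod E c)"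
    and "\<And>t. \<lbrakk>t \<in> Arr E; Dom E t = Cod E f; t \<cdot> f = Zero E (Dom E f) (Cod E t)\<rbrakk>
          \<Longrightarrow> \<exists>u \<in> Hom E (Cod E c) (Cod E t). u \<cdot> c = t"
    and "\<And>u v. \<lbrakk>u \<in> Arr E; v \<in> Arr E; Cod E u = Cod E v; Dom E u = Cod E c; Dom E v = Cod E c;
          u \<cdot> c = v \<cdot> c\<rbrakk> \<Longrightarrow> u = v"
  shows "is_cokernel E c f"
  unfolding is_cokernel_def
proof (intro conjI allI ballI impI)
  fix T t assume t: "t \<in> Hom E (Cod E f) T" "t \<cdot> f = Zero E (Dom E f) T"
  then obtain u where "u \<in> Hom E (Cod E c) T" "u \<cdot> c = t" using assms(5)[of t] by auto
  then show "\<exists>!u. u \<in> Hom E (Cod E c) T \<and> u \<cdot> c = t"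
    by (intro ex1I[of _ u]) (auto intro!: assms(6))
qed (use assms in auto)

lemma kernelD:
  assumes "is_kernel E k f"
  shows "k \<in> Arr E" "f \<in> Arr E" "Cod E k = Dom E f" "f \<cdot> k = Zero E (Dom E k) (Cod E f)"
  using assms by (auto simp: is_kernel_def)

lemma cokernelD:
  assumes "is_cokernel E c f"
  shows "c \<in> Arr E" "f \<in> Arr E" "Dom E c = Cod E f" "c \<cdot> f = Zero E (Dom E f) (Cod E c)"
  using assms by (auto simp: is_cokernel_def)

lemma kernel_factor:
  assumes "is_kernel E k f" "t \<in> Arr E" "Cod E t = Dom E f" "f \<cdot> t = Zero E (Dom E t) (Cod E f)"
  obtains u where "u \<in> Arr E" "Dom E u = Dom E t" "Cod E u = Dom E k" "k \<cdot> u = t"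
  using assms unfolding is_kernel_def by (metis Hom_iff)

lemma cokernel_factor:
  assumes "is_cokernel E c f" "t \<in> Arr E" "Dom E t = Cod E f" "t \<cdot> f = Zero E (Dom E f) (Cod E t)"
  obtains u where "u \<in> Arr E" "Dom E u = Cod E c" "Cod E u = Cod E t" "u \<cdot> c = t"
  using assms unfolding is_cokernel_def by (metis Hom_iff)

lemma kernel_mono:
  assumes "is_kernel E k f" "u \<in> Arr E" "v \<in> Arr E" "Dom E u = Dom E v" "Cod E u = Dom E k"
    "Cod E v = Dom E k" "k \<cdot> u = k \<cdot> v"
  shows "u = v"
proof -
  note k = kernelD[OF assms(1)]
  have "f \<cdot> (k \<cdot> v) = Zero E (Dom E v) (Cod E f)"
    using k assms by (simp add: Comp_append[OF k(4)])
  then have "\<exists>!w. w \<in> Hom E (Dom E v) (Dom E k) \<and> k \<cdot> w = k \<cdot> v"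
    using k assms unfolding is_kernel_def by simp
  then show ?thesis using assms by auto
qed

lemma cokernel_epi:
  assumes "is_cokernel E c f" "u \<in> Arr E" "v \<in> Arr E" "Cod E u = Cod E v" "Dom E u = Cod E c"
    "Dom E v = Cod E c" "u \<cdot> c = v \<cdot> c"
  shows "u = v"
proof -
  note c = cokernelD[OF assms(1)]
  have "(v \<cdot> c) \<cdot> f = Zero E (Dom E f) (Cod E v)"
    using c assms by simp
  then have "\<exists>!w. w \<in> Hom E (Cod E c) (Cod E v) \<and> w \<cdot> c = v \<cdot> c"
    using c assms unfolding is_cokernel_def by simp
  then show ?thesis using assms by auto
qed

text \<open>The subtraction step of a diagram chase: \<open>f\<close> kills -b + a, so this
  difference factors through the kernel.\<close>

lemma kernel_difference:
  assumes "is_kernel E k f" "a \<in> Arr E" "b \<in> Arr E" "Dom E a = Dom E b" "Cod E a = Dom E f"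
    "Cod E b = Dom E f" "f \<cdot> a = f \<cdot> b"
  obtains u where "u \<in> Arr E" "Dom E u = Dom E b" "Cod E u = Dom E k" "a = Plus E b (k \<cdot> u)"
proof -
  note k = kernelD[OF assms(1)]
  have "f \<cdot> Plus E (Neg b) a = Zero E (Dom E (Plus E (Neg b) a)) (Cod E f)"
    using k assms by (simp add: Plus_Neg)
  then obtain u where u: "u \<in> Arr E" "Dom E u = Dom E b" "Cod E u = Dom E k" "k \<cdot> u = Plus E (Neg b) a"
    using kernel_factor[OF assms(1), of "Plus E (Neg b) a"] k assms by auto
  show thesis by (rule that[OF u(1,2,3)]) (use u assms in simp)
qed

section \<open>Biproducts and pullbacks\<close>

lemma biproductD:
  assumes "biproduct E X Y P i1 i2 p1 p2"
  shows "X \<in> Obj E" "Y \<in> Obj E" "P \<in> Obj E"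
    "i1 \<in> Arr E" "Dom E i1 = X" "Cod E i1 = P" "i2 \<in> Arr E" "Dom E i2 = Y" "Cod E i2 = P"
    "p1 \<in> Arr E" "Dom E p1 = P" "Cod E p1 = X" "p2 \<in> Arr E" "Dom E p2 = P" "Cod E p2 = Y"
    "p1 \<cdot> i1 = Ident E X" "p2 \<cdot> i2 = Ident E Y"
    "p1 \<cdot> i2 = Zero E Y X" "p2 \<cdot> i1 = Zero E X Y"
    "Plus E (i1 \<cdot> p1) (i2 \<cdot> p2) = Ident E P"
    "\<And>x. x \<in> Arr E \<Longrightarrow> Cod E x = X \<Longrightarrow> p1 \<cdot> (i1 \<cdot> x) = x"
    "\<And>x. x \<in> Arr E \<Longrightarrow> Cod E x = Y \<Longrightarrow> p2 \<cdot> (i2 \<cdot> x) = x"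
    "\<And>x. x \<in> Arr E \<Longrightarrow> Cod E x = Y \<Longrightarrow> p1 \<cdot> (i2 \<cdot> x) = Zero E (Dom E x) X"
    "\<And>x. x \<in> Arr E \<Longrightarrow> Cod E x = X \<Longrightarrow> p2 \<cdot> (i1 \<cdot> x) = Zero E (Dom E x) Y"
  using assms by (auto simp: biproduct_def Comp_append)

lemma biproduct_swap: "biproduct E X Y P i1 i2 p1 p2 \<Longrightarrow> biproduct E Y X P i2 i1 p2 p1"
  unfolding biproduct_def by (auto simp: Plus_commute)

lemma biproduct_expand:
  assumes "biproduct E X Y P i1 i2 p1 p2" "x \<in> Arr E" "Cod E x = P"
  shows "Plus E (i1 \<cdot> (p1 \<cdot> x)) (i2 \<cdot> (p2 \<cdot> x)) = x"
proof -
  note b = biproductD[OF assms(1)]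
  have "Plus E (i1 \<cdot> p1) (i2 \<cdot> p2) \<cdot> x = x" using b assms by simp
  then show ?thesis using b(1-15) assms by simp
qed

lemma biproduct_jointly_monic:
  assumes "biproduct E X Y P i1 i2 p1 p2" "x \<in> Arr E" "y \<in> Arr E" "Dom E x = Dom E y"
    "Cod E x = P" "Cod E y = P" "p1 \<cdot> x = p1 \<cdot> y" "p2 \<cdot> x = p2 \<cdot> y"
  shows "x = y"
  using biproduct_expand[OF assms(1)] assms(2-) by metis

text \<open>Transport of the biproduct along the automorphism of X \<oplus> Y with matrix rows (1 h)
  and (0 1). Its purpose is to exhibit the row (1 h) as a biproduct projection whose kernel is known
  explicitly.\<close>

lemma biproduct_shear:
  assumes "biproduct E X Y P i1 i2 p1 p2" "h \<in> Hom E Y X"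
  shows "biproduct E X Y P i1 (Plus E i2 (Neg (i1 \<cdot> h))) (Plus E p1 (h \<cdot> p2)) p2"
proof -
  note b = biproductD[OF assms(1)]
  have "Plus E (i1 \<cdot> (Plus E p1 (h \<cdot> p2))) (Plus E i2 (Neg (i1 \<cdot> h)) \<cdot> p2)
     = Plus E (Plus E (i1 \<cdot> p1) (i1 \<cdot> (h \<cdot> p2))) (Plus E (i2 \<cdot> p2) (Neg (i1 \<cdot> (h \<cdot> p2))))"
    using b assms by simp
  also have "\<dots> = Plus E (i1 \<cdot> p1) (Plus E (i1 \<cdot> (h \<cdot> p2)) (Plus E (Neg (i1 \<cdot> (h \<cdot> p2))) (i2 \<cdot> p2)))"
    using b assms by (simp add: Plus_assoc Plus_commute[of "i2 \<cdot> p2"])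
  also have "\<dots> = Ident E P" using b assms by simp
  finally show ?thesis using b assms unfolding biproduct_def by (simp add: Plus_Neg)
qed

lemma pullbackI:
  assumes "p \<in> Arr E" "q \<in> Arr E" "g \<in> Arr E" "h \<in> Arr E"
    "Dom E p = Dom E q" "Cod E p = Dom E g" "Cod E q = Dom E h" "Cod E g = Cod E h" "g \<cdot> p = h \<cdot> q"
    and "\<And>s t. \<lbrakk>s \<in> Arr E; t \<in> Arr E; Dom E s = Dom E t; Cod E s = Dom E g; Cod E t = Dom E h;
          g \<cdot> s = h \<cdot> t\<rbrakk> \<Longrightarrow> \<exists>u \<in> Hom E (Dom E t) (Dom E q). p \<cdot> u = s \<and> q \<cdot> u = t"
    and "\<And>u v. \<lbrakk>u \<in> Arr E; v \<in> Arr E; Dom E u = Dom E v; Cod E u = Dom E q; Cod E v = Dom E q;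
          p \<cdot> u = p \<cdot> v; q \<cdot> u = q \<cdot> v\<rbrakk> \<Longrightarrow> u = v"
  shows "is_pullback E p q g h"
  unfolding is_pullback_def
proof (intro conjI allI ballI impI)
  fix T s t assume st: "s \<in> Hom E T (Dom E g)" "t \<in> Hom E T (Dom E h)" "g \<cdot> s = h \<cdot> t"
  then obtain u where "u \<in> Hom E T (Dom E p)" "p \<cdot> u = s \<and> q \<cdot> u = t" using assms(5) assms(10)[of s t] by auto
  then show "\<exists>!u. u \<in> Hom E T (Dom E p) \<and> p \<cdot> u = s \<and> q \<cdot> u = t"
    using assms(5) by (intro ex1I[of _ u]) (auto intro!: assms(11))
qed (use assms in auto)

lemma pullbackD:
  assumes "is_pullback E p q g h"
  shows "p \<in> Arr E" "q \<in> Arr E" "g \<in> Arr E" "h \<in> Arr E"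
    "Dom E p = Dom E q" "Cod E p = Dom E g" "Cod E q = Dom E h" "Cod E g = Cod E h" "g \<cdot> p = h \<cdot> q"
  using assms by (simp_all add: is_pullback_def)

lemma pullback_factor:
  assumes "is_pullback E p q g h" "s \<in> Arr E" "t \<in> Arr E" "Dom E s = Dom E t"
    "Cod E s = Dom E g" "Cod E t = Dom E h" "g \<cdot> s = h \<cdot> t"
  obtains u where "u \<in> Arr E" "Dom E u = Dom E t" "Cod E u = Dom E q" "p \<cdot> u = s" "q \<cdot> u = t"
  using assms unfolding is_pullback_def by (metis Hom_iff)

lemma pullback_jointly_monic:
  assumes "is_pullback E p q g h" "u \<in> Arr E" "v \<in> Arr E" "Dom E u = Dom E v"
    "Cod E u = Dom E q" "Cod E v = Dom E q" "p \<cdot> u = p \<cdot> v" "q \<cdot> u = q \<cdot> v"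
  shows "u = v"
proof -
  note b = pullbackD[OF assms(1)]
  have "g \<cdot> (p \<cdot> v) = h \<cdot> (q \<cdot> v)" using b assms by (simp add: Comp_append[OF b(9)])
  then have "\<exists>!w. w \<in> Hom E (Dom E v) (Dom E p) \<and> p \<cdot> w = p \<cdot> v \<and> q \<cdot> w = q \<cdot> v"
    using assms b unfolding is_pullback_def by simp
  then show ?thesis using assms b by auto
qed

section \<open>Isomorphisms, epics, monics and the comparison of kernels\<close>

lemma isoI:
  "\<lbrakk>f \<in> Arr E; g \<in> Arr E; Dom E g = Cod E f; Cod E g = Dom E f;
    g \<cdot> f = Ident E (Dom E f); f \<cdot> g = Ident E (Cod E f)\<rbrakk> \<Longrightarrow> iso_arr E f"
  by (auto simp: iso_arr_def)

lemma isoE: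
  assumes "iso_arr E f"
  obtains g where "f \<in> Arr E" "g \<in> Arr E" "Dom E g = Cod E f" "Cod E g = Dom E f"
    "g \<cdot> f = Ident E (Dom E f)" "f \<cdot> g = Ident E (Cod E f)"
  using assms by (auto simp: iso_arr_def)

lemma iso_Ident [simp]: "X \<in> Obj E \<Longrightarrow> iso_arr E (Ident E X)"
  by (rule isoI[of _ "Ident E X"]) simp_all

definition epic :: "'m \<Rightarrow> bool" where
  "epic e \<longleftrightarrow> e \<in> Arr E \<and> (\<forall>u v. u \<in> Arr E \<longrightarrow> v \<in> Arr E \<longrightarrow> Dom E u = Cod E e \<longrightarrow>
     Dom E v = Cod E e \<longrightarrow> Cod E u = Cod E v \<longrightarrow> u \<cdot> e = v \<cdot> e \<longrightarrow> u = v)"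

definition monic :: "'m \<Rightarrow> bool" where
  "monic m \<longleftrightarrow> m \<in> Arr E \<and> (\<forall>u v. u \<in> Arr E \<longrightarrow> v \<in> Arr E \<longrightarrow> Cod E u = Dom E m \<longrightarrow>
     Cod E v = Dom E m \<longrightarrow> Dom E u = Dom E v \<longrightarrow> m \<cdot> u = m \<cdot> v \<longrightarrow> u = v)"

lemma epicD:
  "\<lbrakk>epic e; u \<cdot> e = v \<cdot> e; u \<in> Arr E; v \<in> Arr E; Dom E u = Cod E e; Dom E v = Cod E e; Cod E u = Cod E v\<rbrakk>
    \<Longrightarrow> u = v"
  unfolding epic_def by blast

lemma monicD:
  "\<lbrakk>monic m; m \<cdot> u = m \<cdot> v; u \<in> Arr E; v \<in> Arr E; Cod E u = Dom E m; Cod E v = Dom E m; Dom E u = Dom E v\<rbrakk>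
    \<Longrightarrow> u = v"
  unfolding monic_def by blast

lemma cokernel_is_epic: "is_cokernel E c f \<Longrightarrow> epic c"
  unfolding epic_def using cokernelD(1) cokernel_epi by blast

lemma kernel_is_monic: "is_kernel E k f \<Longrightarrow> monic k"
  unfolding monic_def using kernelD(1) kernel_mono by blast

lemma iso_is_epic:
  assumes "iso_arr E f"
  shows "epic f"
proof -
  obtain g where g: "f \<in> Arr E" "g \<in> Arr E" "Dom E g = Cod E f" "Cod E g = Dom E f"
    "g \<cdot> f = Ident E (Dom E f)" "f \<cdot> g = Ident E (Cod E f)"
    using assms by (rule isoE)
  show ?thesis unfolding epic_def
  proof (intro conjI allI impI)
    fix u v assume uv: "u \<in> Arr E" "v \<in> Arr E" "Dom E u = Cod E f" "Dom E v = Cod E f" "u \<cdot> f = v \<cdot> f"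
    have "u \<cdot> (f \<cdot> g) = v \<cdot> (f \<cdot> g)" using Comp_append[OF uv(5), of g] g uv by simp
    then show "u = v" using g uv by simp
  qed (fact g)
qed

lemma iso_is_monic:
  assumes "iso_arr E f"
  shows "monic f"
proof -
  obtain g where g: "f \<in> Arr E" "g \<in> Arr E" "Dom E g = Cod E f" "Cod E g = Dom E f"
    "g \<cdot> f = Ident E (Dom E f)" "f \<cdot> g = Ident E (Cod E f)"
    using assms by (rule isoE)
  show ?thesis unfolding monic_def
  proof (intro conjI allI impI)
    fix u v assume uv: "u \<in> Arr E" "v \<in> Arr E" "Cod E u = Dom E f" "Cod E v = Dom E f"
      "Dom E u = Dom E v" "f \<cdot> u = f \<cdot> v"
    have "g \<cdot> (f \<cdot> x) = x" if "x \<in> Arr E" "Cod E x = Dom E f" for x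
      using Comp_append[OF g(5), of x] g that by simp
    then show "u = v" using uv by metis
  qed (fact g)
qed

text \<open>An arrow kills \<open>f \<cdot> e\<close> iff it kills \<open>f\<close>. So a cokernel
  of an admissible arrow is the same as a cokernel of its inflation part.\<close>

lemma cokernel_comp_epic:
  assumes "epic e" "f \<in> Arr E" "Cod E e = Dom E f"
  shows "is_cokernel E c (f \<cdot> e) \<longleftrightarrow> is_cokernel E c f"
proof -
  have e: "e \<in> Arr E" using assms(1) by (simp add: epic_def)
  have *: "t \<cdot> (f \<cdot> e) = Zero E (Dom E e) (Cod E t) \<longleftrightarrow> t \<cdot> f = Zero E (Dom E f) (Cod E t)"
    if "t \<in> Arr E" "Dom E t = Cod E f" for t
  proof
    assume z: "t \<cdot> (f \<cdot> e) = Zero E (Dom E e) (Cod E t)"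
    show "t \<cdot> f = Zero E (Dom E f) (Cod E t)"
      by (rule epicD[OF assms(1)]) (use that e assms z in simp_all)
  next
    assume "t \<cdot> f = Zero E (Dom E f) (Cod E t)"
    then show "t \<cdot> (f \<cdot> e) = Zero E (Dom E e) (Cod E t)"
      using that e assms by (simp add: Comp_append)
  qed
  have [simp]: "f \<cdot> e \<in> Arr E" "Dom E (f \<cdot> e) = Dom E e" "Cod E (f \<cdot> e) = Cod E f"
    using e assms by auto
  \<comment> \<open>\<open>Q\<close> abstracts the unique factorisation clause, which does not
    mention the arrow whose cokernel is taken; thus the whole universal property transfers at
    once.\<close>
  have "(\<forall>T. \<forall>t\<in>Hom E (Cod E f) T. t \<cdot> (f \<cdot> e) = Zero E (Dom E e) T \<longrightarrow> Q T t) \<longleftrightarrow>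
      (\<forall>T. \<forall>t\<in>Hom E (Cod E f) T. t \<cdot> f = Zero E (Dom E f) T \<longrightarrow> Q T t)" for Q
    using * by auto
  then show ?thesis using e assms * unfolding is_cokernel_def by auto
qed

text \<open>Dually, a kernel of an admissible arrow is the same as a kernel of its deflation
  part.\<close>

lemma kernel_monic_comp:
  assumes "monic m" "f \<in> Arr E" "Cod E f = Dom E m"
  shows "is_kernel E k (m \<cdot> f) \<longleftrightarrow> is_kernel E k f"
proof -
  have m: "m \<in> Arr E" using assms(1) by (simp add: monic_def)
  have *: "(m \<cdot> f) \<cdot> t = Zero E (Dom E t) (Cod E m) \<longleftrightarrow> f \<cdot> t = Zero E (Dom E t) (Cod E f)"
    if "t \<in> Arr E" "Cod E t = Dom E f" for t
    using monicD[OF assms(1), of "f \<cdot> t" "Zero E (Dom E t) (Cod E f)"] that m assms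
    by auto
  have [simp]: "m \<cdot> f \<in> Arr E" "Dom E (m \<cdot> f) = Dom E f" "Cod E (m \<cdot> f) = Cod E m"
    using m assms by auto
  have "(\<forall>T. \<forall>t\<in>Hom E T (Dom E f). (m \<cdot> f) \<cdot> t = Zero E T (Cod E m) \<longrightarrow> Q T t) \<longleftrightarrow>
      (\<forall>T. \<forall>t\<in>Hom E T (Dom E f). f \<cdot> t = Zero E T (Cod E f) \<longrightarrow> Q T t)" for Q
    using * by auto
  then show ?thesis using m assms * unfolding is_kernel_def by auto
qed

lemma kernel_comparison:
  assumes "is_kernel E k f" "is_kernel E k' f"
  obtains a where "iso_arr E a" "Dom E a = Dom E k" "Cod E a = Dom E k'" "k' \<cdot> a = k"
proof -
  note k = kernelD[OF assms(1)] and k' = kernelD[OF assms(2)]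
  obtain a where a: "a \<in> Arr E" "Dom E a = Dom E k" "Cod E a = Dom E k'" "k' \<cdot> a = k"
    using kernel_factor[OF assms(2) k(1,3,4)] by blast
  obtain b where b: "b \<in> Arr E" "Dom E b = Dom E k'" "Cod E b = Dom E k" "k \<cdot> b = k'"
    using kernel_factor[OF assms(1) k'(1,3,4)] by blast
  have "k \<cdot> (b \<cdot> a) = k" "k' \<cdot> (a \<cdot> b) = k'"
    using a b k k' by (simp_all add: Comp_append[OF a(4)] Comp_append[OF b(4)])
  then have "b \<cdot> a = Ident E (Dom E k)" "a \<cdot> b = Ident E (Dom E k')"
    using a b k k' by (simp_all add: kernel_mono[OF assms(1)] kernel_mono[OF assms(2)])
  then have "iso_arr E a" using a b by (auto intro!: isoI[of a b])
  then show thesis using a that by blast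
qed

lemma cokernel_comparison:
  assumes "is_cokernel E c f" "is_cokernel E c' f"
  obtains a where "iso_arr E a" "Dom E a = Cod E c" "Cod E a = Cod E c'" "a \<cdot> c = c'"
proof -
  note c = cokernelD[OF assms(1)] and c' = cokernelD[OF assms(2)]
  obtain a where a: "a \<in> Arr E" "Dom E a = Cod E c" "Cod E a = Cod E c'" "a \<cdot> c = c'"
    using cokernel_factor[OF assms(1) c'(1,3,4)] by blast
  obtain b where b: "b \<in> Arr E" "Dom E b = Cod E c'" "Cod E b = Cod E c" "b \<cdot> c' = c"
    using cokernel_factor[OF assms(2) c(1,3,4)] by blast
  have "(b \<cdot> a) \<cdot> c = c" "(a \<cdot> b) \<cdot> c' = c'"
    using a b c c' by simp_all
  then have "b \<cdot> a = Ident E (Cod E c)" "a \<cdot> b = Ident E (Cod E c')"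
    using a b c c' by (simp_all add: cokernel_epi[OF assms(1)] cokernel_epi[OF assms(2)])
  then have "iso_arr E a" using a b by (auto intro!: isoI[of a b])
  then show thesis using a that by blast
qed

text \<open>The identity is another kernel of a zero map, and kernels differ by an isomorphism. Next
  to a zero map the kernel condition of an exact sequence thus becomes invertibility.\<close>

lemma kernel_Zero_iso:
  assumes "is_kernel E k (Zero E X Y)" "X \<in> Obj E" "Y \<in> Obj E"
  shows "iso_arr E k"
proof -
  have "is_kernel E (Ident E X) (Zero E X Y)"
    using assms(2,3) by (intro kernelI) auto
  then obtain a where "iso_arr E a" "Ident E X \<cdot> a = k" "Cod E a = X"
    using kernel_comparison[OF assms(1)] assms(2) by (metis Ident_simps(2))
  moreover from this have "a \<in> Arr E" by (simp add: iso_arr_def)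
  ultimately show ?thesis by simp
qed

lemma cokernel_Zero_iso:
  assumes "is_cokernel E c (Zero E X Y)" "X \<in> Obj E" "Y \<in> Obj E"
  shows "iso_arr E c"
proof -
  have "is_cokernel E (Ident E Y) (Zero E X Y)"
    using assms(2,3) by (intro cokernelI) auto
  then obtain a where "iso_arr E a" "a \<cdot> Ident E Y = c" "Dom E a = Y"
    using cokernel_comparison[OF _ assms(1)] assms(3) by (metis Ident_simps(3))
  moreover from this have "a \<in> Arr E" by (simp add: iso_arr_def)
  ultimately show ?thesis by simp
qed

lemma zobj_arrows_eq:
  "\<lbrakk>f \<in> Arr E; g \<in> Arr E; Cod E f = zobj E; Cod E g = zobj E; Dom E f = Dom E g\<rbrakk> \<Longrightarrow> f = g"
  by (metis to_zobj_eq)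

lemma kernel_Ident:
  assumes "X \<in> Obj E"
  shows "is_kernel E (Zero E (zobj E) X) (Ident E X)"
proof (rule kernelI)
  fix t assume "t \<in> Arr E" "Cod E t = Dom E (Ident E X)"
    "Ident E X \<cdot> t = Zero E (Dom E t) (Cod E (Ident E X))"
  then show "\<exists>u\<in>Hom E (Dom E t) (Dom E (Zero E (zobj E) X)). Zero E (zobj E) X \<cdot> u = t"
    using assms by (intro bexI[of _ "Zero E (Dom E t) (zobj E)"]) auto
qed (use assms in \<open>auto intro: zobj_arrows_eq\<close>)

text \<open>If \<open>p2\<close> kills \<open>t\<close>, the expansion of \<open>t\<close> into
  components leaves only \<open>i1 \<cdot> (p1 \<cdot> t)\<close>.\<close>

lemma biproduct_kernel:
  assumes b: "biproduct E X Y P i1 i2 p1 p2"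
  shows "is_kernel E i1 p2"
proof -
  note bD = biproductD[OF b]
  show ?thesis
  proof (rule kernelI)
    fix t assume t: "t \<in> Arr E" "Cod E t = Dom E p2" "p2 \<cdot> t = Zero E (Dom E t) (Cod E p2)"
    have "i1 \<cdot> (p1 \<cdot> t) = t" using biproduct_expand[OF b, of t] t bD by simp
    then show "\<exists>u\<in>Hom E (Dom E t) (Dom E i1). i1 \<cdot> u = t"
      using bD t by (intro bexI[of _ "p1 \<cdot> t"]) auto
  next
    fix u v assume uv: "u \<in> Arr E" "v \<in> Arr E" "Dom E u = Dom E v" "Cod E u = Dom E i1"
      "Cod E v = Dom E i1" "i1 \<cdot> u = i1 \<cdot> v"
    have "p1 \<cdot> (i1 \<cdot> u) = p1 \<cdot> (i1 \<cdot> v)" using uv by simp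
    moreover have "p1 \<cdot> (i1 \<cdot> x) = x" if "x \<in> Arr E" "Cod E x = Dom E i1" for x
      using that bD by simp
    ultimately show "u = v" using uv by metis
  qed (use bD in simp_all)
qed

end

section \<open>Deflations and inflations\<close>

context conflation_category
begin

lemma conflationD:
  assumes "(f, g) \<in> conflations E"
  shows "is_kernel E f g" "is_cokernel E g f"
  using conflation_kernel_cokernel[OF assms] by (auto simp: kernel_cokernel_pair_def)

text \<open>Two kernels of \<open>g\<close> differ by an isomorphism; together with identities on
  the other two objects it is an isomorphism of kernel-cokernel pairs, under which conflations are
  closed.\<close>

lemma conflation_of_kernel:
  assumes "deflation E g" "is_kernel E k g"
  shows "(k, g) \<in> conflations E"
proof -
  obtain f where f: "(f, g) \<in> conflations E" using assms(1) by (auto simp: deflation_def)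
  note fD = kernelD[OF conflationD(1)[OF f]] and kD = kernelD[OF assms(2)]
  obtain a where a: "iso_arr E a" "Dom E a = Dom E f" "Cod E a = Dom E k" "k \<cdot> a = f"
    using kernel_comparison[OF conflationD(1)[OF f] assms(2)] by blast
  have "is_cokernel E g k"
    using conflationD(2)[OF f] cokernel_comp_epic[OF iso_is_epic[OF a(1)], of k g] a kD by simp
  then have "kernel_cokernel_pair E k g" using assms(2) by (simp add: kernel_cokernel_pair_def)
  then show ?thesis
    using conflation_iso_closed[OF f, of k g a "Ident E (Dom E g)" "Ident E (Cod E g)"] a fD kD
    by (simp add: iso_arr_def[of E a])
qed

lemma conflation_of_cokernel:
  assumes "inflation E f" "is_cokernel E c f"
  shows "(f, c) \<in> conflations E"
proof -
  obtain g where g: "(f, g) \<in> conflations E" using assms(1) by (auto simp: inflation_def)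
  note gD = cokernelD[OF conflationD(2)[OF g]] and cD = cokernelD[OF assms(2)]
  obtain a where a: "iso_arr E a" "Dom E a = Cod E g" "Cod E a = Cod E c" "a \<cdot> g = c"
    using cokernel_comparison[OF conflationD(2)[OF g] assms(2)] by blast
  have "is_kernel E f c"
    using conflationD(1)[OF g] kernel_monic_comp[OF iso_is_monic[OF a(1)], of g f] a gD by simp
  then have "kernel_cokernel_pair E f c" using assms(2) by (simp add: kernel_cokernel_pair_def)
  then show ?thesis
    using conflation_iso_closed[OF g, of f c "Ident E (Dom E f)" "Ident E (Cod E f)" a] a gD cD
    by (simp add: iso_arr_def[of E a])
qed

lemma deflation_arr: "deflation E g \<Longrightarrow> g \<in> Arr E"
  unfolding deflation_def using conflationD kernelD by blast

lemma inflation_arr: "inflation E g \<Longrightarrow> g \<in> Arr E"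
  unfolding inflation_def using conflationD kernelD by blast

lemma deflation_epic: "deflation E g \<Longrightarrow> epic g"
  unfolding deflation_def using conflationD cokernel_is_epic by blast

lemma inflation_monic: "inflation E g \<Longrightarrow> monic g"
  unfolding inflation_def using conflationD kernel_is_monic by blast

lemma deflation_kernel:
  assumes "deflation E g"
  obtains k where "(k, g) \<in> conflations E" "inflation E k" "is_kernel E k g" "is_cokernel E g k"
  using assms conflationD unfolding deflation_def inflation_def by blast

end

text \<open>The common setting of all the equivalences. The name refers to the effect of
  \<open>axiom_R0_star\<close>: split pairs become conflations, see
  \<open>conflation_biproduct\<close>.\<close>

locale deflation_exact_split = deflation_exact_category E
  for E :: "('o, 'm, 'z) conflation_structure_scheme" (structure) +
  assumes R0_star: "axiom_R0_star E"
begin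

lemma deflation_to_zobj [simp]: "X \<in> Obj E \<Longrightarrow> deflation E (Zero E X (zobj E))"
  using R0_star by (simp add: axiom_R0_star_def)

text \<open>A product is a pullback over the zero object, so \<open>p2\<close> is the pullback of X
  \<rightarrow> 0 along Y \<rightarrow> 0.\<close>

lemma deflation_biproduct_projection:
  assumes "biproduct E X Y P i1 i2 p1 p2"
  shows "deflation E p2"
proof -
  note b = biproductD[OF assms]
  have "is_pullback E p1 p2 (Zero E X (zobj E)) (Zero E Y (zobj E))"
  proof (rule pullbackI)
    fix s t assume "s \<in> Arr E" "t \<in> Arr E" "Dom E s = Dom E t" "Cod E s = Dom E (Zero E X (zobj E))"
      "Cod E t = Dom E (Zero E Y (zobj E))"
    then show "\<exists>u\<in>Hom E (Dom E t) (Dom E p2). p1 \<cdot> u = s \<and> p2 \<cdot> u = t"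
      using b by (intro bexI[of _ "Plus E (i1 \<cdot> s) (i2 \<cdot> t)"]) auto
  qed (use b in \<open>auto intro: biproduct_jointly_monic[OF assms]\<close>)
  then show ?thesis using R2_stable[OF deflation_to_zobj[OF b(1)]] by blast
qed

lemma conflation_biproduct:
  "biproduct E X Y P i1 i2 p1 p2 \<Longrightarrow> (i1, p2) \<in> conflations E"
  by (intro conflation_of_kernel deflation_biproduct_projection biproduct_kernel)

text \<open>The identity of X is the pullback of the identity of 0 along X \<rightarrow> 0.\<close>

lemma deflation_Ident [simp]:
  assumes "X \<in> Obj E"
  shows "deflation E (Ident E X)"
proof -
  have "is_pullback E (Zero E X (zobj E)) (Ident E X) (Ident E (zobj E)) (Zero E X (zobj E))"
    using assms by (intro pullbackI) (auto intro: zobj_arrows_eq)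
  then show ?thesis using R2_stable[OF R0] by blast
qed

text \<open>Pullbacks are determined only up to isomorphism: with \<open>f\<close> as both
  projections one gets a pullback of an identity along itself, and stability applies.\<close>

lemma deflation_iso:
  assumes "iso_arr E f"
  shows "deflation E f"
proof -
  obtain g where g: "f \<in> Arr E" "g \<in> Arr E" "Dom E g = Cod E f" "Cod E g = Dom E f"
    "g \<cdot> f = Ident E (Dom E f)" "f \<cdot> g = Ident E (Cod E f)"
    using assms by (rule isoE)
  have "is_pullback E f f (Ident E (Cod E f)) (Ident E (Cod E f))"
  proof (rule pullbackI)
    fix s t assume st: "s \<in> Arr E" "t \<in> Arr E" "Dom E s = Dom E t" "Cod E s = Dom E (Ident E (Cod E f))"
      "Cod E t = Dom E (Ident E (Cod E f))" "Ident E (Cod E f) \<cdot> s = Ident E (Cod E f) \<cdot> t"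
    then show "\<exists>u\<in>Hom E (Dom E t) (Dom E f). f \<cdot> u = s \<and> f \<cdot> u = t"
      using g by (intro bexI[of _ "g \<cdot> t"]) (auto simp: Comp_append[OF g(6)])
  qed (use g in \<open>auto intro: monicD[OF iso_is_monic[OF assms]]\<close>)
  then show ?thesis using R2_stable[of "Ident E (Cod E f)"] g by simp
qed

lemma inflation_from_zobj [simp]: "X \<in> Obj E \<Longrightarrow> inflation E (Zero E (zobj E) X)"
  using conflation_of_kernel[OF deflation_Ident kernel_Ident] by (auto simp: inflation_def)

lemma inflation_Ident [simp]:
  assumes "X \<in> Obj E"
  shows "inflation E (Ident E X)"
proof -
  have "is_kernel E (Ident E X) (Zero E X (zobj E))"
    using assms by (intro kernelI) auto
  then show ?thesis using conflation_of_kernel[OF deflation_to_zobj[OF assms]] by (auto simp: inflation_def)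
qed

lemma admissible_deflation: "deflation E f \<Longrightarrow> admissible E f"
  unfolding admissible_def
  by (intro exI[of _ f] exI[of _ "Ident E (Cod E f)"]) (simp add: deflation_arr)

lemma admissible_inflation: "inflation E f \<Longrightarrow> admissible E f"
  unfolding admissible_def
  by (intro exI[of _ f] exI[of _ "Ident E (Dom E f)"]) (simp add: inflation_arr)

lemma admissible_comp: "deflation E r \<Longrightarrow> inflation E i \<Longrightarrow> Cod E r = Dom E i \<Longrightarrow> admissible E (i \<cdot> r)"
  unfolding admissible_def by blast

lemma admissible_to_zobj: "X \<in> Obj E \<Longrightarrow> admissible E (Zero E X (zobj E))"
  by (simp add: admissible_deflation)

text \<open>The row (a h) factors as a \<oplus> 1 : X \<oplus> Y \<rightarrow> Z \<oplus> Y followed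
  by (1 h). The first is the pullback of \<open>a\<close> along the projection \<open>q1\<close>,
  the second is a sheared projection.\<close>

lemma deflation_row:
  assumes "biproduct E X Y P i1 i2 p1 p2" "deflation E a" "Dom E a = X" "h \<in> Hom E Y (Cod E a)"
  shows "deflation E (Plus E (a \<cdot> p1) (h \<cdot> p2))"
proof -
  note b = biproductD[OF assms(1)]
  let ?Z = "Cod E a"
  have a: "a \<in> Arr E" "?Z \<in> Obj E" using assms(2) deflation_arr by auto
  obtain Q j1 j2 q1 q2 where bq: "biproduct E ?Z Y Q j1 j2 q1 q2"
    using biproduct_exists[of ?Z Y] a b by auto
  note q = biproductD[OF bq]
  let ?m = "Plus E (j1 \<cdot> (a \<cdot> p1)) (j2 \<cdot> p2)"
  have "is_pullback E p1 ?m a q1"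
  proof (rule pullbackI)
    fix s t assume st: "s \<in> Arr E" "t \<in> Arr E" "Dom E s = Dom E t" "Cod E s = Dom E a"
      "Cod E t = Dom E q1" "a \<cdot> s = q1 \<cdot> t"
    then show "\<exists>u\<in>Hom E (Dom E t) (Dom E ?m). p1 \<cdot> u = s \<and> ?m \<cdot> u = t"
      using b q a assms(3) biproduct_expand[OF bq, of t]
      by (intro bexI[of _ "Plus E (i1 \<cdot> s) (i2 \<cdot> (q2 \<cdot> t))"]) auto
  next
    fix u v assume uv: "u \<in> Arr E" "v \<in> Arr E" "Dom E u = Dom E v" "Cod E u = Dom E ?m"
      "Cod E v = Dom E ?m" "p1 \<cdot> u = p1 \<cdot> v" "?m \<cdot> u = ?m \<cdot> v"
    then have "q2 \<cdot> (?m \<cdot> u) = q2 \<cdot> (?m \<cdot> v)" by simp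
    then have "p2 \<cdot> u = p2 \<cdot> v" using uv(1-6) b q a assms(3) by simp
    then show "u = v"
      using biproduct_jointly_monic[OF assms(1) uv(1-3) _ _ uv(6)] uv(4,5) b q a assms(3) by simp
  qed (use b q a assms(3) in simp_all)
  then have m: "deflation E ?m" using R2_stable[OF assms(2)] by blast
  have "deflation E (Plus E q1 (h \<cdot> q2))"
    using biproduct_shear[OF bq, of h] assms(4) biproduct_swap deflation_biproduct_projection by blast
  from R1[OF m this] show ?thesis using b q a assms(3,4) by simp
qed

text \<open>The returned \<open>p2\<close> is the sheared projection (f 1), not the projection
  chosen at the start. The whole biproduct is returned because
  \<open>zero_summand_cancellation\<close> needs \<open>g \<cdot> p2\<close> to be the row (0
  g).\<close>

lemma deflation_factor_reduction:
  assumes "f \<in> Hom E X Y" "g \<in> Hom E Y Z" "deflation E (g \<cdot> f)"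
  obtains P i1 i2 p1 p2 where "biproduct E X Y P i1 i2 p1 p2" "deflation E p2" "deflation E (g \<cdot> p2)"
proof -
  obtain P i1 i2 p1 p2 where b: "biproduct E X Y P i1 i2 p1 p2"
    using biproduct_exists[of X Y] assms by auto
  have f: "f \<in> Arr E" "Dom E f = X" "Cod E f = Y" and g: "g \<in> Arr E" "Dom E g = Y" "Cod E g = Z"
    using assms by auto
  note bD = biproductD[OF b]
  \<comment> \<open>A shear alters the first projection; swapping before and after makes it act on
    the second one.\<close>
  have "biproduct E X Y P (Plus E i1 (Neg (i2 \<cdot> f))) i2 p1 (Plus E p2 (f \<cdot> p1))"
    using biproduct_swap[OF biproduct_shear[OF biproduct_swap[OF b] assms(1)]] .
  moreover from this have "deflation E (Plus E p2 (f \<cdot> p1))"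
    by (rule deflation_biproduct_projection)
  moreover have "deflation E (g \<cdot> Plus E p2 (f \<cdot> p1))"
    using deflation_row[OF b assms(3), of g] bD f g by (simp add: Plus_commute)
  ultimately show thesis using that by blast
qed

end

context additive_category
begin

lemma kernel_of_monic: "monic m \<Longrightarrow> Dom E m = X \<Longrightarrow> is_kernel E (Zero E (zobj E) X) m"
  using kernel_monic_comp[of m "Ident E X" "Zero E (zobj E) X"] kernel_Ident[of X]
  by (auto simp: monic_def)

lemma cokernel_of_epic:
  assumes "epic e" "Cod E e = X"
  shows "is_cokernel E (Zero E X (zobj E)) e"
proof -
  have e: "e \<in> Arr E" "X \<in> Obj E" using assms by (auto simp: epic_def)
  have "is_cokernel E (Zero E X (zobj E)) (Ident E X)"
  proof (rule cokernelI)
    fix t assume "t \<in> Arr E" "Dom E t = Cod E (Ident E X)"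
      "t \<cdot> Ident E X = Zero E (Dom E (Ident E X)) (Cod E t)"
    then show "\<exists>u\<in>Hom E (Cod E (Zero E X (zobj E))) (Cod E t). u \<cdot> Zero E X (zobj E) = t"
      using e by (intro bexI[of _ "Zero E (zobj E) (Cod E t)"]) auto
  next
    fix u v assume "u \<in> Arr E" "v \<in> Arr E" "Cod E u = Cod E v"
      "Dom E u = Cod E (Zero E X (zobj E))" "Dom E v = Cod E (Zero E X (zobj E))"
    then show "u = v" using e from_zobj_eq[of u] from_zobj_eq[of v] by simp
  qed (use e in simp_all)
  then show ?thesis
    using cokernel_comp_epic[OF assms(1), of "Ident E X"] e assms(2) by simp
qed

lemma kernel_Zero: "\<lbrakk>X \<in> Obj E; Y \<in> Obj E\<rbrakk> \<Longrightarrow> is_kernel E (Ident E X) (Zero E X Y)"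
  by (intro kernelI) auto

lemma cokernel_Zero: "\<lbrakk>X \<in> Obj E; Y \<in> Obj E\<rbrakk> \<Longrightarrow> is_cokernel E (Ident E Y) (Zero E X Y)"
  by (intro cokernelI) auto

end

context deflation_exact_split
begin

section \<open>Reformulations of axiom R3\<open>\<^sup>+\<close>\<close>

lemma R3_plusD: "\<lbrakk>axiom_R3_plus E; deflation E (g \<cdot> f); f \<in> Arr E; g \<in> Arr E; Cod E f = Dom E g\<rbrakk> \<Longrightarrow> deflation E g"
  unfolding axiom_R3_plus_def by auto

lemma R3_plusI:
  assumes "\<And>X Y Z f g. \<lbrakk>f \<in> Hom E X Y; g \<in> Hom E Y Z; deflation E f; deflation E (g \<cdot> f)\<rbrakk> \<Longrightarrow> deflation E g"
  shows "axiom_R3_plus E"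
  unfolding axiom_R3_plus_def
proof (intro allI ballI impI)
  fix X Y Z f g assume fg: "f \<in> Hom E X Y" "g \<in> Hom E Y Z" "deflation E (g \<cdot> f)"
  then obtain P i1 i2 p1 p2 where "biproduct E X Y P i1 i2 p1 p2" "deflation E p2" "deflation E (g \<cdot> p2)"
    by (rule deflation_factor_reduction)
  then show "deflation E g" using assms[of p2 P Y g Z] fg(2) biproductD by auto
qed

text \<open>For R3 a kernel of \<open>g\<close> must be found. Pull \<open>g\<close> back along the
  deflation \<open>g \<cdot> f\<close>: the result \<open>p\<close> is split by the section with
  components 1 and \<open>f\<close>, so it has a kernel by weak idempotent completeness, and the
  kernel of a pullback of \<open>g\<close> is carried to a kernel of \<open>g\<close>. Conversely,
  R3+ makes each retraction a deflation, since composed with its section it is an identity.\<close>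

lemma R3_plus_iff_weakly_idempotent_complete_R3:
  "axiom_R3_plus E \<longleftrightarrow> weakly_idempotent_complete E \<and> axiom_R3 E"
proof
  assume R: "axiom_R3_plus E"
  have "\<exists>k. is_kernel E k f" if r: "retraction E f" for f
  proof -
    obtain s where s: "f \<in> Arr E" "s \<in> Hom E (Cod E f) (Dom E f)" "f \<cdot> s = Ident E (Cod E f)"
      using r by (auto simp: retraction_def)
    then have "deflation E f" by (intro R3_plusD[OF R, of f s]) auto
    then show ?thesis using deflation_kernel by blast
  qed
  then show "weakly_idempotent_complete E \<and> axiom_R3 E"
    using R unfolding weakly_idempotent_complete_def axiom_R3_def axiom_R3_plus_def by blast
next
  assume R: "weakly_idempotent_complete E \<and> axiom_R3 E"
  show "axiom_R3_plus E"
    unfolding axiom_R3_plus_def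
  proof (intro allI ballI impI)
    fix X Y Z f g assume fg: "f \<in> Hom E X Y" "g \<in> Hom E Y Z" and gf: "deflation E (g \<cdot> f)"
    then have f: "f \<in> Arr E" "Dom E f = X" "Cod E f = Y" and g: "g \<in> Arr E" "Dom E g = Y" "Cod E g = Z"
      by auto
    \<comment> \<open>The pullback exists because \<open>g \<cdot> f\<close>, not \<open>g\<close>,
      is the deflation.\<close>
    obtain p q where pb: "is_pullback E p q (g \<cdot> f) g"
      using R2_exists[OF gf, of g] f g by auto
    note pbD = pullbackD[OF pb]
    obtain s where "s \<in> Arr E" "Dom E s = X" "Cod E s = Dom E q" "p \<cdot> s = Ident E X" "q \<cdot> s = f"
      by (rule pullback_factor[OF pb, of "Ident E X" f]) (use f g in auto)
    then have "retraction E p" using pbD f g by (auto simp: retraction_def)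
    then obtain k where k: "is_kernel E k p" using R by (auto simp: weakly_idempotent_complete_def)
    note kD = kernelD[OF k]
    have "is_kernel E (q \<cdot> k) g"
    proof (rule kernelI)
      have "g \<cdot> (q \<cdot> k) = (g \<cdot> f) \<cdot> (p \<cdot> k)"
        using Comp_append[OF pbD(9), of k] pbD kD f g by simp
      then show "g \<cdot> (q \<cdot> k) = Zero E (Dom E (q \<cdot> k)) (Cod E g)"
        using kD pbD f g by simp
    next
      fix t assume t: "t \<in> Arr E" "Cod E t = Dom E g" "g \<cdot> t = Zero E (Dom E t) (Cod E g)"
      obtain u where u: "u \<in> Arr E" "Dom E u = Dom E t" "Cod E u = Dom E q"
        "p \<cdot> u = Zero E (Dom E t) X" "q \<cdot> u = t"
        by (rule pullback_factor[OF pb, of "Zero E (Dom E t) X" t]) (use t f g in auto)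
      obtain w where "w \<in> Arr E" "Dom E w = Dom E u" "Cod E w = Dom E k" "k \<cdot> w = u"
        using kernel_factor[OF k, of u] u pbD f g by auto
      then show "\<exists>u\<in>Hom E (Dom E t) (Dom E (q \<cdot> k)). (q \<cdot> k) \<cdot> u = t"
        using u kD pbD by (intro bexI[of _ w]) auto
    next
      fix u v assume uv: "u \<in> Arr E" "v \<in> Arr E" "Dom E u = Dom E v" "Cod E u = Dom E (q \<cdot> k)"
        "Cod E v = Dom E (q \<cdot> k)" "(q \<cdot> k) \<cdot> u = (q \<cdot> k) \<cdot> v"
      have "k \<cdot> u = k \<cdot> v"
        by (rule pullback_jointly_monic[OF pb]) (use uv kD pbD in \<open>simp_all add: Comp_append[OF kD(4)]\<close>)
      then show "u = v" using kernel_mono[OF k] uv kD pbD by simp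
    qed (use kD pbD in auto)
    then have "\<exists>k. is_kernel E k g" by blast
    with conjunct2[OF R, unfolded axiom_R3_def, rule_format, OF fg] gf show "deflation E g" by blast
  qed
qed

text \<open>The row (0 g) is \<open>g \<cdot> p2\<close>. One direction cancels \<open>p2\<close>;
  in the other the shear reduction produces exactly such a composite.\<close>

lemma R3_plus_iff_zero_summand_cancellation:
  "axiom_R3_plus E \<longleftrightarrow> zero_summand_cancellation E"
proof
  assume R: "axiom_R3_plus E"
  show "zero_summand_cancellation E"
    unfolding zero_summand_cancellation_def
  proof (intro allI impI)
    fix X Y Z P i1 i2 p1 p2 g m
    assume b: "biproduct E X Y P i1 i2 p1 p2" and g: "g \<in> Hom E Y Z" and m: "m \<in> Hom E P Z"
      "m \<cdot> i1 = Zero E X Z" "m \<cdot> i2 = g" "deflation E m"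
    note bD = biproductD[OF b]
    have Z: "Z \<in> Obj E" using g by auto
    have "m = m \<cdot> Plus E (i1 \<cdot> p1) (i2 \<cdot> p2)" using bD m(1) by simp
    also have "\<dots> = g \<cdot> p2"
      using bD(1-15) m g Z by (simp add: Comp_append[OF m(2)] Comp_append[OF m(3)])
    finally show "deflation E g" using R3_plusD[OF R, of g p2] m(4) g bD by simp
  qed
next
  assume C: "zero_summand_cancellation E"
  show "axiom_R3_plus E"
    unfolding axiom_R3_plus_def
  proof (intro allI ballI impI)
    fix X Y Z f g assume fg: "f \<in> Hom E X Y" "g \<in> Hom E Y Z" "deflation E (g \<cdot> f)"
    then obtain P i1 i2 p1 p2 where b: "biproduct E X Y P i1 i2 p1 p2" "deflation E (g \<cdot> p2)"
      using deflation_factor_reduction by metis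
    then have "g \<cdot> p2 \<in> Hom E P Z" "(g \<cdot> p2) \<cdot> i1 = Zero E X Z" "(g \<cdot> p2) \<cdot> i2 = g"
      using biproductD[OF b(1)] fg by simp_all
    then show "deflation E g"
      using C b fg(2) unfolding zero_summand_cancellation_def by blast
  qed
qed

lemma R3_plus_iff_deflation_criterion: "axiom_R3_plus E \<longleftrightarrow> deflation_criterion E"
proof
  assume R: "axiom_R3_plus E"
  show "deflation_criterion E" unfolding deflation_criterion_def
  proof (intro allI ballI iffI)
    fix Y Z g assume "g \<in> Hom E Y Z" "deflation E g"
    then show "\<exists>X. \<exists>f\<in>Hom E X Y. deflation E f \<and> deflation E (g \<cdot> f)"
      by (intro exI[of _ Y] bexI[of _ "Ident E Y"]) auto
  next
    fix Y Z g assume "g \<in> Hom E Y Z" "\<exists>X. \<exists>f\<in>Hom E X Y. deflation E f \<and> deflation E (g \<cdot> f)"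
    then show "deflation E g" using R unfolding axiom_R3_plus_def by blast
  qed
next
  assume "deflation_criterion E"
  then show "axiom_R3_plus E" unfolding deflation_criterion_def by (intro R3_plusI) blast
qed

text \<open>The retraction \<open>s\<close> is a deflation because composed with its section it is
  an identity; hence so is \<open>s \<cdot> g\<close>, which equals \<open>g' \<cdot> r\<close>, and
  \<open>r\<close> can be cancelled.\<close>

lemma R3_plus_imp_closed_under_retracts:
  assumes R: "axiom_R3_plus E"
  shows "deflations_closed_under_retracts E"
  unfolding deflations_closed_under_retracts_def
proof (intro allI ballI impI)
  fix Y Z Y' Z' g g' r s
  assume "g \<in> Hom E Y Z" "g' \<in> Hom E Y' Z'" "r \<in> Hom E Y Y'" "s \<in> Hom E Z Z'"
    and *: "s \<cdot> g = g' \<cdot> r" "retraction E s" "deflation E g"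
  then have t: "g \<in> Arr E" "Dom E g = Y" "Cod E g = Z" "g' \<in> Arr E" "Dom E g' = Y'" "Cod E g' = Z'"
    "r \<in> Arr E" "Dom E r = Y" "Cod E r = Y'" "s \<in> Arr E" "Dom E s = Z" "Cod E s = Z'" by auto
  obtain s' where "s' \<in> Arr E" "Dom E s' = Z'" "Cod E s' = Z" "s \<cdot> s' = Ident E Z'"
    using *(2) t by (auto simp: retraction_def)
  then have "deflation E s" using R3_plusD[OF R, of s s'] t by auto
  then have "deflation E (g' \<cdot> r)" using R1[OF *(3), of s] t *(1) by simp
  then show "deflation E g'" using R3_plusD[OF R, of g' r] t by simp
qed

text \<open>The biproduct projections are retractions from \<open>m\<close> onto \<open>g\<close>;
  the other summand follows by swapping both biproducts.\<close>

lemma closed_under_retracts_imp_summands: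
  assumes R: "deflations_closed_under_retracts E"
  shows "deflations_closed_under_summands E"
proof -
  have *: "deflation E g" if a: "biproduct E Y Y' P i i' p p'" "biproduct E Z Z' Q j j' q q'"
        "g \<in> Hom E Y Z" "g' \<in> Hom E Y' Z'" "m \<in> Hom E P Q" "m \<cdot> i = j \<cdot> g" "m \<cdot> i' = j' \<cdot> g'"
        "deflation E m" for Y Y' P i i' p p' Z Z' Q j j' q q' g g' m
  proof -
    note b = biproductD[OF a(1)] and c = biproductD[OF a(2)]
    have "q \<cdot> m = q \<cdot> (m \<cdot> Plus E (i \<cdot> p) (i' \<cdot> p'))" using b a(5) by simp
    also have "\<dots> = g \<cdot> p"
      using b(1-15) c a(3-5) by (simp add: Comp_append[OF a(6)] Comp_append[OF a(7)])
    finally have "q \<cdot> m = g \<cdot> p" .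
    moreover have "retraction E p" "retraction E q" using b c unfolding retraction_def by auto
    ultimately show ?thesis
      using R[unfolded deflations_closed_under_retracts_def] a b c by (metis Hom_iff)
  qed
  show ?thesis
    unfolding deflations_closed_under_summands_def
  proof (intro allI impI)
    fix Y Y' P i i' p p' Z Z' Q j j' q q' g g' m
    assume a: "biproduct E Y Y' P i i' p p'" "biproduct E Z Z' Q j j' q q'"
        "g \<in> Hom E Y Z" "g' \<in> Hom E Y' Z'" "m \<in> Hom E P Q" "m \<cdot> i = j \<cdot> g" "m \<cdot> i' = j' \<cdot> g'"
        "deflation E m"
    show "deflation E g \<and> deflation E g'"
      using *[OF a] *[OF biproduct_swap[OF a(1)] biproduct_swap[OF a(2)] a(4,3,5,7,6,8)] by blast
  qed
qed

text \<open>The row \<open>(0 g) : X \<oplus> Y \<rightarrow> Z\<close> is the direct sum of \<open>X \<rightarrow> 0\<close> and \<open>g\<close>.\<close>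

lemma closed_under_summands_imp_zero_summand_cancellation:
  assumes R: "deflations_closed_under_summands E"
  shows "zero_summand_cancellation E"
  unfolding zero_summand_cancellation_def
proof (intro allI impI)
  fix X Y Z P i1 i2 p1 p2 g m
  assume b: "biproduct E X Y P i1 i2 p1 p2" and g: "g \<in> Hom E Y Z" and m: "m \<in> Hom E P Z"
    "m \<cdot> i1 = Zero E X Z" "m \<cdot> i2 = g" "deflation E m"
  note bD = biproductD[OF b]
  have Z: "Z \<in> Obj E" using g by auto
  have "biproduct E (zobj E) Z Z (Zero E (zobj E) Z) (Ident E Z) (Zero E Z (zobj E)) (Ident E Z)"
    using Z by (simp add: biproduct_def Ident_zobj)
  moreover have "Zero E X (zobj E) \<in> Hom E X (zobj E)" "m \<cdot> i1 = Zero E (zobj E) Z \<cdot> Zero E X (zobj E)"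
    "m \<cdot> i2 = Ident E Z \<cdot> g"
    using bD m(2,3) Z g by auto
  ultimately show "deflation E g"
    using R b g m(1,4) unfolding deflations_closed_under_summands_def by blast
qed

text \<open>The inflation part of the arrow before a map to 0 is a kernel of a zero map, hence
  invertible. This is how a sequence property yields a deflation.\<close>

lemma exact_seq_deflation_before_Zero:
  assumes "exact_seq E fs" "Suc j < length fs" "fs ! Suc j = Zero E X (zobj E)" "X \<in> Obj E"
  shows "deflation E (fs ! j)"
proof -
  obtain r i where ri: "deflation E r" "inflation E i" "Cod E r = Dom E i" "fs ! j = i \<cdot> r"
    "is_kernel E i (fs ! Suc j)"
    using assms(1,2) unfolding exact_seq_def by (meson Suc_lessD)
  then have "deflation E i" using kernel_Zero_iso[of i X "zobj E"] assms(3,4) deflation_iso by simp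
  then show ?thesis using R1[OF ri(1) _ ri(3)] ri(4) by simp
qed

lemma inflation_cokernel_pairI:
  assumes "deflation E g" "is_kernel E k g"
  shows "inflation E k" "is_cokernel E g k"
  using conflation_of_kernel[OF assms] conflationD unfolding inflation_def by blast+

text \<open>With \<open>k : K \<rightarrow> X\<close> and \<open>l : L \<rightarrow> X\<close> the kernels of \<open>f\<close> and \<open>g f\<close>, apply the property to
  \<open>K \<rightarrow> K \<oplus> L \<rightarrow> X\<close>: the first map is the injection and the second one has image \<open>L\<close>, so that the
  cokernels of the composite and of the second map are \<open>f\<close> and \<open>g f\<close>.\<close>

lemma ker_coker_sequence_imp_R3_plus:
  assumes "ker_coker_sequence_property E"
  shows "axiom_R3_plus E"
proof (rule R3_plusI)
  fix X Y Z f g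
  assume "f \<in> Hom E X Y" "g \<in> Hom E Y Z" and fd: "deflation E f" and gfd: "deflation E (g \<cdot> f)"
  then have f: "f \<in> Arr E" "Dom E f = X" "Cod E f = Y" and g: "g \<in> Arr E" "Dom E g = Y" "Cod E g = Z"
    by auto
  obtain k where k: "(k, f) \<in> conflations E" "inflation E k" "is_kernel E k f" "is_cokernel E f k"
    using deflation_kernel[OF fd] .
  obtain l where l: "inflation E l" "is_kernel E l (g \<cdot> f)" "is_cokernel E (g \<cdot> f) l"
    using deflation_kernel[OF gfd] .
  note kD = kernelD[OF k(3)] and lD = kernelD[OF l(2)]
  obtain c where c: "c \<in> Arr E" "Dom E c = Dom E k" "Cod E c = Dom E l" "l \<cdot> c = k"
    using kernel_factor[OF l(2), of k] kD f g by auto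
  obtain P i1 i2 p1 p2 where b: "biproduct E (Dom E k) (Dom E l) P i1 i2 p1 p2"
    using biproduct_exists[of "Dom E k" "Dom E l"] kD lD by auto
  note bD = biproductD[OF b]
  \<comment> \<open>\<open>u\<close> is the row (c 1) : K \<oplus> L \<rightarrow> L, a sheared
    projection. Since \<open>l \<cdot> c = k\<close>, the composite \<open>l \<cdot> u\<close> is
    the row (k l).\<close>
  define u where "u = Plus E p2 (c \<cdot> p1)"
  have b': "biproduct E (Dom E k) (Dom E l) P (Plus E i1 (Neg (i2 \<cdot> c))) i2 p1 u"
    using biproduct_swap[OF biproduct_shear[OF biproduct_swap[OF b], of c]] c by (simp add: u_def)
  have u: "deflation E u" "u \<in> Arr E" "Dom E u = P" "Cod E u = Dom E l"
    using deflation_biproduct_projection[OF b'] biproductD[OF b'] by auto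
  have ui: "u \<cdot> i1 = c" using bD c by (simp add: u_def)
  have h: "(l \<cdot> u) \<cdot> i1 = k" using u lD bD ui c by simp
  note i1 = conflation_biproduct[OF b]
  have i1': "inflation E i1" using i1 by (auto simp: inflation_def)
  \<comment> \<open>The kernel of \<open>l \<cdot> u\<close> is that of the projection
    \<open>u\<close>, its cokernel is that of \<open>l\<close>.\<close>
  note lu = kernel_monic_comp[OF inflation_monic[OF l(1)], of u] cokernel_comp_epic[OF deflation_epic[OF u(1)], of l]
  have "admissible E i1" "admissible E (l \<cdot> u)" "admissible E ((l \<cdot> u) \<cdot> i1)"
    unfolding h using admissible_inflation k(2) i1' admissible_comp[OF u(1) l(1)] u by auto
  moreover have "is_kernel E (Zero E (zobj E) (Dom E k)) i1"
    using kernel_of_monic[OF inflation_monic[OF i1']] bD by simp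
  moreover have "is_kernel E (Plus E i1 (Neg (i2 \<cdot> c))) (l \<cdot> u)"
    using lu biproduct_kernel[OF b'] u by simp
  moreover have "is_kernel E (Zero E (zobj E) (Dom E k)) ((l \<cdot> u) \<cdot> i1)"
    unfolding h using kernel_of_monic[OF inflation_monic[OF k(2)]] by simp
  moreover have "is_cokernel E p2 i1" using conflationD(2)[OF i1] .
  moreover have "is_cokernel E (g \<cdot> f) (l \<cdot> u)"
    using lu l(3) u lD by simp
  moreover have "is_cokernel E f ((l \<cdot> u) \<cdot> i1)"
    unfolding h by (rule k(4))
  moreover have "i1 \<in> Hom E (Dom E k) P" "l \<cdot> u \<in> Hom E P X"
    using bD lD u f g by auto
  ultimately have "\<exists>a b d. \<exists>e \<in> Hom E (Cod E f) (Cod E (g \<cdot> f)). e \<cdot> f = g \<cdot> f \<and>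
      exact_seq E [Zero E (zobj E) (Dom E (Zero E (zobj E) (Dom E k))), a, b,
        p2 \<cdot> Plus E i1 (Neg (i2 \<cdot> c)), d, e, Zero E (Cod E (g \<cdot> f)) (zobj E)]"
    using assms[unfolded ker_coker_sequence_property_def Let_def, rule_format,
        of i1 "Dom E k" P "l \<cdot> u" X "Zero E (zobj E) (Dom E k)" "Plus E i1 (Neg (i2 \<cdot> c))"
          "Zero E (zobj E) (Dom E k)" p2 "g \<cdot> f" f] by blast
  then obtain a b d e where e: "e \<in> Hom E (Cod E f) (Cod E (g \<cdot> f))" "e \<cdot> f = g \<cdot> f"
    and ex: "exact_seq E [Zero E (zobj E) (Dom E (Zero E (zobj E) (Dom E k))), a, b,
        p2 \<cdot> Plus E i1 (Neg (i2 \<cdot> c)), d, e, Zero E (Cod E (g \<cdot> f)) (zobj E)]"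
    by blast
  \<comment> \<open>Naturality determines the last map between cokernels on the epic
    \<open>f\<close>; it sits at index 5 of the sequence.\<close>
  have "e = g" by (rule epicD[OF deflation_epic[OF fd] e(2)]) (use e f g in auto)
  moreover have "Z \<in> Obj E" using g by auto
  ultimately show "deflation E g"
    using exact_seq_deflation_before_Zero[OF ex, of 5 Z] f g by simp
qed

text \<open>Each arrow is its own image factorisation, padded by an identity. The final zero map is
  a cokernel of \<open>g\<close> because \<open>g\<close> is epic.\<close>

lemma exact_seq_conflation_right:
  assumes "(f, g) \<in> conflations E"
  shows "exact_seq E [f, g, Zero E (Cod E g) (zobj E)]"
proof -
  note k = conflationD(1)[OF assms] and c = conflationD(2)[OF assms]
  note kD = kernelD[OF k]
  have d: "deflation E g" "inflation E f" using assms by (auto simp: deflation_def inflation_def)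
  show ?thesis
    unfolding exact_seq_def
  proof (intro allI impI)
    fix j assume "j < length [f, g, Zero E (Cod E g) (zobj E)]"
    then consider "j = 0" | "j = 1" | "j = 2" by fastforce
    then show "\<exists>\<rho> \<iota>. deflation E \<rho> \<and> inflation E \<iota> \<and> Cod E \<rho> = Dom E \<iota> \<and>
        [f, g, Zero E (Cod E g) (zobj E)] ! j = \<iota> \<cdot> \<rho> \<and>
        (Suc j < length [f, g, Zero E (Cod E g) (zobj E)] \<longrightarrow>
          is_kernel E \<iota> ([f, g, Zero E (Cod E g) (zobj E)] ! Suc j)) \<and>
        (0 < j \<longrightarrow> is_cokernel E \<rho> ([f, g, Zero E (Cod E g) (zobj E)] ! (j - 1)))"
    proof cases
      case 1
      then show ?thesis using d k kD by (intro exI[of _ "Ident E (Dom E f)"] exI[of _ f]) simp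
    next
      case 2
      then show ?thesis using d c kD
        by (intro exI[of _ g] exI[of _ "Ident E (Cod E g)"]) (simp add: kernel_Zero)
    next
      case 3
      then show ?thesis using d c kD
        by (intro exI[of _ "Zero E (Cod E g) (zobj E)"] exI[of _ "Ident E (zobj E)"])
          (simp add: cokernel_of_epic[OF deflation_epic])
    qed
  qed
qed

lemma exact_seq_conflation_left:
  assumes "(f, g) \<in> conflations E"
  shows "exact_seq E [Zero E (zobj E) (Dom E f), f, g]"
proof -
  note k = conflationD(1)[OF assms] and c = conflationD(2)[OF assms]
  note kD = kernelD[OF k]
  have d: "deflation E g" "inflation E f" using assms by (auto simp: deflation_def inflation_def)
  show ?thesis
    unfolding exact_seq_def
  proof (intro allI impI)
    fix j assume "j < length [Zero E (zobj E) (Dom E f), f, g]"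
    then consider "j = 0" | "j = 1" | "j = 2" by fastforce
    then show "\<exists>\<rho> \<iota>. deflation E \<rho> \<and> inflation E \<iota> \<and> Cod E \<rho> = Dom E \<iota> \<and>
        [Zero E (zobj E) (Dom E f), f, g] ! j = \<iota> \<cdot> \<rho> \<and>
        (Suc j < length [Zero E (zobj E) (Dom E f), f, g] \<longrightarrow>
          is_kernel E \<iota> ([Zero E (zobj E) (Dom E f), f, g] ! Suc j)) \<and>
        (0 < j \<longrightarrow> is_cokernel E \<rho> ([Zero E (zobj E) (Dom E f), f, g] ! (j - 1)))"
    proof cases
      case 1
      then show ?thesis using d kD
        by (intro exI[of _ "Ident E (zobj E)"] exI[of _ "Zero E (zobj E) (Dom E f)"])
          (simp add: kernel_of_monic[OF inflation_monic])
    next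
      case 2
      then show ?thesis using d k kD
        by (intro exI[of _ "Ident E (Dom E f)"] exI[of _ f]) (simp add: cokernel_Zero)
    next
      case 3
      then show ?thesis using d c kD
        by (intro exI[of _ g] exI[of _ "Ident E (Cod E g)"]) simp
    qed
  qed
qed

text \<open>Conflations are exact rows with admissible arrows. Thus one test diagram and one chase
  serve both snake lemmas.\<close>

lemma short_snake_diagram_imp_long:
  assumes "short_snake_diagram E S"
  shows "long_snake_diagram E S"
proof -
  have "(top1 S, top2 S) \<in> conflations E" "(bot1 S, bot2 S) \<in> conflations E" "snake_diagram E S"
    using assms by (auto simp: short_snake_diagram_def)
  then show ?thesis
    unfolding long_snake_diagram_def
    using exact_seq_conflation_right exact_seq_conflation_left admissible_deflation admissible_inflation
    unfolding deflation_def inflation_def by blast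
qed

text \<open>The diagram has the rows \<open>0 \<rightarrow> K \<oplus> L = K \<oplus> L\<close> and \<open>L \<rightarrow> X \<oplus> L \<rightarrow> X\<close>, the latter split with
  second map \<open>(1 l)\<close>; the vertical maps \<open>k \<oplus> 1\<close> and \<open>(k l)\<close> have the cokernels \<open>Y\<close> and \<open>Z\<close>.\<close>

lemma short_snake_reduction:
  assumes "f \<in> Hom E X Y" "g \<in> Hom E Y Z" and fd: "deflation E f" and gfd: "deflation E (g \<cdot> f)"
  obtains S where "short_snake_diagram E S" "Cod E (cok3 S) = Z"
    "\<forall>\<kappa>1 \<kappa>2 \<gamma>1 \<gamma>2. snake_induced E S \<kappa>1 \<kappa>2 \<gamma>1 \<gamma>2 \<longrightarrow> \<gamma>2 = g"
proof -
  have f: "f \<in> Arr E" "Dom E f = X" "Cod E f = Y" and g: "g \<in> Arr E" "Dom E g = Y" "Cod E g = Z"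
    using assms by auto
  obtain k where k: "(k, f) \<in> conflations E" "inflation E k" "is_kernel E k f" "is_cokernel E f k"
    using deflation_kernel[OF fd] .
  obtain l where l: "inflation E l" "is_kernel E l (g \<cdot> f)" "is_cokernel E (g \<cdot> f) l"
    using deflation_kernel[OF gfd] .
  define K where "K = Dom E k"
  define L where "L = Dom E l"
  have kD: "k \<in> Arr E" "Dom E k = K" "Cod E k = X" "f \<cdot> k = Zero E K Y"
    using kernelD[OF k(3)] f by (auto simp: K_def)
  have lD: "l \<in> Arr E" "Dom E l = L" "Cod E l = X" "g \<cdot> (f \<cdot> l) = Zero E L Z"
    using kernelD[OF l(2)] f g by (auto simp: L_def)
  have O: "K \<in> Obj E" "L \<in> Obj E" "X \<in> Obj E" "Y \<in> Obj E" "Z \<in> Obj E" using kD lD f g by auto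
  have "(g \<cdot> f) \<cdot> k = Zero E K Z" using kD f g O by simp
  then obtain c where c: "c \<in> Arr E" "Dom E c = K" "Cod E c = L" "l \<cdot> c = k"
    using kernel_factor[OF l(2), of k] kD lD(2) f g O by auto
  obtain P i1 i2 p1 p2 where b: "biproduct E K L P i1 i2 p1 p2"
    using biproduct_exists O by blast
  obtain Q j1 j2 q1 q2 where bq: "biproduct E X L Q j1 j2 q1 q2"
    using biproduct_exists O by blast
  note bD = biproductD[OF b] and qD = biproductD[OF bq]
  define u where "u = Plus E p2 (c \<cdot> p1)"
  have b': "biproduct E K L P (Plus E i1 (Neg (i2 \<cdot> c))) i2 p1 u"
    using biproduct_swap[OF biproduct_shear[OF biproduct_swap[OF b], of c]] c by (simp add: u_def)
  have u: "deflation E u" "u \<in> Arr E" "Dom E u = P" "Cod E u = L"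
    using deflation_biproduct_projection[OF b'] biproductD[OF b'] by auto
  \<comment> \<open>\<open>m\<close> is k \<oplus> 1 : K \<oplus> L \<rightarrow> X \<oplus> L, and
    \<open>u\<close> above is the row (c 1).\<close>
  define m where "m = Plus E (j1 \<cdot> (k \<cdot> p1)) (j2 \<cdot> p2)"
  have m: "m \<in> Arr E" "Dom E m = P" "Cod E m = Q" using bD qD kD by (simp_all add: m_def)
  have q1m: "q1 \<cdot> m = k \<cdot> p1" and q2m: "q2 \<cdot> m = p2"
    unfolding m_def using bD qD kD by simp_all
  \<comment> \<open>Shearing X \<oplus> L by \<open>l\<close> gives another splitting, in which
    \<open>v1\<close>, with components -l and 1, is the kernel of \<open>v2\<close>, the row (1
    l).\<close>
  define v1 where "v1 = Plus E j2 (Neg (j1 \<cdot> l))"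
  define v2 where "v2 = Plus E q1 (l \<cdot> q2)"
  have "biproduct E L X Q v1 j1 q2 v2"
    unfolding v1_def v2_def using lD biproduct_swap[OF biproduct_shear[OF bq, of l]] by simp
  note v = conflation_biproduct[OF this] biproductD[OF this]
  \<comment> \<open>The right-hand square: (1 l) after k \<oplus> 1 is (k l), which factors as
    \<open>l \<cdot> u\<close>.\<close>
  have v2m: "v2 \<cdot> m = l \<cdot> u"
    unfolding u_def v2_def using bD qD kD c lD m
    by (simp add: q1m q2m Comp_append[OF c(4)] Plus_commute)
  \<comment> \<open>The cokernel of \<open>m\<close> is reached from the other side:
    \<open>f \<cdot> q1\<close> is a deflation with kernel \<open>m\<close>, so \<open>m\<close> is
    an inflation with cokernel \<open>f \<cdot> q1\<close>.\<close>
  have fq: "deflation E (f \<cdot> q1)"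
    using R1[OF deflation_biproduct_projection[OF biproduct_swap[OF bq]] fd] f qD by simp
  have km: "is_kernel E m (f \<cdot> q1)"
  proof (rule kernelI)
    show "f \<cdot> q1 \<cdot> m = Zero E (Dom E m) (Cod E (f \<cdot> q1))"
      using f qD m kD bD O by (simp add: q1m Comp_append[OF kD(4)])
  next
    fix t assume t: "t \<in> Arr E" "Cod E t = Dom E (f \<cdot> q1)" "f \<cdot> q1 \<cdot> t = Zero E (Dom E t) (Cod E (f \<cdot> q1))"
    obtain w where w: "w \<in> Arr E" "Dom E w = Dom E t" "Cod E w = K" "k \<cdot> w = q1 \<cdot> t"
      using kernel_factor[OF k(3), of "q1 \<cdot> t"] t f qD kD(2) by auto
    let ?w = "Plus E (i1 \<cdot> w) (i2 \<cdot> (q2 \<cdot> t))"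
    have "m \<cdot> ?w = Plus E (j1 \<cdot> (q1 \<cdot> t)) (j2 \<cdot> (q2 \<cdot> t))"
      unfolding m_def using w t f qD bD kD O by simp
    also have "\<dots> = t" using biproduct_expand[OF bq, of t] t f qD by simp
    finally show "\<exists>w\<in>Hom E (Dom E t) (Dom E m). m \<cdot> w = t"
      using w t f qD bD m by (intro bexI[of _ ?w]) auto
  next
    fix s t assume st: "s \<in> Arr E" "t \<in> Arr E" "Dom E s = Dom E t" "Cod E s = Dom E m" "Cod E t = Dom E m"
      "m \<cdot> s = m \<cdot> t"
    have e: "q1 \<cdot> (m \<cdot> x) = k \<cdot> (p1 \<cdot> x)" "q2 \<cdot> (m \<cdot> x) = p2 \<cdot> x" if "x \<in> Arr E" "Cod E x = P" for x
      using Comp_append[OF q1m, of x] Comp_append[OF q2m, of x] that m qD kD bD by simp_all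
    have "k \<cdot> (p1 \<cdot> s) = k \<cdot> (p1 \<cdot> t)" "p2 \<cdot> s = p2 \<cdot> t" using st m e by metis+
    moreover from this have "p1 \<cdot> s = p1 \<cdot> t"
      using st m bD kD by (intro kernel_mono[OF k(3), of "p1 \<cdot> s" "p1 \<cdot> t"]) simp_all
    ultimately show "s = t"
      using biproduct_jointly_monic[OF b, of s t] st m by simp
  qed (use m f qD in auto)
  note fqm = inflation_cokernel_pairI[OF fq km]
  define S where "S = \<lparr>top1 = Zero E (zobj E) P, top2 = Ident E P, bot1 = v1, bot2 = v2,
    vert1 = Zero E (zobj E) L, vert2 = m, vert3 = l \<cdot> u,
    ker1 = Zero E (zobj E) (zobj E), ker2 = Zero E (zobj E) P, ker3 = Plus E i1 (Neg (i2 \<cdot> c)),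
    cok1 = Ident E L, cok2 = f \<cdot> q1, cok3 = g \<cdot> f\<rparr>"
  have "Zero E (zobj E) P \<in> Hom E (zobj E) P" "Ident E P \<in> Hom E P P" "v1 \<in> Hom E L Q" "v2 \<in> Hom E Q X"
    "Zero E (zobj E) L \<in> Hom E (zobj E) L" "m \<in> Hom E P Q" "l \<cdot> u \<in> Hom E P X"
    using bD(3) v O m lD u by auto
  moreover have "m \<cdot> Zero E (zobj E) P = v1 \<cdot> Zero E (zobj E) L" "l \<cdot> u \<cdot> Ident E P = v2 \<cdot> m"
    using v m lD u bD v2m by simp_all
  moreover have "admissible E (Zero E (zobj E) L)" "admissible E m" "admissible E (l \<cdot> u)"
    using admissible_inflation fqm admissible_comp[OF u(1) l(1)] u lD O by auto
  moreover have "is_kernel E (Zero E (zobj E) (zobj E)) (Zero E (zobj E) L)"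
    "is_kernel E (Zero E (zobj E) P) m" "is_kernel E (Plus E i1 (Neg (i2 \<cdot> c))) (l \<cdot> u)"
    using kernel_of_monic[OF inflation_monic] fqm m O biproduct_kernel[OF b']
      kernel_monic_comp[OF inflation_monic[OF l(1)], of u] u lD by auto
  moreover have "is_cokernel E (Ident E L) (Zero E (zobj E) L)" "is_cokernel E (f \<cdot> q1) m"
    "is_cokernel E (g \<cdot> f) (l \<cdot> u)"
    using cokernel_Zero O fqm l(3) cokernel_comp_epic[OF deflation_epic[OF u(1)], of l] u lD by auto
  ultimately have "snake_diagram E S"
    unfolding snake_diagram_def S_def by auto
  then have "short_snake_diagram E S"
    unfolding short_snake_diagram_def S_def
    using v(1) conflation_of_kernel[OF deflation_Ident kernel_Ident] bD(3) by simp
  moreover have "Cod E (cok3 S) = Z" using f g by (simp add: S_def)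
  \<comment> \<open>On X \<oplus> L the composite \<open>g \<cdot> f \<cdot> v2\<close> agrees with
    \<open>g \<cdot> (f \<cdot> q1)\<close>, as \<open>g \<cdot> f\<close> kills \<open>l\<close>;
    cancelling the epic \<open>f \<cdot> q1\<close> gives the claim.\<close>
  moreover have "\<gamma>2 = g" if s: "snake_induced E S \<kappa>1 \<kappa>2 \<gamma>1 \<gamma>2" for \<kappa>1 \<kappa>2 \<gamma>1 \<gamma>2
  proof -
    have ga: "\<gamma>2 \<in> Arr E" "Dom E \<gamma>2 = Y" "Cod E \<gamma>2 = Z" "\<gamma>2 \<cdot> (f \<cdot> q1) = g \<cdot> f \<cdot> v2"
      using s f g qD by (simp_all add: snake_induced_def S_def)
    have "g \<cdot> f \<cdot> v2 = Plus E (g \<cdot> (f \<cdot> q1)) ((g \<cdot> (f \<cdot> l)) \<cdot> q2)"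
      unfolding v2_def using f g lD(1-3) qD by simp
    also have "\<dots> = g \<cdot> (f \<cdot> q1)" using lD(4) qD f g O by simp
    finally show ?thesis
      using ga f g qD by (intro epicD[OF deflation_epic[OF fq], of \<gamma>2 g]) simp_all
  qed
  ultimately show thesis using that by blast
qed

lemma short_snake_imp_R3_plus:
  assumes "short_snake_lemma E"
  shows "axiom_R3_plus E"
proof (rule R3_plusI)
  fix X Y Z f g
  assume "f \<in> Hom E X Y" and g: "g \<in> Hom E Y Z" and "deflation E f" "deflation E (g \<cdot> f)"
  then obtain S where S: "short_snake_diagram E S" "Cod E (cok3 S) = Z"
    "\<forall>\<kappa>1 \<kappa>2 \<gamma>1 \<gamma>2. snake_induced E S \<kappa>1 \<kappa>2 \<gamma>1 \<gamma>2 \<longrightarrow> \<gamma>2 = g"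
    by (rule short_snake_reduction)
  obtain \<delta> \<kappa>1 \<kappa>2 \<gamma>1 \<gamma>2 where "snake_induced E S \<kappa>1 \<kappa>2 \<gamma>1 \<gamma>2"
    and ex: "exact_seq E [Zero E (zobj E) (Dom E (ker1 S)), \<kappa>1, \<kappa>2, \<delta> S, \<gamma>1, \<gamma>2, Zero E (Cod E (cok3 S)) (zobj E)]"
    using assms S(1) unfolding short_snake_lemma_def by blast
  moreover have "Z \<in> Obj E" using g by auto
  ultimately show "deflation E g"
    using exact_seq_deflation_before_Zero[OF ex, of 5 Z] S(2,3) by auto
qed

text \<open>The test diagram of the short case is read as a long one. There \<open>bot2\<close> is
  epic, so its cokernel is 0 and \<gamma>3 is the map Z \<rightarrow> 0; exactness makes \<gamma>2,
  which is \<open>g\<close>, a deflation. The extra \<kappa>0 moves \<gamma>2 to index 6.\<close>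

lemma snake_imp_R3_plus:
  assumes "snake_lemma E"
  shows "axiom_R3_plus E"
proof (rule R3_plusI)
  fix X Y Z f g
  assume "f \<in> Hom E X Y" and g: "g \<in> Hom E Y Z" and "deflation E f" "deflation E (g \<cdot> f)"
  then obtain S where S: "short_snake_diagram E S" "Cod E (cok3 S) = Z"
    "\<forall>\<kappa>1 \<kappa>2 \<gamma>1 \<gamma>2. snake_induced E S \<kappa>1 \<kappa>2 \<gamma>1 \<gamma>2 \<longrightarrow> \<gamma>2 = g"
    by (rule short_snake_reduction)
  have "inflation E (top1 S)" "deflation E (bot2 S)"
    using S(1) by (auto simp: short_snake_diagram_def inflation_def deflation_def)
  then have "is_kernel E (Zero E (zobj E) (Dom E (top1 S))) (top1 S)"
    "is_cokernel E (Zero E (Cod E (bot2 S)) (zobj E)) (bot2 S)"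
    by (auto intro: kernel_of_monic cokernel_of_epic inflation_monic deflation_epic)
  then obtain \<delta> \<kappa>0 \<kappa>1 \<kappa>2 \<gamma>1 \<gamma>2 \<gamma>3 where *: "snake_induced E S \<kappa>1 \<kappa>2 \<gamma>1 \<gamma>2"
      "\<gamma>3 \<in> Hom E (Cod E (cok3 S)) (Cod E (Zero E (Cod E (bot2 S)) (zobj E)))"
    and ex: "exact_seq E [Zero E (zobj E) (Dom E (Zero E (zobj E) (Dom E (top1 S)))), \<kappa>0, \<kappa>1, \<kappa>2, \<delta> S,
      \<gamma>1, \<gamma>2, \<gamma>3, Zero E (Cod E (Zero E (Cod E (bot2 S)) (zobj E))) (zobj E)]"
    using assms short_snake_diagram_imp_long[OF S(1)] unfolding snake_lemma_def by blast
  have "Cod E (bot2 S) \<in> Obj E" using \<open>deflation E (bot2 S)\<close> deflation_arr by simp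
  then have "\<gamma>3 = Zero E Z (zobj E)" using *(2) S(2) to_zobj_eq[of \<gamma>3] by simp
  moreover have "Z \<in> Obj E" using g by auto
  ultimately show "deflation E g"
    using exact_seq_deflation_before_Zero[OF ex, of 6 Z] S(3)[rule_format, OF *(1)] by simp
qed

section \<open>Local exactness\<close>

text \<open>Exactness of the represented sheaves in the topology of deflations.\<close>

definition loc_exact :: "'m \<Rightarrow> 'm \<Rightarrow> bool" where
  "loc_exact f g \<longleftrightarrow> f \<in> Arr E \<and> g \<in> Arr E \<and> Cod E f = Dom E g \<and> g \<cdot> f = Zero E (Dom E f) (Cod E g) \<and>
     (\<forall>t. t \<in> Arr E \<longrightarrow> Cod E t = Dom E g \<longrightarrow> g \<cdot> t = Zero E (Dom E t) (Cod E g) \<longrightarrow>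
        (\<exists>q s. deflation E q \<and> Cod E q = Dom E t \<and> s \<in> Hom E (Dom E q) (Dom E f) \<and> f \<cdot> s = t \<cdot> q))"

lemma loc_exactI:
  assumes "f \<in> Arr E" "g \<in> Arr E" "Cod E f = Dom E g" "g \<cdot> f = Zero E (Dom E f) (Cod E g)"
    and "\<And>t. \<lbrakk>t \<in> Arr E; Cod E t = Dom E g; g \<cdot> t = Zero E (Dom E t) (Cod E g)\<rbrakk> \<Longrightarrow>
        \<exists>q s. deflation E q \<and> Cod E q = Dom E t \<and> s \<in> Hom E (Dom E q) (Dom E f) \<and> f \<cdot> s = t \<cdot> q"
  shows "loc_exact f g"
  using assms unfolding loc_exact_def by blast

lemma loc_exactE:
  assumes "loc_exact f g" "t \<in> Arr E" "Cod E t = Dom E g" "g \<cdot> t = Zero E (Dom E t) (Cod E g)"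
  obtains q s where "deflation E q" "q \<in> Arr E" "Cod E q = Dom E t"
    "s \<in> Arr E" "Dom E s = Dom E q" "Cod E s = Dom E f" "f \<cdot> s = t \<cdot> q"
  using assms deflation_arr unfolding loc_exact_def by (metis Hom_iff)

lemma deflation_lift:
  assumes "deflation E e" "t \<in> Arr E" "Cod E t = Cod E e"
  obtains q s where "deflation E q" "q \<in> Arr E" "Cod E q = Dom E t"
    "s \<in> Arr E" "Dom E s = Dom E q" "Cod E s = Dom E e" "e \<cdot> s = t \<cdot> q"
proof -
  obtain p q where pb: "is_pullback E p q e t" using R2_exists[OF assms] by blast
  then show thesis using that[of q p] R2_stable[OF assms(1) pb] pullbackD[OF pb] by simp
qed

lemma loc_exact_kernel:
  assumes "is_kernel E k f"
  shows "loc_exact k f"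
proof (rule loc_exactI)
  fix t assume t: "t \<in> Arr E" "Cod E t = Dom E f" "f \<cdot> t = Zero E (Dom E t) (Cod E f)"
  obtain u where "u \<in> Arr E" "Dom E u = Dom E t" "Cod E u = Dom E k" "k \<cdot> u = t"
    using kernel_factor[OF assms t] .
  then show "\<exists>q s. deflation E q \<and> Cod E q = Dom E t \<and> s \<in> Hom E (Dom E q) (Dom E k) \<and> k \<cdot> s = t \<cdot> q"
    using t by (intro exI[of _ "Ident E (Dom E t)"] exI[of _ u]) auto
qed (use kernelD[OF assms] in auto)

text \<open>With \<open>f = i \<cdot> r\<close>, the arrow \<open>c\<close> is also a cokernel of
  the inflation \<open>i\<close>, so (i, c) is a conflation. An element killed by \<open>c\<close>
  factors through \<open>i\<close> and then lifts along the deflation \<open>r\<close> on a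
  cover.\<close>

lemma admissible_cokernel:
  assumes "admissible E f" "is_cokernel E c f"
  shows "deflation E c" "loc_exact f c"
proof -
  obtain r i where ri: "deflation E r" "inflation E i" "Cod E r = Dom E i" "f = i \<cdot> r"
    using assms(1) by (auto simp: admissible_def)
  have r: "r \<in> Arr E" "i \<in> Arr E" using ri deflation_arr inflation_arr by auto
  have "is_cokernel E c i"
    using assms(2) cokernel_comp_epic[OF deflation_epic[OF ri(1)], of i] r ri by simp
  then have ic: "(i, c) \<in> conflations E" using conflation_of_cokernel ri(2) by blast
  then show "deflation E c" by (auto simp: deflation_def)
  note cD = cokernelD[OF assms(2)] and k = conflationD(1)[OF ic]
  show "loc_exact f c"
  proof (rule loc_exactI)
    fix t assume t: "t \<in> Arr E" "Cod E t = Dom E c" "c \<cdot> t = Zero E (Dom E t) (Cod E c)"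
    obtain u where u: "u \<in> Arr E" "Dom E u = Dom E t" "Cod E u = Dom E i" "i \<cdot> u = t"
      using kernel_factor[OF k t] .
    obtain q s where q: "deflation E q" "q \<in> Arr E" "Cod E q = Dom E u"
      "s \<in> Arr E" "Dom E s = Dom E q" "Cod E s = Dom E r" "r \<cdot> s = u \<cdot> q"
      using deflation_lift[OF ri(1) u(1)] u(3) ri(3) by auto
    have "f \<cdot> s = i \<cdot> (u \<cdot> q)" using q r ri by simp
    also have "\<dots> = t \<cdot> q" using Comp_append[OF u(4), of q] u q r by simp
    finally have "f \<cdot> s = t \<cdot> q" .
    moreover have "Dom E f = Dom E r" using r ri by simp
    ultimately show "\<exists>q s. deflation E q \<and> Cod E q = Dom E t \<and> s \<in> Hom E (Dom E q) (Dom E f) \<and> f \<cdot> s = t \<cdot> q"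
      using q(1-6) u(2) by (intro exI[of _ q] exI[of _ s]) simp
  qed (use cD in auto)
qed

lemma exact_seq_imp_loc_exact:
  assumes "exact_seq E fs" "Suc j < length fs"
  shows "loc_exact (fs ! j) (fs ! Suc j)"
proof -
  obtain r i where ri: "deflation E r" "inflation E i" "Cod E r = Dom E i" "fs ! j = i \<cdot> r"
    "is_kernel E i (fs ! Suc j)"
    using assms unfolding exact_seq_def by (meson Suc_lessD)
  note iD = kernelD[OF ri(5)]
  have r: "r \<in> Arr E" using ri deflation_arr by auto
  show ?thesis unfolding ri(4)
  proof (rule loc_exactI)
    fix t assume t: "t \<in> Arr E" "Cod E t = Dom E (fs ! Suc j)"
      "fs ! Suc j \<cdot> t = Zero E (Dom E t) (Cod E (fs ! Suc j))"
    obtain u where u: "u \<in> Arr E" "Dom E u = Dom E t" "Cod E u = Dom E i" "i \<cdot> u = t"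
      using kernel_factor[OF ri(5) t] .
    obtain q s where q: "deflation E q" "q \<in> Arr E" "Cod E q = Dom E u"
      "s \<in> Arr E" "Dom E s = Dom E q" "Cod E s = Dom E r" "r \<cdot> s = u \<cdot> q"
      using deflation_lift[OF ri(1) u(1)] u(3) ri(3) by auto
    have "(i \<cdot> r) \<cdot> s = i \<cdot> (u \<cdot> q)" using q r ri iD by simp
    also have "\<dots> = t \<cdot> q" using Comp_append[OF u(4), of q] u q r iD by simp
    finally have "(i \<cdot> r) \<cdot> s = t \<cdot> q" .
    moreover have "Dom E (i \<cdot> r) = Dom E r" using r ri(3) iD by simp
    ultimately show "\<exists>q s. deflation E q \<and> Cod E q = Dom E t \<and> s \<in> Hom E (Dom E q) (Dom E (i \<cdot> r)) \<and> (i \<cdot> r) \<cdot> s = t \<cdot> q"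
      using q(1-6) u(2) by (intro exI[of _ q] exI[of _ s]) (simp del: Comp_assoc_right)
  next
    show "fs ! Suc j \<cdot> (i \<cdot> r) = Zero E (Dom E (i \<cdot> r)) (Cod E (fs ! Suc j))"
      using r ri iD by (simp add: Comp_append[OF iD(4)])
  qed (use r ri iD in auto)
qed

text \<open>The decisive use of R3+. Factor \<open>f\<close> as \<open>i \<cdot> r\<close> through
  the kernel \<open>i\<close> of \<open>g\<close>; \<open>r\<close> is locally surjective, hence a
  deflation. The arrow \<open>i\<close> is an inflation, being the kernel of the deflation part of
  \<open>g\<close>.\<close>

lemma loc_exact_image:
  assumes R: "axiom_R3_plus E" and "loc_exact f g" "admissible E g"
  obtains r i where "deflation E r" "inflation E i" "Cod E r = Dom E i" "f = i \<cdot> r" "is_kernel E i g"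
proof -
  obtain r' i' where g: "deflation E r'" "inflation E i'" "Cod E r' = Dom E i'" "g = i' \<cdot> r'"
    using assms(3) by (auto simp: admissible_def)
  obtain i where i: "inflation E i" "is_kernel E i r'" using deflation_kernel[OF g(1)] by blast
  have ig: "is_kernel E i g"
    using i(2) kernel_monic_comp[OF inflation_monic[OF g(2)], of r'] g deflation_arr by simp
  note iD = kernelD[OF ig]
  have f: "f \<in> Arr E" "Cod E f = Dom E g" "g \<cdot> f = Zero E (Dom E f) (Cod E g)"
    using assms(2) by (auto simp: loc_exact_def)
  obtain r where r: "r \<in> Arr E" "Dom E r = Dom E f" "Cod E r = Dom E i" "i \<cdot> r = f"
    using kernel_factor[OF ig f] .
  \<comment> \<open>The kernel \<open>i\<close> is the universal element killed by \<open>g\<close>;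
    lifting it through \<open>f\<close> over a cover \<open>q\<close> gives
    \<open>r \<cdot> s = q\<close>.\<close>
  obtain q s where q: "deflation E q" "q \<in> Arr E" "Cod E q = Dom E i"
      "s \<in> Arr E" "Dom E s = Dom E q" "Cod E s = Dom E f" "f \<cdot> s = i \<cdot> q"
    using loc_exactE[OF assms(2) iD(1,3,4)] .
  have "i \<cdot> (r \<cdot> s) = f \<cdot> s"
    by (rule Comp_append[OF r(4)]) (use r(1-3) q(2-6) iD(1,3) in simp_all)
  with q(7) have "i \<cdot> (r \<cdot> s) = i \<cdot> q" by simp
  then have "r \<cdot> s = q"
    by (rule kernel_mono[OF ig, rotated 5]) (use r(1-3) q(2-6) in simp_all)
  then have "deflation E r" using R3_plusD[OF R, of r s] q r by simp
  then show thesis using that[of r i] i(1) ig r by simp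
qed

lemma exact_seqI:
  assumes R: "axiom_R3_plus E" and "fs \<noteq> []" and last: "admissible E (last fs)"
    and ex: "\<And>j. Suc j < length fs \<Longrightarrow> loc_exact (fs ! j) (fs ! Suc j)"
  shows "exact_seq E fs"
proof -
  have adm: "admissible E (fs ! j)" if "j < length fs" for j
    using that
  \<comment> \<open>Admissibility spreads from the last arrow to the left; the case of length 0
    contradicts \<open>j < length fs\<close>.\<close>
  proof (induction "length fs - j" arbitrary: j)
    case (Suc n)
    show ?case
    proof (cases "Suc j < length fs")
      case True
      then have "admissible E (fs ! Suc j)" using Suc by simp
      then obtain r i where "deflation E r" "inflation E i" "Cod E r = Dom E i" "fs ! j = i \<cdot> r"
        using loc_exact_image[OF R ex[OF True]] by metis
      then show ?thesis using admissible_comp by simp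
    next
      case False
      then have "j = length fs - 1" using Suc by simp
      then show ?thesis using last \<open>fs \<noteq> []\<close> by (simp add: last_conv_nth)
    qed
  qed simp
  show ?thesis
    unfolding exact_seq_def
  proof (intro allI impI)
    fix j assume j: "j < length fs"
    obtain r i where ri: "deflation E r" "inflation E i" "Cod E r = Dom E i" "fs ! j = i \<cdot> r"
      "Suc j < length fs \<longrightarrow> is_kernel E i (fs ! Suc j)"
    proof (cases "Suc j < length fs")
      case True
      then show thesis using loc_exact_image[OF R ex[OF True] adm[OF True]] that by metis
    next
      case False
      then show thesis using adm[OF j] that by (auto simp: admissible_def)
    qed
    \<comment> \<open>The preceding image \<open>i'\<close> is a kernel of \<open>fs ! j\<close>,
      hence of its deflation part \<open>r\<close>; so \<open>r\<close> is a cokernel of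
      \<open>i'\<close>, and precomposing \<open>i'\<close> with the epic \<open>r'\<close> does not
      change this.\<close>
    have "is_cokernel E r (fs ! (j - 1))" if "0 < j"
    proof -
      from that j have j': "Suc (j - 1) < length fs" "Suc (j - 1) = j" by auto
      obtain r' i' where ri': "deflation E r'" "inflation E i'" "Cod E r' = Dom E i'"
        "fs ! (j - 1) = i' \<cdot> r'" "is_kernel E i' (fs ! j)"
        using loc_exact_image[OF R ex[OF j'(1)] adm[OF j'(1)]] j'(2) by metis
      have "is_kernel E i' r"
        using ri'(5) kernel_monic_comp[OF inflation_monic[OF ri(2)], of r] ri deflation_arr by simp
      then have "is_cokernel E r i'" using inflation_cokernel_pairI ri(1) by blast
      then show ?thesis
        using cokernel_comp_epic[OF deflation_epic[OF ri'(1)], of i'] ri' inflation_arr by simp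
    qed
    then show "\<exists>\<rho> \<iota>. deflation E \<rho> \<and> inflation E \<iota> \<and> Cod E \<rho> = Dom E \<iota> \<and> fs ! j = \<iota> \<cdot> \<rho> \<and>
        (Suc j < length fs \<longrightarrow> is_kernel E \<iota> (fs ! Suc j)) \<and> (0 < j \<longrightarrow> is_cokernel E \<rho> (fs ! (j - 1)))"
      using ri by blast
  qed
qed

section \<open>The snake lemma\<close>

text \<open>The usual recipe for the connecting map, on generalised elements: lift \<open>x\<close> to \<open>a\<close>, push \<open>a\<close>
  down to \<open>f2 a\<close> and take the class of its preimage \<open>b\<close>.\<close>

definition connecting :: "'m \<Rightarrow> 'm \<Rightarrow> 'm \<Rightarrow> 'm \<Rightarrow> 'm \<Rightarrow> 'm \<Rightarrow> bool" where
  "connecting \<phi>2 \<psi>1 f2 k3 c1 d \<longleftrightarrow> d \<in> Hom E (Dom E k3) (Cod E c1) \<and>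
     (\<forall>x a b. x \<in> Arr E \<longrightarrow> a \<in> Arr E \<longrightarrow> b \<in> Arr E \<longrightarrow> Dom E a = Dom E x \<longrightarrow> Dom E b = Dom E x \<longrightarrow>
        Cod E x = Dom E k3 \<longrightarrow> Cod E a = Dom E \<phi>2 \<longrightarrow> Cod E b = Dom E \<psi>1 \<longrightarrow>
        \<phi>2 \<cdot> a = k3 \<cdot> x \<longrightarrow> f2 \<cdot> a = \<psi>1 \<cdot> b \<longrightarrow> d \<cdot> x = c1 \<cdot> b)"

end

text \<open>The assumptions are what the long snake diagram and the diagram behind the
  ker-coker-sequence have in common: a locally exact top row ending in a deflation, and a bottom row
  starting with a genuine kernel.\<close>

locale snake_chase = deflation_exact_split E
  for E :: "('o, 'm, 'z) conflation_structure_scheme" (structure) +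
  fixes A1 A2 A3 B1 B2 B3 K1 K2 K3 C1 C2 C3 :: 'o
    and \<phi>1 \<phi>2 \<psi>1 \<psi>2 f1 f2 f3 k1 k2 k3 c1 c2 c3 :: 'm
  assumes hom: "\<phi>1 \<in> Hom E A1 A2" "\<phi>2 \<in> Hom E A2 A3" "\<psi>1 \<in> Hom E B1 B2" "\<psi>2 \<in> Hom E B2 B3"
      "f1 \<in> Hom E A1 B1" "f2 \<in> Hom E A2 B2" "f3 \<in> Hom E A3 B3"
      "k1 \<in> Hom E K1 A1" "k2 \<in> Hom E K2 A2" "k3 \<in> Hom E K3 A3"
      "c1 \<in> Hom E B1 C1" "c2 \<in> Hom E B2 C2" "c3 \<in> Hom E B3 C3"
    and commute: "f2 \<cdot> \<phi>1 = \<psi>1 \<cdot> f1" "f3 \<cdot> \<phi>2 = \<psi>2 \<cdot> f2"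
    and adm: "admissible E f1" "admissible E f2" "admissible E f3"
    and ker: "is_kernel E k1 f1" "is_kernel E k2 f2" "is_kernel E k3 f3"
    and cok: "is_cokernel E c1 f1" "is_cokernel E c2 f2" "is_cokernel E c3 f3"
    and \<phi>2: "deflation E \<phi>2"
    and row1: "loc_exact \<phi>1 \<phi>2"
    and row2: "is_kernel E \<psi>1 \<psi>2"
begin

lemma arr [simp]:
  "\<phi>1 \<in> Arr E" "\<phi>2 \<in> Arr E" "\<psi>1 \<in> Arr E" "\<psi>2 \<in> Arr E" "f1 \<in> Arr E" "f2 \<in> Arr E" "f3 \<in> Arr E"
  "k1 \<in> Arr E" "k2 \<in> Arr E" "k3 \<in> Arr E" "c1 \<in> Arr E" "c2 \<in> Arr E" "c3 \<in> Arr E"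
  "Dom E \<phi>1 = A1" "Dom E \<phi>2 = A2" "Dom E \<psi>1 = B1" "Dom E \<psi>2 = B2" "Dom E f1 = A1" "Dom E f2 = A2"
  "Dom E f3 = A3" "Dom E k1 = K1" "Dom E k2 = K2" "Dom E k3 = K3" "Dom E c1 = B1" "Dom E c2 = B2" "Dom E c3 = B3"
  "Cod E \<phi>1 = A2" "Cod E \<phi>2 = A3" "Cod E \<psi>1 = B2" "Cod E \<psi>2 = B3" "Cod E f1 = B1" "Cod E f2 = B2"
  "Cod E f3 = B3" "Cod E k1 = A1" "Cod E k2 = A2" "Cod E k3 = A3" "Cod E c1 = C1" "Cod E c2 = C2" "Cod E c3 = C3"
  using hom by simp_all

lemma obj [simp]:
  "A1 \<in> Obj E" "A2 \<in> Obj E" "A3 \<in> Obj E" "B1 \<in> Obj E" "B2 \<in> Obj E" "B3 \<in> Obj E"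
  "K1 \<in> Obj E" "K2 \<in> Obj E" "K3 \<in> Obj E" "C1 \<in> Obj E" "C2 \<in> Obj E" "C3 \<in> Obj E"
  using Dom_Obj[of \<phi>1] Dom_Obj[of \<phi>2] Cod_Obj[of \<phi>2] Dom_Obj[of \<psi>1] Dom_Obj[of \<psi>2] Cod_Obj[of \<psi>2]
    Dom_Obj[of k1] Dom_Obj[of k2] Dom_Obj[of k3] Cod_Obj[of c1] Cod_Obj[of c2] Cod_Obj[of c3] by simp_all

lemma zero_comps:
  "\<phi>2 \<cdot> \<phi>1 = Zero E A1 A3" "\<psi>2 \<cdot> \<psi>1 = Zero E B1 B3"
  "f1 \<cdot> k1 = Zero E K1 B1" "f2 \<cdot> k2 = Zero E K2 B2" "f3 \<cdot> k3 = Zero E K3 B3"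
  "c1 \<cdot> f1 = Zero E A1 C1" "c2 \<cdot> f2 = Zero E A2 C2" "c3 \<cdot> f3 = Zero E A3 C3"
  using row1 kernelD(4)[OF row2] kernelD(4)[OF ker(1)] kernelD(4)[OF ker(2)] kernelD(4)[OF ker(3)]
    cokernelD(4)[OF cok(1)] cokernelD(4)[OF cok(2)] cokernelD(4)[OF cok(3)]
  by (simp_all add: loc_exact_def)

lemma square_comps [simp]:
  assumes "x \<in> Arr E"
  shows "Cod E x = A1 \<Longrightarrow> f2 \<cdot> (\<phi>1 \<cdot> x) = \<psi>1 \<cdot> (f1 \<cdot> x)" "Cod E x = A2 \<Longrightarrow> f3 \<cdot> (\<phi>2 \<cdot> x) = \<psi>2 \<cdot> (f2 \<cdot> x)"
    "Cod E x = A1 \<Longrightarrow> \<phi>2 \<cdot> (\<phi>1 \<cdot> x) = Zero E (Dom E x) A3" "Cod E x = B1 \<Longrightarrow> \<psi>2 \<cdot> (\<psi>1 \<cdot> x) = Zero E (Dom E x) B3"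
    "Cod E x = K1 \<Longrightarrow> f1 \<cdot> (k1 \<cdot> x) = Zero E (Dom E x) B1" "Cod E x = K2 \<Longrightarrow> f2 \<cdot> (k2 \<cdot> x) = Zero E (Dom E x) B2"
    "Cod E x = K3 \<Longrightarrow> f3 \<cdot> (k3 \<cdot> x) = Zero E (Dom E x) B3"
    "Cod E x = A1 \<Longrightarrow> c1 \<cdot> (f1 \<cdot> x) = Zero E (Dom E x) C1" "Cod E x = A2 \<Longrightarrow> c2 \<cdot> (f2 \<cdot> x) = Zero E (Dom E x) C2"
    "Cod E x = A3 \<Longrightarrow> c3 \<cdot> (f3 \<cdot> x) = Zero E (Dom E x) C3"
  using assms by (simp_all add: zero_comps[THEN Comp_append] commute[THEN Comp_append])

text \<open>Only the lift along \<open>\<phi>2\<close> costs a cover; the preimage \<open>b\<close>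
  exists on the same cover, because \<open>\<psi>1\<close> is a kernel of
  \<open>\<psi>2\<close>.\<close>

lemma connecting_lift:
  assumes "x \<in> Arr E" "Cod E x = K3"
  obtains q a b where "deflation E q" "q \<in> Arr E" "Cod E q = Dom E x" "a \<in> Arr E" "b \<in> Arr E"
    "Dom E a = Dom E q" "Dom E b = Dom E q" "Cod E a = A2" "Cod E b = B1"
    "\<phi>2 \<cdot> a = k3 \<cdot> (x \<cdot> q)" "f2 \<cdot> a = \<psi>1 \<cdot> b"
proof -
  obtain q a where q: "deflation E q" "q \<in> Arr E" "Cod E q = Dom E x" "a \<in> Arr E" "Dom E a = Dom E q"
    "Cod E a = A2" "\<phi>2 \<cdot> a = k3 \<cdot> (x \<cdot> q)"
    using deflation_lift[OF \<phi>2, of "k3 \<cdot> x"] assms by auto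
  have "\<psi>2 \<cdot> (f2 \<cdot> a) = f3 \<cdot> (\<phi>2 \<cdot> a)" using q(1-6) by simp
  also have "\<dots> = Zero E (Dom E a) B3" unfolding q(7) using q(1-6) assms by simp
  finally have "\<psi>2 \<cdot> (f2 \<cdot> a) = Zero E (Dom E a) B3" .
  then obtain b where "b \<in> Arr E" "Dom E b = Dom E a" "Cod E b = B1" "\<psi>1 \<cdot> b = f2 \<cdot> a"
    using kernel_factor[OF row2, of "f2 \<cdot> a"] q(4-6) by auto
  then show thesis using that[of q a b] q by simp
qed

text \<open>Carry out the recipe for the universal lift, which lives on the pullback of
  \<open>\<phi>2\<close> along \<open>k3\<close>, and descend the resulting
  \<open>c1 \<cdot> \<beta>\<close> along the deflation \<open>\<pi>\<close>. Descent is possible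
  because \<open>\<pi>\<close> is the cokernel of its kernel \<open>n\<close> and
  \<open>c1 \<cdot> \<beta>\<close> vanishes on \<open>n\<close>.\<close>

lemma connecting_exists: "\<exists>d. connecting \<phi>2 \<psi>1 f2 k3 c1 d"
proof -
  obtain \<sigma> \<pi> where pb: "is_pullback E \<sigma> \<pi> \<phi>2 k3" using R2_exists[OF \<phi>2, of k3] by auto
  define P where "P = Dom E \<pi>"
  have p: "\<sigma> \<in> Arr E" "\<pi> \<in> Arr E" "Dom E \<sigma> = P" "Dom E \<pi> = P" "Cod E \<sigma> = A2" "Cod E \<pi> = K3" "\<phi>2 \<cdot> \<sigma> = k3 \<cdot> \<pi>"
    using pullbackD[OF pb] by (auto simp: P_def)
  have P: "P \<in> Obj E" using p by auto
  have "\<psi>2 \<cdot> (f2 \<cdot> \<sigma>) = f3 \<cdot> (\<phi>2 \<cdot> \<sigma>)" using p(1-6) by simp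
  also have "\<dots> = Zero E P B3" unfolding p(7) using p(1-6) by simp
  finally have "\<psi>2 \<cdot> (f2 \<cdot> \<sigma>) = Zero E P B3" .
  then obtain \<beta> where \<beta>: "\<beta> \<in> Arr E" "Dom E \<beta> = P" "Cod E \<beta> = B1" "\<psi>1 \<cdot> \<beta> = f2 \<cdot> \<sigma>"
    using kernel_factor[OF row2, of "f2 \<cdot> \<sigma>"] p(1-6) by auto
  have \<pi>: "deflation E \<pi>" using R2_stable[OF \<phi>2 pb] .
  obtain n where n: "is_kernel E n \<pi>" "is_cokernel E \<pi> n" using deflation_kernel[OF \<pi>] by blast
  have nD: "n \<in> Arr E" "Cod E n = P" "\<pi> \<cdot> n = Zero E (Dom E n) K3" using kernelD[OF n(1)] p by auto
  have "\<phi>2 \<cdot> (\<sigma> \<cdot> n) = k3 \<cdot> (\<pi> \<cdot> n)" using Comp_append[OF p(7), of n] p(1-6) nD(1,2) by simp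
  then have "\<phi>2 \<cdot> (\<sigma> \<cdot> n) = Zero E (Dom E n) A3" using nD by simp
  \<comment> \<open>On \<open>n\<close> the lift \<open>\<sigma>\<close> comes locally from A1, so
    \<open>\<beta>\<close> comes locally from \<open>f1\<close> and is killed by
    \<open>c1\<close>.\<close>
  then obtain q s where q: "deflation E q" "q \<in> Arr E" "Cod E q = Dom E n" "s \<in> Arr E" "Dom E s = Dom E q"
    "Cod E s = A1" "\<phi>1 \<cdot> s = \<sigma> \<cdot> (n \<cdot> q)"
    using loc_exactE[OF row1, of "\<sigma> \<cdot> n"] p(1-6) nD by auto
  have "\<psi>1 \<cdot> (\<beta> \<cdot> (n \<cdot> q)) = f2 \<cdot> (\<phi>1 \<cdot> s)"
    unfolding q(7) using Comp_append[OF \<beta>(4), of "n \<cdot> q"] \<beta>(1-3) p(1-6) nD q(1-6) by simp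
  then have "\<psi>1 \<cdot> (\<beta> \<cdot> (n \<cdot> q)) = \<psi>1 \<cdot> (f1 \<cdot> s)" using q(1-6) by simp
  then have bs: "\<beta> \<cdot> (n \<cdot> q) = f1 \<cdot> s"
    by (rule kernel_mono[OF row2, rotated 5]) (use \<beta>(1-3) nD(1,2) q(1-6) in simp_all)
  have "(c1 \<cdot> (\<beta> \<cdot> n)) \<cdot> q = c1 \<cdot> (\<beta> \<cdot> (n \<cdot> q))" using \<beta>(1-3) nD q(1-6) by simp
  also have "\<dots> = Zero E (Dom E n) C1 \<cdot> q" unfolding bs using q(1-6) nD by simp
  finally have "c1 \<cdot> (\<beta> \<cdot> n) = Zero E (Dom E n) C1"
    by (rule epicD[OF deflation_epic[OF q(1)]]) (use \<beta>(1-3) nD q(1-6) in simp_all)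
  then obtain d where d: "d \<in> Arr E" "Dom E d = K3" "Cod E d = C1" "d \<cdot> \<pi> = c1 \<cdot> \<beta>"
    using cokernel_factor[OF n(2), of "c1 \<cdot> \<beta>"] \<beta>(1-3) nD p(1-6) by auto
  have "connecting \<phi>2 \<psi>1 f2 k3 c1 d"
    unfolding connecting_def
  proof (intro conjI allI impI)
    fix x a b
    assume x: "x \<in> Arr E" "a \<in> Arr E" "b \<in> Arr E" "Dom E a = Dom E x" "Dom E b = Dom E x"
      "Cod E x = Dom E k3" "Cod E a = Dom E \<phi>2" "Cod E b = Dom E \<psi>1" "\<phi>2 \<cdot> a = k3 \<cdot> x" "f2 \<cdot> a = \<psi>1 \<cdot> b"
    \<comment> \<open>Any other lift factors through the universal one, and \<open>b\<close> is then
      determined since \<open>\<psi>1\<close> is monic.\<close>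
    obtain u where u: "u \<in> Arr E" "Dom E u = Dom E x" "Cod E u = P" "\<sigma> \<cdot> u = a" "\<pi> \<cdot> u = x"
      using pullback_factor[OF pb x(2,1,4,7,6,9)] by (auto simp: P_def)
    have "\<psi>1 \<cdot> (\<beta> \<cdot> u) = f2 \<cdot> (\<sigma> \<cdot> u)"
      using Comp_append[OF \<beta>(4), of u] \<beta>(1-3) p(1-6) u(1-3) by simp
    then have "\<psi>1 \<cdot> (\<beta> \<cdot> u) = \<psi>1 \<cdot> b" unfolding u(4) x(10) .
    then have "\<beta> \<cdot> u = b"
      by (rule kernel_mono[OF row2, rotated 5]) (use \<beta>(1-3) u(1-3) x in simp_all)
    moreover have "d \<cdot> (\<pi> \<cdot> u) = c1 \<cdot> (\<beta> \<cdot> u)"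
      using Comp_append[OF d(4), of u] d(1-3) \<beta>(1-3) p(1-6) u(1-3) by simp
    ultimately show "d \<cdot> x = c1 \<cdot> b" unfolding u(5) by simp
  qed (use d in simp_all)
  then show ?thesis ..
qed

end

section \<open>Local exactness at the kernels and cokernels\<close>

locale snake_maps = snake_chase E A1 A2 A3 B1 B2 B3 K1 K2 K3 C1 C2 C3 \<phi>1 \<phi>2 \<psi>1 \<psi>2 f1 f2 f3 k1 k2 k3 c1 c2 c3
  for E :: "('o, 'm, 'z) conflation_structure_scheme" (structure)
    and A1 A2 A3 B1 B2 B3 K1 K2 K3 C1 C2 C3 \<phi>1 \<phi>2 \<psi>1 \<psi>2 f1 f2 f3 k1 k2 k3 c1 c2 c3 +
  fixes \<kappa>1 \<kappa>2 d \<gamma>1 \<gamma>2 :: 'm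
  assumes maps: "\<kappa>1 \<in> Hom E K1 K2" "\<kappa>2 \<in> Hom E K2 K3" "\<gamma>1 \<in> Hom E C1 C2" "\<gamma>2 \<in> Hom E C2 C3"
    and induced: "k2 \<cdot> \<kappa>1 = \<phi>1 \<cdot> k1" "k3 \<cdot> \<kappa>2 = \<phi>2 \<cdot> k2" "\<gamma>1 \<cdot> c1 = c2 \<cdot> \<psi>1" "\<gamma>2 \<cdot> c2 = c3 \<cdot> \<psi>2"
    and conn: "connecting \<phi>2 \<psi>1 f2 k3 c1 d"
begin

lemma maps_arr [simp]:
  "\<kappa>1 \<in> Arr E" "\<kappa>2 \<in> Arr E" "\<gamma>1 \<in> Arr E" "\<gamma>2 \<in> Arr E" "d \<in> Arr E"
  "Dom E \<kappa>1 = K1" "Dom E \<kappa>2 = K2" "Dom E \<gamma>1 = C1" "Dom E \<gamma>2 = C2" "Dom E d = K3"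
  "Cod E \<kappa>1 = K2" "Cod E \<kappa>2 = K3" "Cod E \<gamma>1 = C2" "Cod E \<gamma>2 = C3" "Cod E d = C1"
  using maps conn by (simp_all add: connecting_def)

lemma induced_comps [simp]:
  assumes "x \<in> Arr E"
  shows "Cod E x = K1 \<Longrightarrow> k2 \<cdot> (\<kappa>1 \<cdot> x) = \<phi>1 \<cdot> (k1 \<cdot> x)" "Cod E x = K2 \<Longrightarrow> k3 \<cdot> (\<kappa>2 \<cdot> x) = \<phi>2 \<cdot> (k2 \<cdot> x)"
    "Cod E x = B1 \<Longrightarrow> \<gamma>1 \<cdot> (c1 \<cdot> x) = c2 \<cdot> (\<psi>1 \<cdot> x)" "Cod E x = B2 \<Longrightarrow> \<gamma>2 \<cdot> (c2 \<cdot> x) = c3 \<cdot> (\<psi>2 \<cdot> x)"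
  using assms by (simp_all add: induced[THEN Comp_append])

lemma connD:
  "\<lbrakk>x \<in> Arr E; a \<in> Arr E; b \<in> Arr E; Dom E a = Dom E x; Dom E b = Dom E x; Cod E x = K3; Cod E a = A2;
    Cod E b = B1; \<phi>2 \<cdot> a = k3 \<cdot> x; f2 \<cdot> a = \<psi>1 \<cdot> b\<rbrakk> \<Longrightarrow> d \<cdot> x = c1 \<cdot> b"
  using conn by (simp add: connecting_def)

lemmas c1_facts = admissible_cokernel[OF adm(1) cok(1)]
lemmas c2_facts = admissible_cokernel[OF adm(2) cok(2)]
lemmas c3_facts = admissible_cokernel[OF adm(3) cok(3)]

lemma exact_K1:
  assumes k: "is_kernel E k \<phi>1" and \<kappa>0: "\<kappa>0 \<in> Hom E (Dom E k) K1" "k1 \<cdot> \<kappa>0 = k"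
  shows "loc_exact \<kappa>0 \<kappa>1"
proof (rule loc_exactI)
  have kD: "k \<in> Arr E" "Cod E k = A1" "\<phi>1 \<cdot> k = Zero E (Dom E k) A2" using kernelD[OF k] by auto
  have [simp]: "\<kappa>0 \<in> Arr E" "Dom E \<kappa>0 = Dom E k" "Cod E \<kappa>0 = K1" using \<kappa>0 by auto
  have "k2 \<cdot> (\<kappa>1 \<cdot> \<kappa>0) = k2 \<cdot> Zero E (Dom E k) K2" using kD by (simp add: \<kappa>0(2))
  then have "\<kappa>1 \<cdot> \<kappa>0 = Zero E (Dom E k) K2"
    by (rule kernel_mono[OF ker(2), rotated 5]) (use kD in simp_all)
  then show "\<kappa>1 \<cdot> \<kappa>0 = Zero E (Dom E \<kappa>0) (Cod E \<kappa>1)" by simp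
  fix t assume t: "t \<in> Arr E" "Cod E t = Dom E \<kappa>1" "\<kappa>1 \<cdot> t = Zero E (Dom E t) (Cod E \<kappa>1)"
  have "\<phi>1 \<cdot> (k1 \<cdot> t) = k2 \<cdot> (\<kappa>1 \<cdot> t)" using t(1,2) by simp
  also have "\<dots> = Zero E (Dom E t) A2" unfolding t(3) using t(1,2) by simp
  finally obtain u where u: "u \<in> Arr E" "Dom E u = Dom E t" "Cod E u = Dom E k" "k \<cdot> u = k1 \<cdot> t"
    using kernel_factor[OF k, of "k1 \<cdot> t"] t(1,2) by auto
  have "k1 \<cdot> (\<kappa>0 \<cdot> u) = k1 \<cdot> t" using Comp_append[OF \<kappa>0(2), of u] u by simp
  then have "\<kappa>0 \<cdot> u = t"
    by (rule kernel_mono[OF ker(1), rotated 5]) (use u(1-3) t(1,2) in simp_all)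
  then show "\<exists>q s. deflation E q \<and> Cod E q = Dom E t \<and> s \<in> Hom E (Dom E q) (Dom E \<kappa>0) \<and> \<kappa>0 \<cdot> s = t \<cdot> q"
    using u(1-3) t(1,2) by (intro exI[of _ "Ident E (Dom E t)"] exI[of _ u]) simp
qed (use \<kappa>0 in simp_all)

text \<open>If \<kappa>2 kills \<open>t\<close>, then \<open>k2 \<cdot> t\<close> is locally some
  \<open>\<phi>1 \<cdot> s\<close>. The monic \<open>\<psi>1\<close> forces
  \<open>f1 \<cdot> s\<close> to vanish, so \<open>s\<close> comes from K1.\<close>

lemma exact_K2: "loc_exact \<kappa>1 \<kappa>2"
proof (rule loc_exactI)
  have "k3 \<cdot> (\<kappa>2 \<cdot> \<kappa>1) = k3 \<cdot> Zero E K1 K3" by (simp add: induced)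
  then have "\<kappa>2 \<cdot> \<kappa>1 = Zero E K1 K3"
    by (rule kernel_mono[OF ker(3), rotated 5]) simp_all
  then show "\<kappa>2 \<cdot> \<kappa>1 = Zero E (Dom E \<kappa>1) (Cod E \<kappa>2)" by simp
  fix t assume t: "t \<in> Arr E" "Cod E t = Dom E \<kappa>2" "\<kappa>2 \<cdot> t = Zero E (Dom E t) (Cod E \<kappa>2)"
  have "\<phi>2 \<cdot> (k2 \<cdot> t) = k3 \<cdot> (\<kappa>2 \<cdot> t)" using t(1,2) by simp
  also have "\<dots> = Zero E (Dom E t) A3" unfolding t(3) using t(1,2) by simp
  finally obtain q s where q: "deflation E q" "q \<in> Arr E" "Cod E q = Dom E t" "s \<in> Arr E" "Dom E s = Dom E q"
    "Cod E s = A1" "\<phi>1 \<cdot> s = k2 \<cdot> (t \<cdot> q)"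
    using loc_exactE[OF row1, of "k2 \<cdot> t"] t(1,2) by auto
  have "\<psi>1 \<cdot> (f1 \<cdot> s) = f2 \<cdot> (\<phi>1 \<cdot> s)" using q(1-6) by simp
  also have "\<dots> = \<psi>1 \<cdot> Zero E (Dom E s) B1" unfolding q(7) using q(1-6) t(1,2) by simp
  finally have "f1 \<cdot> s = Zero E (Dom E s) B1"
    by (rule kernel_mono[OF row2, rotated 5]) (use q(1-6) in simp_all)
  then obtain u where u: "u \<in> Arr E" "Dom E u = Dom E q" "Cod E u = K1" "k1 \<cdot> u = s"
    using kernel_factor[OF ker(1), of s] q(1-6) by auto
  have "k2 \<cdot> (\<kappa>1 \<cdot> u) = k2 \<cdot> (t \<cdot> q)" using u q(7) by simp
  then have "\<kappa>1 \<cdot> u = t \<cdot> q"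
    by (rule kernel_mono[OF ker(2), rotated 5]) (use u(1-3) t(1,2) q(1-6) in simp_all)
  then show "\<exists>q s. deflation E q \<and> Cod E q = Dom E t \<and> s \<in> Hom E (Dom E q) (Dom E \<kappa>1) \<and> \<kappa>1 \<cdot> s = t \<cdot> q"
    using u(1-3) q(1-6) by (intro exI[of _ q] exI[of _ u]) simp
qed simp_all

text \<open>If \<open>d\<close> kills \<open>t\<close>, the preimage \<open>b\<close> of a lift
  \<open>a\<close> is locally \<open>f1 \<cdot> s\<close>. Correcting \<open>a\<close> by
  \<open>\<phi>1 \<cdot> s\<close> puts it into the kernel of \<open>f2\<close> without changing its
  image under \<open>\<phi>2\<close>.\<close>

lemma exact_K3: "loc_exact \<kappa>2 d"
proof (rule loc_exactI)
  \<comment> \<open>For elements coming from K2 one may take the lift \<open>k2\<close> with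
    preimage \<open>b\<close> = 0.\<close>
  have "d \<cdot> \<kappa>2 = c1 \<cdot> Zero E K2 B1"
    by (rule connD[of \<kappa>2 k2]) (simp_all add: induced zero_comps)
  then show "d \<cdot> \<kappa>2 = Zero E (Dom E \<kappa>2) (Cod E d)" by simp
  fix t assume t: "t \<in> Arr E" "Cod E t = Dom E d" "d \<cdot> t = Zero E (Dom E t) (Cod E d)"
  obtain q a b where q: "deflation E q" "q \<in> Arr E" "Cod E q = Dom E t" "a \<in> Arr E" "b \<in> Arr E"
    "Dom E a = Dom E q" "Dom E b = Dom E q" "Cod E a = A2" "Cod E b = B1"
    "\<phi>2 \<cdot> a = k3 \<cdot> (t \<cdot> q)" "f2 \<cdot> a = \<psi>1 \<cdot> b"
    using connecting_lift[of t] t(1,2) by auto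
  have "c1 \<cdot> b = d \<cdot> (t \<cdot> q)" using connD[of "t \<cdot> q" a b] q t(1,2) by simp
  also have "\<dots> = Zero E (Dom E q) C1" using Comp_append[OF t(3), of q] q(1-3) t(1,2) by simp
  finally obtain r s where r: "deflation E r" "r \<in> Arr E" "Cod E r = Dom E q" "s \<in> Arr E" "Dom E s = Dom E r"
    "Cod E s = A1" "f1 \<cdot> s = b \<cdot> r"
    using loc_exactE[OF c1_facts(2), of b] q(5,7,9) by auto
  have "f2 \<cdot> (a \<cdot> r) = \<psi>1 \<cdot> (b \<cdot> r)" using Comp_append[OF q(11), of r] q(1-9) r(1-3) by simp
  also have "\<dots> = f2 \<cdot> (\<phi>1 \<cdot> s)" using r by simp
  finally obtain u where u: "u \<in> Arr E" "Dom E u = Dom E r" "Cod E u = K2" "a \<cdot> r = Plus E (\<phi>1 \<cdot> s) (k2 \<cdot> u)"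
    using kernel_difference[OF ker(2), of "a \<cdot> r" "\<phi>1 \<cdot> s"] q(1-9) r(1-6) by auto
  have "k3 \<cdot> (\<kappa>2 \<cdot> u) = \<phi>2 \<cdot> (a \<cdot> r)" unfolding u(4) using u(1-3) r(1-6) by simp
  also have "\<dots> = k3 \<cdot> (t \<cdot> (q \<cdot> r))" using Comp_append[OF q(10), of r] q(1-9) r(1-3) t(1,2) by simp
  finally have "\<kappa>2 \<cdot> u = t \<cdot> (q \<cdot> r)"
    by (rule kernel_mono[OF ker(3), rotated 5]) (use u(1-3) t(1,2) q(1-3) r(1-3) in simp_all)
  moreover have "deflation E (q \<cdot> r)" using R1[OF r(1) q(1) r(3)] .
  ultimately show "\<exists>q s. deflation E q \<and> Cod E q = Dom E t \<and> s \<in> Hom E (Dom E q) (Dom E \<kappa>2) \<and> \<kappa>2 \<cdot> s = t \<cdot> q"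
    using u(1-3) q(1-3) r(1-3) by (intro exI[of _ "q \<cdot> r"] exI[of _ u]) simp
qed simp_all

text \<open>Lift \<open>t\<close> to \<open>b\<close> in B1. If \<gamma>1 kills \<open>t\<close>,
  then \<open>\<psi>1 \<cdot> b\<close> is locally \<open>f2 \<cdot> a\<close>; so
  \<open>\<phi>2 \<cdot> a\<close> lies in K3, and \<open>a\<close>, \<open>b\<close> are admissible
  data for computing \<open>d\<close> on it.\<close>

lemma exact_C1: "loc_exact d \<gamma>1"
proof (rule loc_exactI)
  \<comment> \<open>The vanishing of \<open>\<gamma>1 \<cdot> d\<close> is tested on the identity of
    K3 after a cover, which is epic.\<close>
  obtain q a b where q: "deflation E q" "q \<in> Arr E" "Cod E q = K3" "a \<in> Arr E" "b \<in> Arr E"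
    "Dom E a = Dom E q" "Dom E b = Dom E q" "Cod E a = A2" "Cod E b = B1"
    "\<phi>2 \<cdot> a = k3 \<cdot> q" "f2 \<cdot> a = \<psi>1 \<cdot> b"
    using connecting_lift[of "Ident E K3"] by auto
  have "d \<cdot> q = c1 \<cdot> b" by (rule connD[of q a b]) (use q in simp_all)
  then have "(\<gamma>1 \<cdot> d) \<cdot> q = c2 \<cdot> (\<psi>1 \<cdot> b)" using q(1-9) by simp
  also have "\<dots> = Zero E K3 C2 \<cdot> q" unfolding q(11)[symmetric] using q(1-9) by simp
  finally have "\<gamma>1 \<cdot> d = Zero E K3 C2"
    by (rule epicD[OF deflation_epic[OF q(1)]]) (use q(1-3) in simp_all)
  then show "\<gamma>1 \<cdot> d = Zero E (Dom E d) (Cod E \<gamma>1)" by simp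
  fix t assume t: "t \<in> Arr E" "Cod E t = Dom E \<gamma>1" "\<gamma>1 \<cdot> t = Zero E (Dom E t) (Cod E \<gamma>1)"
  obtain q b where q: "deflation E q" "q \<in> Arr E" "Cod E q = Dom E t" "b \<in> Arr E" "Dom E b = Dom E q"
    "Cod E b = B1" "c1 \<cdot> b = t \<cdot> q"
    using deflation_lift[OF c1_facts(1), of t] t(1,2) by auto
  have "c2 \<cdot> (\<psi>1 \<cdot> b) = \<gamma>1 \<cdot> (c1 \<cdot> b)" using q(1-6) by simp
  also have "\<dots> = Zero E (Dom E b) C2"
    unfolding q(7) using Comp_append[OF t(3), of q] q(1-6) t(1,2) by simp
  finally obtain r a where r: "deflation E r" "r \<in> Arr E" "Cod E r = Dom E q" "a \<in> Arr E" "Dom E a = Dom E r"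
    "Cod E a = A2" "f2 \<cdot> a = \<psi>1 \<cdot> (b \<cdot> r)"
    using loc_exactE[OF c2_facts(2), of "\<psi>1 \<cdot> b"] q(1-6) by auto
  have "f3 \<cdot> (\<phi>2 \<cdot> a) = \<psi>2 \<cdot> (f2 \<cdot> a)" using r(1-6) by simp
  also have "\<dots> = Zero E (Dom E a) B3" unfolding r(7) using q(1-6) r(1-6) by simp
  finally obtain x where x: "x \<in> Arr E" "Dom E x = Dom E r" "Cod E x = K3" "k3 \<cdot> x = \<phi>2 \<cdot> a"
    using kernel_factor[OF ker(3), of "\<phi>2 \<cdot> a"] r(1-6) by auto
  have "d \<cdot> x = c1 \<cdot> (b \<cdot> r)"
    by (rule connD[of x a]) (use x r q(1-6) in simp_all)
  also have "\<dots> = t \<cdot> (q \<cdot> r)" using Comp_append[OF q(7), of r] q(1-6) r(1-3) t(1,2) by simp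
  finally have "d \<cdot> x = t \<cdot> (q \<cdot> r)" .
  moreover have "deflation E (q \<cdot> r)" using R1[OF r(1) q(1) r(3)] .
  ultimately show "\<exists>q s. deflation E q \<and> Cod E q = Dom E t \<and> s \<in> Hom E (Dom E q) (Dom E d) \<and> d \<cdot> s = t \<cdot> q"
    using x(1-3) q(1-3) r(1-3) by (intro exI[of _ "q \<cdot> r"] exI[of _ x]) simp
qed simp_all

text \<open>Three covers are needed: lift \<open>t\<close> to \<open>b\<close> in B2, write
  \<open>\<psi>2 \<cdot> b\<close> as \<open>f3 \<cdot> a3\<close>, lift \<open>a3\<close> to
  \<open>a\<close> in A2. Then b - f2 a comes from B1, and \<open>f2 \<cdot> a\<close> is invisible
  in C2.\<close>

lemma exact_C2: "loc_exact \<gamma>1 \<gamma>2"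
proof (rule loc_exactI)
  have "(\<gamma>2 \<cdot> \<gamma>1) \<cdot> c1 = Zero E C1 C3 \<cdot> c1" by (simp add: induced zero_comps)
  then show "\<gamma>2 \<cdot> \<gamma>1 = Zero E (Dom E \<gamma>1) (Cod E \<gamma>2)"
    using cokernel_epi[OF cok(1), of "\<gamma>2 \<cdot> \<gamma>1" "Zero E C1 C3"] by simp
  fix t assume t: "t \<in> Arr E" "Cod E t = Dom E \<gamma>2" "\<gamma>2 \<cdot> t = Zero E (Dom E t) (Cod E \<gamma>2)"
  obtain q b where q: "deflation E q" "q \<in> Arr E" "Cod E q = Dom E t" "b \<in> Arr E" "Dom E b = Dom E q"
    "Cod E b = B2" "c2 \<cdot> b = t \<cdot> q"
    using deflation_lift[OF c2_facts(1), of t] t(1,2) by auto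
  have "c3 \<cdot> (\<psi>2 \<cdot> b) = \<gamma>2 \<cdot> (c2 \<cdot> b)" using q(1-6) by simp
  also have "\<dots> = Zero E (Dom E b) C3"
    unfolding q(7) using Comp_append[OF t(3), of q] q(1-6) t(1,2) by simp
  finally obtain r a3 where r: "deflation E r" "r \<in> Arr E" "Cod E r = Dom E q" "a3 \<in> Arr E" "Dom E a3 = Dom E r"
    "Cod E a3 = A3" "f3 \<cdot> a3 = \<psi>2 \<cdot> (b \<cdot> r)"
    using loc_exactE[OF c3_facts(2), of "\<psi>2 \<cdot> b"] q(1-6) by auto
  obtain p a where p: "deflation E p" "p \<in> Arr E" "Cod E p = Dom E r" "a \<in> Arr E" "Dom E a = Dom E p"
    "Cod E a = A2" "\<phi>2 \<cdot> a = a3 \<cdot> p"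
    using deflation_lift[OF \<phi>2, of a3] r(4-6) by auto
  have "\<psi>2 \<cdot> (b \<cdot> (r \<cdot> p)) = f3 \<cdot> (a3 \<cdot> p)" using Comp_append[OF r(7), of p] q(1-6) r(1-6) p(1-6) by simp
  also have "\<dots> = \<psi>2 \<cdot> (f2 \<cdot> a)" unfolding p(7)[symmetric] using p(1-6) by simp
  finally obtain b1 where b1: "b1 \<in> Arr E" "Dom E b1 = Dom E p" "Cod E b1 = B1"
    "b \<cdot> (r \<cdot> p) = Plus E (f2 \<cdot> a) (\<psi>1 \<cdot> b1)"
    using kernel_difference[OF row2, of "b \<cdot> (r \<cdot> p)" "f2 \<cdot> a"] q(1-6) r(1-6) p(1-6) by auto
  have "\<gamma>1 \<cdot> (c1 \<cdot> b1) = c2 \<cdot> (b \<cdot> (r \<cdot> p))" unfolding b1(4) using b1(1-3) p(1-6) by simp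
  also have "\<dots> = t \<cdot> (q \<cdot> (r \<cdot> p))"
    using Comp_append[OF q(7), of "r \<cdot> p"] q(1-6) r(1-6) p(1-6) t(1,2) by simp
  finally have "\<gamma>1 \<cdot> (c1 \<cdot> b1) = t \<cdot> (q \<cdot> (r \<cdot> p))" .
  moreover have "deflation E (q \<cdot> (r \<cdot> p))" using R1[OF R1[OF p(1) r(1) p(3)] q(1)] p(1-3) r(1-3) by simp
  ultimately show "\<exists>q s. deflation E q \<and> Cod E q = Dom E t \<and> s \<in> Hom E (Dom E q) (Dom E \<gamma>1) \<and> \<gamma>1 \<cdot> s = t \<cdot> q"
    using b1(1-3) q(1-3) r(1-3) p(1-3) by (intro exI[of _ "q \<cdot> (r \<cdot> p)"] exI[of _ "c1 \<cdot> b1"]) simp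
qed simp_all

text \<open>Local exactness suffices for \<open>c\<close>, so that it may be a cokernel of
  \<open>\<psi>2\<close> in the long sequence and the zero map after a deflation
  \<open>\<psi>2\<close> in the short one.\<close>

lemma exact_C3:
  assumes c: "loc_exact \<psi>2 c" and \<gamma>3: "\<gamma>3 \<in> Hom E C3 (Cod E c)" "\<gamma>3 \<cdot> c3 = c"
  shows "loc_exact \<gamma>2 \<gamma>3"
proof (rule loc_exactI)
  have cD: "c \<in> Arr E" "Dom E c = B3" "c \<cdot> \<psi>2 = Zero E B2 (Cod E c)" using c by (auto simp: loc_exact_def)
  have [simp]: "\<gamma>3 \<in> Arr E" "Dom E \<gamma>3 = C3" "Cod E \<gamma>3 = Cod E c" using \<gamma>3 by auto
  have "(\<gamma>3 \<cdot> \<gamma>2) \<cdot> c2 = (\<gamma>3 \<cdot> c3) \<cdot> \<psi>2" by (simp add: induced)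
  also have "\<dots> = Zero E C2 (Cod E c) \<cdot> c2" unfolding \<gamma>3(2) using cD by simp
  finally show "\<gamma>3 \<cdot> \<gamma>2 = Zero E (Dom E \<gamma>2) (Cod E \<gamma>3)"
    using cokernel_epi[OF cok(2), of "\<gamma>3 \<cdot> \<gamma>2" "Zero E C2 (Cod E c)"] cD by simp
  fix t assume t: "t \<in> Arr E" "Cod E t = Dom E \<gamma>3" "\<gamma>3 \<cdot> t = Zero E (Dom E t) (Cod E \<gamma>3)"
  obtain q b where q: "deflation E q" "q \<in> Arr E" "Cod E q = Dom E t" "b \<in> Arr E" "Dom E b = Dom E q"
    "Cod E b = B3" "c3 \<cdot> b = t \<cdot> q"
    using deflation_lift[OF c3_facts(1), of t] t(1,2) by auto
  have "c \<cdot> b = \<gamma>3 \<cdot> (c3 \<cdot> b)" using Comp_append[OF \<gamma>3(2), of b] q(1-6) by simp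
  also have "\<dots> = Zero E (Dom E b) (Cod E c)"
    unfolding q(7) using Comp_append[OF t(3), of q] q(1-6) t(1,2) cD by simp
  finally obtain r b2 where r: "deflation E r" "r \<in> Arr E" "Cod E r = Dom E q" "b2 \<in> Arr E" "Dom E b2 = Dom E r"
    "Cod E b2 = B2" "\<psi>2 \<cdot> b2 = b \<cdot> r"
    using loc_exactE[OF c, of b] q(1-6) cD by auto
  have "\<gamma>2 \<cdot> (c2 \<cdot> b2) = c3 \<cdot> (b \<cdot> r)" using r by simp
  also have "\<dots> = t \<cdot> (q \<cdot> r)" using Comp_append[OF q(7), of r] q(1-6) r(1-3) t(1,2) by simp
  finally have "\<gamma>2 \<cdot> (c2 \<cdot> b2) = t \<cdot> (q \<cdot> r)" .
  moreover have "deflation E (q \<cdot> r)" using R1[OF r(1) q(1) r(3)] .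
  ultimately show "\<exists>q s. deflation E q \<and> Cod E q = Dom E t \<and> s \<in> Hom E (Dom E q) (Dom E \<gamma>2) \<and> \<gamma>2 \<cdot> s = t \<cdot> q"
    using r(1-6) q(1-3) by (intro exI[of _ "q \<cdot> r"] exI[of _ "c2 \<cdot> b2"]) simp
qed (use c \<gamma>3 in \<open>auto simp: loc_exact_def\<close>)

end

context additive_category
begin

lemma kernel_comp_iso:
  assumes "is_kernel E k f" "iso_arr E a" "Cod E a = Dom E k"
  shows "is_kernel E (k \<cdot> a) f"
proof -
  note kD = kernelD[OF assms(1)]
  obtain b where b: "a \<in> Arr E" "b \<in> Arr E" "Dom E b = Cod E a" "Cod E b = Dom E a"
    "b \<cdot> a = Ident E (Dom E a)" "a \<cdot> b = Ident E (Cod E a)"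
    using assms(2) by (rule isoE)
  show ?thesis
  proof (rule kernelI)
    fix t assume t: "t \<in> Arr E" "Cod E t = Dom E f" "f \<cdot> t = Zero E (Dom E t) (Cod E f)"
    obtain u where u: "u \<in> Arr E" "Dom E u = Dom E t" "Cod E u = Dom E k" "k \<cdot> u = t"
      using kernel_factor[OF assms(1) t] .
    have "a \<cdot> (b \<cdot> u) = u" using Comp_append[OF b(6), of u] b(1-4) u(1-3) assms(3) by simp
    then have "(k \<cdot> a) \<cdot> (b \<cdot> u) = t" using b(1-4) u kD(1) assms(3) by simp
    then show "\<exists>w\<in>Hom E (Dom E t) (Dom E (k \<cdot> a)). (k \<cdot> a) \<cdot> w = t"
      using b(1-4) u(1-3) kD(1) assms(3) by (intro bexI[of _ "b \<cdot> u"]) auto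
  next
    fix u v assume uv: "u \<in> Arr E" "v \<in> Arr E" "Dom E u = Dom E v" "Cod E u = Dom E (k \<cdot> a)"
      "Cod E v = Dom E (k \<cdot> a)" "(k \<cdot> a) \<cdot> u = (k \<cdot> a) \<cdot> v"
    have "a \<cdot> u = a \<cdot> v"
      by (rule kernel_mono[OF assms(1)]) (use uv b(1-4) kD(1) assms(3) in simp_all)
    then show "u = v"
      by (rule monicD[OF iso_is_monic[OF assms(2)]]) (use uv(1-5) b(1-4) kD(1) assms(3) in simp_all)
  qed (use b(1-4) kD assms(3) in \<open>simp_all add: Comp_append[OF kD(4)]\<close>)
qed

lemma monic_right_factor:
  assumes "monic (m \<cdot> n)" "m \<in> Arr E" "n \<in> Arr E" "Cod E n = Dom E m"
  shows "monic n"
  unfolding monic_def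
proof (intro conjI allI impI)
  fix u v assume uv: "u \<in> Arr E" "v \<in> Arr E" "Cod E u = Dom E n" "Cod E v = Dom E n"
    "Dom E u = Dom E v" "n \<cdot> u = n \<cdot> v"
  show "u = v"
    by (rule monicD[OF assms(1)]) (use uv assms(2-) in simp_all)
qed (fact assms(3))

end

context deflation_exact_split
begin

lemma loc_exact_monic: "monic m \<Longrightarrow> Dom E m = X \<Longrightarrow> loc_exact (Zero E (zobj E) X) m"
  by (rule loc_exact_kernel[OF kernel_of_monic])

lemma loc_exact_deflation:
  assumes "deflation E g" "Cod E g = Z"
  shows "loc_exact g (Zero E Z (zobj E))"
proof (rule loc_exactI)
  have g: "g \<in> Arr E" "Z \<in> Obj E" using assms deflation_arr by auto
  fix t assume t: "t \<in> Arr E" "Cod E t = Dom E (Zero E Z (zobj E))"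
  then obtain q s where "deflation E q" "q \<in> Arr E" "Cod E q = Dom E t"
    "s \<in> Arr E" "Dom E s = Dom E q" "Cod E s = Dom E g" "g \<cdot> s = t \<cdot> q"
    using deflation_lift[OF assms(1), of t] assms(2) g by auto
  then show "\<exists>q s. deflation E q \<and> Cod E q = Dom E t \<and> s \<in> Hom E (Dom E q) (Dom E g) \<and> g \<cdot> s = t \<cdot> q"
    by auto
qed (use assms deflation_arr[OF assms(1)] in auto)

end

context snake_chase
begin

lemma induced_maps_exist:
  obtains \<kappa>1 \<kappa>2 \<gamma>1 \<gamma>2 where "\<kappa>1 \<in> Hom E K1 K2" "\<kappa>2 \<in> Hom E K2 K3" "\<gamma>1 \<in> Hom E C1 C2" "\<gamma>2 \<in> Hom E C2 C3"
    "k2 \<cdot> \<kappa>1 = \<phi>1 \<cdot> k1" "k3 \<cdot> \<kappa>2 = \<phi>2 \<cdot> k2" "\<gamma>1 \<cdot> c1 = c2 \<cdot> \<psi>1" "\<gamma>2 \<cdot> c2 = c3 \<cdot> \<psi>2"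
proof -
  have "c2 \<cdot> (\<psi>1 \<cdot> f1) = c2 \<cdot> (f2 \<cdot> \<phi>1)" "c3 \<cdot> (\<psi>2 \<cdot> f2) = c3 \<cdot> (f3 \<cdot> \<phi>2)" by (simp_all only: commute)
  then have z: "c2 \<cdot> (\<psi>1 \<cdot> f1) = Zero E A1 C2" "c3 \<cdot> (\<psi>2 \<cdot> f2) = Zero E A2 C3"
    using Comp_append[OF zero_comps(7), of \<phi>1] Comp_append[OF zero_comps(8), of \<phi>2] by simp_all
  obtain \<kappa>1 where "\<kappa>1 \<in> Arr E" "Dom E \<kappa>1 = K1" "Cod E \<kappa>1 = K2" "k2 \<cdot> \<kappa>1 = \<phi>1 \<cdot> k1"
    using kernel_factor[OF ker(2), of "\<phi>1 \<cdot> k1"] by (auto simp: zero_comps)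
  moreover obtain \<kappa>2 where "\<kappa>2 \<in> Arr E" "Dom E \<kappa>2 = K2" "Cod E \<kappa>2 = K3" "k3 \<cdot> \<kappa>2 = \<phi>2 \<cdot> k2"
    using kernel_factor[OF ker(3), of "\<phi>2 \<cdot> k2"] by (auto simp: zero_comps)
  moreover obtain \<gamma>1 where "\<gamma>1 \<in> Arr E" "Dom E \<gamma>1 = C1" "Cod E \<gamma>1 = C2" "\<gamma>1 \<cdot> c1 = c2 \<cdot> \<psi>1"
    using cokernel_factor[OF cok(1), of "c2 \<cdot> \<psi>1"] z by auto
  moreover obtain \<gamma>2 where "\<gamma>2 \<in> Arr E" "Dom E \<gamma>2 = C2" "Cod E \<gamma>2 = C3" "\<gamma>2 \<cdot> c2 = c3 \<cdot> \<psi>2"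
    using cokernel_factor[OF cok(2), of "c3 \<cdot> \<psi>2"] z by auto
  ultimately show thesis using that by simp
qed

end

context deflation_exact_split
begin

text \<open>Exactness at the zero ends is made explicit: \<open>top2\<close> is a deflation, and the
  deflation part of \<open>bot1\<close> is a cokernel of the map from 0, hence invertible, so
  \<open>bot1\<close> itself is a kernel of \<open>bot2\<close>.\<close>

lemma snake_chase_of_long_diagram:
  assumes "long_snake_diagram E S"
  obtains A1 A2 A3 B1 B2 B3 K1 K2 K3 C1 C2 C3 where
    "snake_chase E A1 A2 A3 B1 B2 B3 K1 K2 K3 C1 C2 C3 (top1 S) (top2 S) (bot1 S) (bot2 S) (vert1 S) (vert2 S) (vert3 S)
    (ker1 S) (ker2 S) (ker3 S) (cok1 S) (cok2 S) (cok3 S)"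
proof -
  have D: "snake_diagram E S" and top: "exact_seq E [top1 S, top2 S, Zero E (Cod E (top2 S)) (zobj E)]"
    and bot: "exact_seq E [Zero E (zobj E) (Dom E (bot1 S)), bot1 S, bot2 S]"
    using assms by (auto simp: long_snake_diagram_def)
  have a: "top2 S \<in> Arr E" "bot1 S \<in> Arr E" using D by (auto simp: snake_diagram_def)
  have t2: "deflation E (top2 S)"
    using exact_seq_deflation_before_Zero[OF top, of 1 "Cod E (top2 S)"] a by simp
  have r1: "loc_exact (top1 S) (top2 S)"
    using exact_seq_imp_loc_exact[OF top, of 0] by simp
  obtain r i where ri: "deflation E r" "Cod E r = Dom E i" "bot1 S = i \<cdot> r" "is_kernel E i (bot2 S)"
    "is_cokernel E r (Zero E (zobj E) (Dom E (bot1 S)))"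
    using bot[unfolded exact_seq_def, rule_format, of 1] by auto
  have "iso_arr E r" using cokernel_Zero_iso[OF ri(5)] a by simp
  then have r2: "is_kernel E (bot1 S) (bot2 S)" using kernel_comp_iso[OF ri(4) _ ri(2)] ri(3) by simp
  have "ker1 S \<in> Hom E (Dom E (ker1 S)) (Dom E (vert1 S))" "ker2 S \<in> Hom E (Dom E (ker2 S)) (Dom E (vert2 S))"
    "ker3 S \<in> Hom E (Dom E (ker3 S)) (Dom E (vert3 S))" "cok1 S \<in> Hom E (Cod E (vert1 S)) (Cod E (cok1 S))"
    "cok2 S \<in> Hom E (Cod E (vert2 S)) (Cod E (cok2 S))" "cok3 S \<in> Hom E (Cod E (vert3 S)) (Cod E (cok3 S))"
    using D by (auto simp: snake_diagram_def dest: kernelD cokernelD)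
  then have "snake_chase E (Dom E (vert1 S)) (Dom E (vert2 S)) (Dom E (vert3 S))
    (Cod E (vert1 S)) (Cod E (vert2 S)) (Cod E (vert3 S))
    (Dom E (ker1 S)) (Dom E (ker2 S)) (Dom E (ker3 S)) (Cod E (cok1 S)) (Cod E (cok2 S)) (Cod E (cok3 S))
    (top1 S) (top2 S) (bot1 S) (bot2 S) (vert1 S) (vert2 S) (vert3 S)
    (ker1 S) (ker2 S) (ker3 S) (cok1 S) (cok2 S) (cok3 S)"
    by unfold_locales (use D t2 r1 r2 in \<open>auto simp: snake_diagram_def\<close>)
  then show thesis by (rule that)
qed

text \<open>A morphism of diagrams carries a lift and its preimage to valid data for the target
  diagram, so both composites agree on a cover of K3; that cover is epic.\<close>

lemma natural_connecting_arrow: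
  assumes d: "\<And>S. long_snake_diagram E S \<Longrightarrow> connecting (top2 S) (bot1 S) (vert2 S) (ker3 S) (cok1 S) (\<delta> S)"
  shows "natural_connecting E (long_snake_diagram E) \<delta>"
  unfolding natural_connecting_def
proof (intro conjI allI impI)
  fix S assume "long_snake_diagram E S"
  then show "\<delta> S \<in> Hom E (Dom E (ker3 S)) (Cod E (cok1 S))" using d by (simp add: connecting_def)
next
  fix S S' a1 a2 a3 b1 b2 b3 u v
  assume S: "long_snake_diagram E S" and S': "long_snake_diagram E S'"
    and m: "snake_morphism E S S' a1 a2 a3 b1 b2 b3"
    and "u \<in> Hom E (Dom E (ker3 S)) (Dom E (ker3 S'))" and uk: "ker3 S' \<cdot> u = a3 \<cdot> ker3 S"
    and "v \<in> Hom E (Cod E (cok1 S)) (Cod E (cok1 S'))" and vc: "v \<cdot> cok1 S = cok1 S' \<cdot> b1"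
  then have u: "u \<in> Arr E" "Dom E u = Dom E (ker3 S)" "Cod E u = Dom E (ker3 S')"
    and v: "v \<in> Arr E" "Dom E v = Cod E (cok1 S)" "Cod E v = Cod E (cok1 S')" by auto
  obtain A1 A2 A3 B1 B2 B3 K1 K2 K3 C1 C2 C3 where
    "snake_chase E A1 A2 A3 B1 B2 B3 K1 K2 K3 C1 C2 C3 (top1 S) (top2 S) (bot1 S) (bot2 S)
      (vert1 S) (vert2 S) (vert3 S) (ker1 S) (ker2 S) (ker3 S) (cok1 S) (cok2 S) (cok3 S)"
    using snake_chase_of_long_diagram[OF S] .
  then interpret s: snake_chase E A1 A2 A3 B1 B2 B3 K1 K2 K3 C1 C2 C3 "top1 S" "top2 S" "bot1 S" "bot2 S"
    "vert1 S" "vert2 S" "vert3 S" "ker1 S" "ker2 S" "ker3 S" "cok1 S" "cok2 S" "cok3 S" .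
  obtain A1' A2' A3' B1' B2' B3' K1' K2' K3' C1' C2' C3' where
    "snake_chase E A1' A2' A3' B1' B2' B3' K1' K2' K3' C1' C2' C3' (top1 S') (top2 S') (bot1 S') (bot2 S')
      (vert1 S') (vert2 S') (vert3 S') (ker1 S') (ker2 S') (ker3 S') (cok1 S') (cok2 S') (cok3 S')"
    using snake_chase_of_long_diagram[OF S'] .
  then interpret s': snake_chase E A1' A2' A3' B1' B2' B3' K1' K2' K3' C1' C2' C3' "top1 S'" "top2 S'" "bot1 S'" "bot2 S'"
    "vert1 S'" "vert2 S'" "vert3 S'" "ker1 S'" "ker2 S'" "ker3 S'" "cok1 S'" "cok2 S'" "cok3 S'" .
  have mh: "a2 \<in> Arr E" "Dom E a2 = Dom E (vert2 S)" "Cod E a2 = Dom E (vert2 S')"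
    "a3 \<in> Arr E" "Dom E a3 = Dom E (vert3 S)" "Cod E a3 = Dom E (vert3 S')"
    "b1 \<in> Arr E" "Dom E b1 = Cod E (vert1 S)" "Cod E b1 = Cod E (vert1 S')"
    "b2 \<in> Arr E" "Dom E b2 = Cod E (vert2 S)" "Cod E b2 = Cod E (vert2 S')"
    and mc': "a3 \<cdot> top2 S = top2 S' \<cdot> a2" "b2 \<cdot> bot1 S = bot1 S' \<cdot> b1" "b2 \<cdot> vert2 S = vert2 S' \<cdot> a2"
    using m unfolding snake_morphism_def Hom_iff by blast+
  note mc = mc'[symmetric]
  obtain q a b where q: "deflation E q" "q \<in> Arr E" "Cod E q = K3" "a \<in> Arr E" "b \<in> Arr E"
    "Dom E a = Dom E q" "Dom E b = Dom E q" "Cod E a = A2" "Cod E b = B1"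
    "top2 S \<cdot> a = ker3 S \<cdot> q" "vert2 S \<cdot> a = bot1 S \<cdot> b"
    using s.connecting_lift[of "Ident E K3"] by auto
  have dh: "\<delta> S \<in> Arr E" "Dom E (\<delta> S) = Dom E (ker3 S)" "Cod E (\<delta> S) = Cod E (cok1 S)"
    "\<delta> S' \<in> Arr E" "Dom E (\<delta> S') = Dom E (ker3 S')" "Cod E (\<delta> S') = Cod E (cok1 S')"
    using d[OF S] d[OF S'] by (auto simp: connecting_def)
  have dq: "\<delta> S \<cdot> q = cok1 S \<cdot> b"
    using d[OF S] q by (auto simp: connecting_def)
  have "top2 S' \<cdot> (a2 \<cdot> a) = a3 \<cdot> (top2 S \<cdot> a)"
    using Comp_append[OF mc(1), of a] mh q(1-9) by simp
  also have "\<dots> = ker3 S' \<cdot> (u \<cdot> q)"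
    unfolding q(10) using Comp_append[OF uk, of q] mh q(1-9) u by simp
  finally have 1: "top2 S' \<cdot> (a2 \<cdot> a) = ker3 S' \<cdot> (u \<cdot> q)" .
  have "vert2 S' \<cdot> (a2 \<cdot> a) = b2 \<cdot> (vert2 S \<cdot> a)"
    using Comp_append[OF mc(3), of a] mh q(1-9) by simp
  also have "\<dots> = bot1 S' \<cdot> (b1 \<cdot> b)"
    unfolding q(11) using Comp_append[OF mc(2), of b] mh q(1-9) by simp
  finally have 2: "vert2 S' \<cdot> (a2 \<cdot> a) = bot1 S' \<cdot> (b1 \<cdot> b)" .
  have "\<delta> S' \<cdot> (u \<cdot> q) = cok1 S' \<cdot> (b1 \<cdot> b)"
    using d[OF S', unfolded connecting_def, THEN conjunct2, rule_format, of "u \<cdot> q" "a2 \<cdot> a" "b1 \<cdot> b"]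
      1 2 mh q(1-9) u by simp
  also have "\<dots> = v \<cdot> (\<delta> S \<cdot> q)"
    unfolding dq using Comp_append[OF vc, of b] mh q(1-9) v by simp
  finally have "(\<delta> S' \<cdot> u) \<cdot> q = (v \<cdot> \<delta> S) \<cdot> q" using dh u v q(1-9) by simp
  then show "\<delta> S' \<cdot> u = v \<cdot> \<delta> S"
    by (rule epicD[OF deflation_epic[OF q(1)]]) (use dh u v q(1-9) in simp_all)
qed

end

section \<open>From local exactness to exact sequences\<close>

context snake_maps
begin

lemma long_exact_seq:
  assumes R: "axiom_R3_plus E" and k: "is_kernel E k \<phi>1" and c: "is_cokernel E c \<psi>2" "admissible E \<psi>2"
    and \<kappa>0: "\<kappa>0 \<in> Hom E (Dom E k) K1" "k1 \<cdot> \<kappa>0 = k" and \<gamma>3: "\<gamma>3 \<in> Hom E C3 (Cod E c)" "\<gamma>3 \<cdot> c3 = c"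
  shows "exact_seq E [Zero E (zobj E) (Dom E k), \<kappa>0, \<kappa>1, \<kappa>2, d, \<gamma>1, \<gamma>2, \<gamma>3, Zero E (Cod E c) (zobj E)]"
proof (rule exact_seqI[OF R])
  have cD: "deflation E c" "loc_exact \<psi>2 c" using admissible_cokernel[OF c(2,1)] by auto
  have "monic \<kappa>0"
    by (rule monic_right_factor[of k1]) (use kernel_is_monic[OF k] \<kappa>0 in simp_all)
  then have "loc_exact (Zero E (zobj E) (Dom E k)) \<kappa>0" using loc_exact_monic \<kappa>0(1) by simp
  moreover have "deflation E \<gamma>3"
    by (rule R3_plusD[OF R, of _ c3]) (use cD(1) \<gamma>3 in simp_all)
  then have "loc_exact \<gamma>3 (Zero E (Cod E c) (zobj E))" using loc_exact_deflation \<gamma>3(1) by simp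
  \<comment> \<open>\<open>successively\<close> lets the simplifier split the list into neighbouring
    pairs, in place of a case distinction on \<open>j\<close>.\<close>
  ultimately have "successively loc_exact
      [Zero E (zobj E) (Dom E k), \<kappa>0, \<kappa>1, \<kappa>2, d, \<gamma>1, \<gamma>2, \<gamma>3, Zero E (Cod E c) (zobj E)]"
    using exact_K1[OF k \<kappa>0] exact_K2 exact_K3 exact_C1 exact_C2 exact_C3[OF cD(2) \<gamma>3] by simp
  then show "loc_exact ([Zero E (zobj E) (Dom E k), \<kappa>0, \<kappa>1, \<kappa>2, d, \<gamma>1, \<gamma>2, \<gamma>3, Zero E (Cod E c) (zobj E)] ! j)
      ([Zero E (zobj E) (Dom E k), \<kappa>0, \<kappa>1, \<kappa>2, d, \<gamma>1, \<gamma>2, \<gamma>3, Zero E (Cod E c) (zobj E)] ! Suc j)"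
    if "Suc j < length [Zero E (zobj E) (Dom E k), \<kappa>0, \<kappa>1, \<kappa>2, d, \<gamma>1, \<gamma>2, \<gamma>3, Zero E (Cod E c) (zobj E)]" for j
    using that unfolding successively_conv_nth by blast
qed (use cokernelD[OF c(1)] in \<open>simp_all add: admissible_to_zobj\<close>)

text \<open>At the ends, \<open>exact_K1\<close> is applied with the zero kernel of the monic
  \<open>\<phi>1\<close> and \<open>exact_C3\<close> with the zero map out of B3.\<close>

lemma short_exact_seq:
  assumes R: "axiom_R3_plus E" and "monic \<phi>1" "deflation E \<psi>2"
  shows "exact_seq E [Zero E (zobj E) K1, \<kappa>1, \<kappa>2, d, \<gamma>1, \<gamma>2, Zero E C3 (zobj E)]"
proof (rule exact_seqI[OF R])
  have "loc_exact (Zero E (zobj E) K1) \<kappa>1"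
    by (rule exact_K1[OF kernel_of_monic[OF assms(2)]]) simp_all
  moreover have "loc_exact \<gamma>2 (Zero E C3 (zobj E))"
    by (rule exact_C3[OF loc_exact_deflation[OF assms(3)]]) simp_all
  ultimately have "successively loc_exact [Zero E (zobj E) K1, \<kappa>1, \<kappa>2, d, \<gamma>1, \<gamma>2, Zero E C3 (zobj E)]"
    using exact_K2 exact_K3 exact_C1 exact_C2 by simp
  then show "loc_exact ([Zero E (zobj E) K1, \<kappa>1, \<kappa>2, d, \<gamma>1, \<gamma>2, Zero E C3 (zobj E)] ! j)
      ([Zero E (zobj E) K1, \<kappa>1, \<kappa>2, d, \<gamma>1, \<gamma>2, Zero E C3 (zobj E)] ! Suc j)"
    if "Suc j < length [Zero E (zobj E) K1, \<kappa>1, \<kappa>2, d, \<gamma>1, \<gamma>2, Zero E C3 (zobj E)]" for j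
    using that unfolding successively_conv_nth by blast
qed (simp_all add: admissible_to_zobj)

end

context deflation_exact_split
begin

text \<open>The choice is harmless: naturality follows from the property \<open>connecting\<close>
  alone.\<close>

definition connecting_arrow :: "'m snake \<Rightarrow> 'm" where
  "connecting_arrow S = (SOME d. connecting (top2 S) (bot1 S) (vert2 S) (ker3 S) (cok1 S) d)"

lemma connecting_connecting_arrow:
  assumes "long_snake_diagram E S"
  shows "connecting (top2 S) (bot1 S) (vert2 S) (ker3 S) (cok1 S) (connecting_arrow S)"
  unfolding connecting_arrow_def
  by (rule someI_ex) (rule snake_chase_of_long_diagram[OF assms], rule snake_chase.connecting_exists)

lemma snake_maps_of_long_diagram:
  assumes "long_snake_diagram E S"
  obtains A1 A2 A3 B1 B2 B3 K1 K2 K3 C1 C2 C3 \<kappa>1 \<kappa>2 \<gamma>1 \<gamma>2 where "snake_induced E S \<kappa>1 \<kappa>2 \<gamma>1 \<gamma>2"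
    "snake_maps E A1 A2 A3 B1 B2 B3 K1 K2 K3 C1 C2 C3 (top1 S) (top2 S) (bot1 S) (bot2 S)
      (vert1 S) (vert2 S) (vert3 S) (ker1 S) (ker2 S) (ker3 S) (cok1 S) (cok2 S) (cok3 S)
      \<kappa>1 \<kappa>2 (connecting_arrow S) \<gamma>1 \<gamma>2"
proof -
  obtain A1 A2 A3 B1 B2 B3 K1 K2 K3 C1 C2 C3 where
    s: "snake_chase E A1 A2 A3 B1 B2 B3 K1 K2 K3 C1 C2 C3 (top1 S) (top2 S) (bot1 S) (bot2 S)
      (vert1 S) (vert2 S) (vert3 S) (ker1 S) (ker2 S) (ker3 S) (cok1 S) (cok2 S) (cok3 S)"
    using snake_chase_of_long_diagram[OF assms] .
  obtain \<kappa>1 \<kappa>2 \<gamma>1 \<gamma>2 where m: "\<kappa>1 \<in> Hom E K1 K2" "\<kappa>2 \<in> Hom E K2 K3" "\<gamma>1 \<in> Hom E C1 C2" "\<gamma>2 \<in> Hom E C2 C3"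
    "ker2 S \<cdot> \<kappa>1 = top1 S \<cdot> ker1 S" "ker3 S \<cdot> \<kappa>2 = top2 S \<cdot> ker2 S"
    "\<gamma>1 \<cdot> cok1 S = cok2 S \<cdot> bot1 S" "\<gamma>2 \<cdot> cok2 S = cok3 S \<cdot> bot2 S"
    using snake_chase.induced_maps_exist[OF s] .
  have "snake_induced E S \<kappa>1 \<kappa>2 \<gamma>1 \<gamma>2"
    unfolding snake_induced_def snake_chase.arr[OF s] using m by blast
  moreover have "snake_maps E A1 A2 A3 B1 B2 B3 K1 K2 K3 C1 C2 C3 (top1 S) (top2 S) (bot1 S) (bot2 S)
      (vert1 S) (vert2 S) (vert3 S) (ker1 S) (ker2 S) (ker3 S) (cok1 S) (cok2 S) (cok3 S)
      \<kappa>1 \<kappa>2 (connecting_arrow S) \<gamma>1 \<gamma>2"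
    using connecting_connecting_arrow[OF assms] by (intro snake_maps.intro snake_maps_axioms.intro s m)
  ultimately show thesis by (rule that)
qed

lemma R3_plus_imp_snake:
  assumes R: "axiom_R3_plus E"
  shows "snake_lemma E"
  unfolding snake_lemma_def
proof (intro exI[of _ connecting_arrow] conjI allI impI)
  show "natural_connecting E (long_snake_diagram E) connecting_arrow"
    by (rule natural_connecting_arrow) (rule connecting_connecting_arrow)
  fix S k c assume S: "long_snake_diagram E S" and k: "is_kernel E k (top1 S)" and c: "is_cokernel E c (bot2 S)"
  obtain A1 A2 A3 B1 B2 B3 K1 K2 K3 C1 C2 C3 \<kappa>1 \<kappa>2 \<gamma>1 \<gamma>2 where i: "snake_induced E S \<kappa>1 \<kappa>2 \<gamma>1 \<gamma>2"
    and sm: "snake_maps E A1 A2 A3 B1 B2 B3 K1 K2 K3 C1 C2 C3 (top1 S) (top2 S) (bot1 S) (bot2 S)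
      (vert1 S) (vert2 S) (vert3 S) (ker1 S) (ker2 S) (ker3 S) (cok1 S) (cok2 S) (cok3 S)
      \<kappa>1 \<kappa>2 (connecting_arrow S) \<gamma>1 \<gamma>2"
    using snake_maps_of_long_diagram[OF S] .
  interpret s: snake_maps E A1 A2 A3 B1 B2 B3 K1 K2 K3 C1 C2 C3 "top1 S" "top2 S" "bot1 S" "bot2 S"
    "vert1 S" "vert2 S" "vert3 S" "ker1 S" "ker2 S" "ker3 S" "cok1 S" "cok2 S" "cok3 S"
    \<kappa>1 \<kappa>2 "connecting_arrow S" \<gamma>1 \<gamma>2
    by (rule sm)
  have kD: "k \<in> Arr E" "Cod E k = A1" "top1 S \<cdot> k = Zero E (Dom E k) A2" using kernelD[OF k] by auto
  have cD: "c \<in> Arr E" "Dom E c = B3" "c \<cdot> bot2 S = Zero E B2 (Cod E c)" using cokernelD[OF c] by auto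
  \<comment> \<open>To obtain \<kappa>0, the vanishing of \<open>vert1 S \<cdot> k\<close> is tested
    after the monic \<open>bot1 S\<close>.\<close>
  have "bot1 S \<cdot> (vert1 S \<cdot> k) = vert2 S \<cdot> (top1 S \<cdot> k)" using kD(1,2) by simp
  also have "\<dots> = bot1 S \<cdot> Zero E (Dom E k) B1" unfolding kD(3) using kD(1,2) by simp
  finally have "vert1 S \<cdot> k = Zero E (Dom E k) B1"
    by (rule kernel_mono[OF s.row2, rotated 5]) (use kD(1,2) in simp_all)
  then obtain \<kappa>0 where \<kappa>0: "\<kappa>0 \<in> Hom E (Dom E k) K1" "ker1 S \<cdot> \<kappa>0 = k"
    using kernel_factor[OF s.ker(1), of k] kD(1,2) by auto
  \<comment> \<open>For \<gamma>3, the vanishing of \<open>c \<cdot> vert3 S\<close> is tested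
    before it, on the epic \<open>top2 S\<close>.\<close>
  have "(c \<cdot> vert3 S) \<cdot> top2 S = (c \<cdot> bot2 S) \<cdot> vert2 S" using cD(1,2) by (simp add: s.commute)
  also have "\<dots> = Zero E A3 (Cod E c) \<cdot> top2 S" unfolding cD(3) using cD(1) by simp
  finally have "c \<cdot> vert3 S = Zero E A3 (Cod E c)"
    by (rule epicD[OF deflation_epic[OF s.\<phi>2]]) (use cD(1,2) in simp_all)
  then obtain \<gamma>3 where \<gamma>3: "\<gamma>3 \<in> Hom E C3 (Cod E c)" "\<gamma>3 \<cdot> cok3 S = c"
    using cokernel_factor[OF s.cok(3), of c] cD(1,2) by auto
  have "admissible E (bot2 S)" using S by (simp add: long_snake_diagram_def)
  then have "exact_seq E [Zero E (zobj E) (Dom E k), \<kappa>0, \<kappa>1, \<kappa>2, connecting_arrow S, \<gamma>1, \<gamma>2, \<gamma>3,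
      Zero E (Cod E c) (zobj E)]"
    by (rule s.long_exact_seq[OF R k c _ \<kappa>0 \<gamma>3])
  then show "\<exists>\<kappa>1 \<kappa>2 \<gamma>1 \<gamma>2. \<exists>\<kappa>0\<in>Hom E (Dom E k) (Dom E (ker1 S)). \<exists>\<gamma>3\<in>Hom E (Cod E (cok3 S)) (Cod E c).
      snake_induced E S \<kappa>1 \<kappa>2 \<gamma>1 \<gamma>2 \<and> ker1 S \<cdot> \<kappa>0 = k \<and> \<gamma>3 \<cdot> cok3 S = c \<and>
      exact_seq E [Zero E (zobj E) (Dom E k), \<kappa>0, \<kappa>1, \<kappa>2, connecting_arrow S, \<gamma>1, \<gamma>2, \<gamma>3,
        Zero E (Cod E c) (zobj E)]"
    using i \<kappa>0 \<gamma>3 unfolding s.arr by blast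
qed

lemma R3_plus_imp_short_snake:
  assumes R: "axiom_R3_plus E"
  shows "short_snake_lemma E"
  unfolding short_snake_lemma_def
proof (intro exI[of _ connecting_arrow] conjI allI impI)
  have "natural_connecting E (long_snake_diagram E) connecting_arrow"
    by (rule natural_connecting_arrow) (rule connecting_connecting_arrow)
  then show "natural_connecting E (short_snake_diagram E) connecting_arrow"
    unfolding natural_connecting_def using short_snake_diagram_imp_long by blast
  fix S assume S: "short_snake_diagram E S"
  obtain A1 A2 A3 B1 B2 B3 K1 K2 K3 C1 C2 C3 \<kappa>1 \<kappa>2 \<gamma>1 \<gamma>2 where i: "snake_induced E S \<kappa>1 \<kappa>2 \<gamma>1 \<gamma>2"
    and sm: "snake_maps E A1 A2 A3 B1 B2 B3 K1 K2 K3 C1 C2 C3 (top1 S) (top2 S) (bot1 S) (bot2 S)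
      (vert1 S) (vert2 S) (vert3 S) (ker1 S) (ker2 S) (ker3 S) (cok1 S) (cok2 S) (cok3 S)
      \<kappa>1 \<kappa>2 (connecting_arrow S) \<gamma>1 \<gamma>2"
    using snake_maps_of_long_diagram[OF short_snake_diagram_imp_long[OF S]] .
  interpret s: snake_maps E A1 A2 A3 B1 B2 B3 K1 K2 K3 C1 C2 C3 "top1 S" "top2 S" "bot1 S" "bot2 S"
    "vert1 S" "vert2 S" "vert3 S" "ker1 S" "ker2 S" "ker3 S" "cok1 S" "cok2 S" "cok3 S"
    \<kappa>1 \<kappa>2 "connecting_arrow S" \<gamma>1 \<gamma>2
    by (rule sm)
  have "monic (top1 S)" "deflation E (bot2 S)"
    using S inflation_monic by (auto simp: short_snake_diagram_def deflation_def inflation_def)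
  then show "\<exists>\<kappa>1 \<kappa>2 \<gamma>1 \<gamma>2. snake_induced E S \<kappa>1 \<kappa>2 \<gamma>1 \<gamma>2 \<and>
      exact_seq E [Zero E (zobj E) (Dom E (ker1 S)), \<kappa>1, \<kappa>2, connecting_arrow S, \<gamma>1, \<gamma>2,
        Zero E (Cod E (cok3 S)) (zobj E)]"
    using i s.short_exact_seq[OF R] unfolding s.arr by blast
qed

text \<open>The ker-coker-sequence is the kernel-cokernel sequence of the snake diagram with rows
  \<open>A \<rightarrow> B \<rightarrow> coker f\<close> and \<open>C = C \<rightarrow> 0\<close> and vertical arrows \<open>h\<close>, \<open>g\<close> and \<open>0\<close>.\<close>

lemma R3_plus_imp_ker_coker_sequence:
  assumes R: "axiom_R3_plus E"
  shows "ker_coker_sequence_property E"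
  unfolding ker_coker_sequence_property_def Let_def
proof (intro allI ballI impI)
  fix A B C f g kf kg kh cf cg ch
  assume fg: "f \<in> Hom E A B" "g \<in> Hom E B C"
    and adm: "admissible E f" "admissible E g" "admissible E (g \<cdot> f)"
    and ker: "is_kernel E kf f" "is_kernel E kg g" "is_kernel E kh (g \<cdot> f)"
    and cok: "is_cokernel E cf f" "is_cokernel E cg g" "is_cokernel E ch (g \<cdot> f)"
  have f: "f \<in> Arr E" "Dom E f = A" "Cod E f = B" and g: "g \<in> Arr E" "Dom E g = B" "Cod E g = C"
    using fg by auto
  obtain D K K' Q Q' where names: "D = Cod E cf" "K = Dom E kh" "K' = Dom E kg" "Q = Cod E ch" "Q' = Cod E cg"
    by blast
  have O: "A \<in> Obj E" "B \<in> Obj E" "C \<in> Obj E" using f g by auto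
  have kfD: "kf \<in> Arr E" "Cod E kf = A" "f \<cdot> kf = Zero E (Dom E kf) B" using kernelD[OF ker(1)] f by auto
  have kgD: "kg \<in> Arr E" "Cod E kg = B" "Dom E kg = K'" using kernelD[OF ker(2)] g names by auto
  have khD: "kh \<in> Arr E" "Cod E kh = A" "Dom E kh = K" using kernelD[OF ker(3)] f g names by auto
  have cfD: "cf \<in> Arr E" "Dom E cf = B" "Cod E cf = D" using cokernelD[OF cok(1)] f names by auto
  have cgD: "cg \<in> Arr E" "Dom E cg = C" "Cod E cg = Q'" using cokernelD[OF cok(2)] g names by auto
  have chD: "ch \<in> Arr E" "Dom E ch = C" "Cod E ch = Q" using cokernelD[OF cok(3)] f g names by auto
  let ?Z = "zobj E"
  have D: "D \<in> Obj E" using cfD by auto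
  \<comment> \<open>The third column is coker f \<rightarrow> 0, with kernel coker f and cokernel 0.
    So the connecting map goes from coker f to coker h, as required of \<open>d\<close>.\<close>
  interpret s: snake_chase E A B D C C ?Z K K' D Q Q' ?Z
    f cf "Ident E C" "Zero E C ?Z" "g \<cdot> f" g "Zero E D ?Z" kh kg "Ident E D" ch cg "Ident E ?Z"
    by unfold_locales
      (use f g kgD khD cfD cgD chD O D ker cok adm admissible_cokernel[OF adm(1) cok(1)] in
        \<open>simp_all add: kernel_Zero cokernel_Zero admissible_to_zobj\<close>)
  obtain b \<kappa>2 e \<gamma>2 where m: "b \<in> Hom E K K'" "\<kappa>2 \<in> Hom E K' D"
    "e \<in> Hom E Q Q'" "\<gamma>2 \<in> Hom E Q' ?Z"
    "kg \<cdot> b = f \<cdot> kh" "Ident E D \<cdot> \<kappa>2 = cf \<cdot> kg" "e \<cdot> ch = cg \<cdot> Ident E C" "\<gamma>2 \<cdot> cg = Ident E ?Z \<cdot> Zero E C ?Z"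
    using s.induced_maps_exist .
  obtain d where d: "connecting cf (Ident E C) g (Ident E D) ch d" using s.connecting_exists by blast
  interpret sm: snake_maps E A B D C C ?Z K K' D Q Q' ?Z
    f cf "Ident E C" "Zero E C ?Z" "g \<cdot> f" g "Zero E D ?Z" kh kg "Ident E D" ch cg "Ident E ?Z" b \<kappa>2 d e \<gamma>2
    by (intro snake_maps.intro snake_maps_axioms.intro s.snake_chase_axioms m d)
  have \<kappa>2: "\<kappa>2 = cf \<cdot> kg" using m(2,6) by simp
  have \<gamma>2: "\<gamma>2 = Zero E Q' ?Z" using to_zobj_eq[of \<gamma>2] m(4) by simp
  \<comment> \<open>Evaluate the connecting map at \<open>cf\<close>, with the identity of B as lift
    and \<open>g\<close> as preimage.\<close>
  have "d \<cdot> cf = ch \<cdot> g"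
    by (rule sm.connD[of cf "Ident E B" g]) (use f g cfD O in simp_all)
  moreover have "(g \<cdot> f) \<cdot> kf = Zero E (Dom E kf) (Cod E (g \<cdot> f))" using kfD f g by simp
  then obtain a where a: "a \<in> Hom E (Dom E kf) K" "kh \<cdot> a = kf"
    using kernel_factor[OF ker(3), of kf] kfD f g by auto
  moreover have "exact_seq E [Zero E ?Z (Dom E kf), a, b, cf \<cdot> kg, d, e, Zero E Q' ?Z]"
  proof (rule exact_seqI[OF R])
    have "monic a"
      by (rule monic_right_factor[of kh]) (use kernel_is_monic[OF ker(1)] a khD in simp_all)
    then have "loc_exact (Zero E ?Z (Dom E kf)) a" using loc_exact_monic a(1) by simp
    then have "successively loc_exact [Zero E ?Z (Dom E kf), a, b, cf \<cdot> kg, d, e, Zero E Q' ?Z]"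
      using sm.exact_K1[OF ker(1) a] sm.exact_K2 sm.exact_K3 sm.exact_C1 sm.exact_C2 unfolding \<kappa>2 \<gamma>2 by simp
    then show "loc_exact ([Zero E ?Z (Dom E kf), a, b, cf \<cdot> kg, d, e, Zero E Q' ?Z] ! j)
        ([Zero E ?Z (Dom E kf), a, b, cf \<cdot> kg, d, e, Zero E Q' ?Z] ! Suc j)"
      if "Suc j < length [Zero E ?Z (Dom E kf), a, b, cf \<cdot> kg, d, e, Zero E Q' ?Z]" for j
      using that unfolding successively_conv_nth by blast
  qed (use cgD in \<open>simp_all add: admissible_to_zobj\<close>)
  moreover have "d \<in> Hom E D Q" "e \<cdot> ch = cg" using d m(7) cgD by (simp_all add: connecting_def)
  ultimately show "\<exists>a\<in>Hom E (Dom E kf) (Dom E kh). \<exists>b\<in>Hom E (Dom E kh) (Dom E kg).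
      \<exists>d\<in>Hom E (Cod E cf) (Cod E ch). \<exists>e\<in>Hom E (Cod E ch) (Cod E cg).
        kh \<cdot> a = kf \<and> kg \<cdot> b = f \<cdot> kh \<and> d \<cdot> cf = ch \<cdot> g \<and> e \<cdot> ch = cg \<and>
        exact_seq E [Zero E (zobj E) (Dom E kf), a, b, cf \<cdot> kg, d, e, Zero E (Cod E cg) (zobj E)]"
    unfolding kgD(3) khD(3) cfD(3) cgD(3) chD(3) using m(1,3,5) by blast
qed

end

theorem theorem1p2:
  fixes E :: "('o, 'm) conflation_structure"
  assumes "deflation_exact_category E"
    and "axiom_R0_star E"
  shows "(axiom_R3_plus E \<longleftrightarrow> weakly_idempotent_complete E \<and> axiom_R3 E) \<and>
         (axiom_R3_plus E \<longleftrightarrow> zero_summand_cancellation E) \<and>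
         (axiom_R3_plus E \<longleftrightarrow> deflation_criterion E) \<and>
         (axiom_R3_plus E \<longleftrightarrow> ker_coker_sequence_property E) \<and>
         (axiom_R3_plus E \<longleftrightarrow> short_snake_lemma E) \<and>
         (axiom_R3_plus E \<longleftrightarrow> snake_lemma E) \<and>
         (axiom_R3_plus E \<longleftrightarrow> deflations_closed_under_retracts E) \<and>
         (axiom_R3_plus E \<longleftrightarrow> deflations_closed_under_summands E)"
proof -
  interpret deflation_exact_split E
    using assms by (simp add: deflation_exact_split_def deflation_exact_split_axioms_def)
  \<comment> \<open>A cycle: R3+ gives retracts, these give summands, these give cancellation of a
    zero summand, and this gives R3+ back.\<close>
  have "axiom_R3_plus E \<longleftrightarrow> deflations_closed_under_retracts E"
    "axiom_R3_plus E \<longleftrightarrow> deflations_closed_under_summands E"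
    using R3_plus_imp_closed_under_retracts closed_under_retracts_imp_summands
      closed_under_summands_imp_zero_summand_cancellation R3_plus_iff_zero_summand_cancellation by blast+
  then show ?thesis
    using R3_plus_iff_weakly_idempotent_complete_R3 R3_plus_iff_zero_summand_cancellation
      R3_plus_iff_deflation_criterion R3_plus_imp_ker_coker_sequence ker_coker_sequence_imp_R3_plus
      R3_plus_imp_short_snake short_snake_imp_R3_plus R3_plus_imp_snake snake_imp_R3_plus by blast
qed

end
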